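(* Assume $\lim_{n\to\infty}X'X/n=Q$ exists and is positive definite, and let $\beta^{(n)}$ be a sequence in $\mathbb{R}^k$ such that either $\|\sqrt n\beta_2^{(n)}\|\to\infty$ or $\sqrt n\beta_2^{(n)}\to\gamma\in\mathbb{R}^{k_2}$. Let $f_\infty=f_{\infty,\infty}$ in the first case and $f_\infty=f_{\infty,\gamma}$ in the second case. Then $\int_{\mathbb{R}^k}|f_{n,\beta^{(n)},\sigma}(t)-f_\infty(t)|\,dt\to0$ as $n\to\infty$. Consequently the cdf $F_{n,\beta^{(n)},\sigma}(t)=\mathbb{P}_{n,\beta^{(n)},\sigma}(\sqrt n(\tilde\beta-\beta^{(n)})\le t)$ converges in total variation distance to the cdf corresponding to $f_\infty$.
   Context: Setup: for each sample size $n$, $Y=X\beta+u$, where $Y$ is $n\times1$, $X$ is a non-stochastic $n\times k$ matrix of full column rank $k$ (so $n\ge k$), $k>1$, and $u\sim N(0,\sigma^2I_n)$ with $0<\sigma^2<\infty$ known. $\mathbb{P}_{n,\beta,\sigma}$ denotes the distribution of $Y$. Partition $X=[X_1:X_2]$, $\beta=(\beta_1',\beta_2')'$ commensurably, $X_i$ having $k_i\ge1$ columns; $Q$ is partitioned conformably into $Q_{11},Q_{12},Q_{21},Q_{22}$. $\hat\beta(R)=\big(((X_1'X_1)^{-1}X_1'Y)',0_{1\times k_2}\big)'$, $\hat\beta(U)=(X'X)^{-1}X'Y$. For $\alpha>0$, $\tilde\beta=\hat\lambda\hat\beta(R)+(1-\hat\lambda)\hat\beta(U)$ with $\hat\lambda=\big[1+\exp(-2\alpha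 k_2)\exp(\alpha\|X\hat\beta(R)-X\hat\beta(U)\|^2/\sigma^2)\big]^{-1}$. The inequality $\le$ between vectors is componentwise. $f_{n,\beta,\sigma}$ is the Lebesgue density of $\sqrt n(\tilde\beta-\beta)$ under $\mathbb{P}_{n,\beta,\sigma}$ (it exists). $f_{\infty,\infty}$ is the $N(0,\sigma^2Q^{-1})$ density. For $\gamma\in\mathbb{R}^{k_2}$, $f_{\infty,\gamma}$ is the density of $B_\infty\gamma+C_\infty Z_1+[1+\exp(2\alpha k_2)\exp(-\alpha\|Z_2+(Q_{22}-Q_{21}Q_{11}^{-1}Q_{12})^{1/2}\gamma\|^2/\sigma^2)]^{-1}\{D_\infty Z_2-B_\infty\gamma\}$, where $B_\infty=\begin{bmatrix}Q_{11}^{-1}Q_{12}\\-I_{k_2}\end{bmatrix}$, $C_\infty=\begin{bmatrix}Q_{11}^{-1/2}\\0\end{bmatrix}$, $D_\infty=\begin{bmatrix}-Q_{11}^{-1}Q_{12}(Q_{22}-Q_{21}Q_{11}^{-1}Q_{12})^{-1/2}\\(Q_{22}-Q_{21}Q_{11}^{-1}Q_{12})^{-1/2}\end{bmatrix}$, $Z_1\sim N(0,\sigma^2I_{k_1})$ and $Z_2\sim N(0,\sigma^2I_{k_2})$ independent ($A^{1/2}$: symmetric positive definite root). This distribution is absolutely continuous. *)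

theory Defs
  imports "HOL-Analysis.Analysis" "HOL-Probability.Probability"
begin

text \<open>Vectors in R^k with k = k1 + k2 are represented as real^('k1::finite + 'k2::finite);
  the Inl-indices form the first block (beta_1, X_1), the Inr-indices the second.\<close>

definition vjoin :: "real^'a \<Rightarrow> real^'b \<Rightarrow> real^('a::finite + 'b::finite)" where
  "vjoin a b = (\<chi> i. case i of Inl p \<Rightarrow> a $ p | Inr q \<Rightarrow> b $ q)"

definition vfst :: "real^('a::finite + 'b::finite) \<Rightarrow> real^'a" where
  "vfst v = (\<chi> p. v $ Inl p)"

definition vsnd :: "real^('a::finite + 'b::finite) \<Rightarrow> real^'b" where
  "vsnd v = (\<chi> q. v $ Inr q)"

definition blk11 :: "real^('a::finite + 'b::finite)^('a::finite + 'b::finite) \<Rightarrow> real^'a^'a" where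
  "blk11 Q = (\<chi> i j. Q $ Inl i $ Inl j)"
definition blk12 :: "real^('a::finite + 'b::finite)^('a::finite + 'b::finite) \<Rightarrow> real^'b^'a" where
  "blk12 Q = (\<chi> i j. Q $ Inl i $ Inr j)"
definition blk21 :: "real^('a::finite + 'b::finite)^('a::finite + 'b::finite) \<Rightarrow> real^'a^'b" where
  "blk21 Q = (\<chi> i j. Q $ Inr i $ Inl j)"
definition blk22 :: "real^('a::finite + 'b::finite)^('a::finite + 'b::finite) \<Rightarrow> real^'b^'b" where
  "blk22 Q = (\<chi> i j. Q $ Inr i $ Inr j)"

definition posdef :: "real^'n^'n \<Rightarrow> bool" where
  "posdef A \<longleftrightarrow> transpose A = A \<and> (\<forall>x. x \<noteq> 0 \<longrightarrow> x \<bullet> (A *v x) > 0)"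

definition psd_sqrt :: "real^'n^'n \<Rightarrow> real^'n^'n" where
  "psd_sqrt A = (THE B. posdef B \<and> B ** B = A)"

text \<open>A design matrix of sample size n is given by its rows Xn 0, ..., Xn (n-1).\<close>

definition full_col_rank :: "(nat \<Rightarrow> real^'k) \<Rightarrow> nat \<Rightarrow> bool" where
  "full_col_rank Xn n \<longleftrightarrow> (\<forall>c. (\<forall>i<n. Xn i \<bullet> c = 0) \<longrightarrow> c = 0)"

definition gram :: "(nat \<Rightarrow> real^'k) \<Rightarrow> nat \<Rightarrow> real^'k^'k" where
  "gram Xn n = (\<chi> a b. \<Sum>i<n. Xn i $ a * Xn i $ b)"

definition xty :: "(nat \<Rightarrow> real^'k) \<Rightarrow> nat \<Rightarrow> (nat \<Rightarrow> real) \<Rightarrow> real^'k" where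
  "xty Xn n Y = (\<Sum>i<n. Y i *\<^sub>R Xn i)"

definition beta_U :: "(nat \<Rightarrow> real^'k) \<Rightarrow> nat \<Rightarrow> (nat \<Rightarrow> real) \<Rightarrow> real^'k" where
  "beta_U Xn n Y = matrix_inv (gram Xn n) *v xty Xn n Y"

definition beta_R :: "(nat \<Rightarrow> real^('k1::finite + 'k2::finite)) \<Rightarrow> nat \<Rightarrow> (nat \<Rightarrow> real) \<Rightarrow> real^('k1::finite + 'k2::finite)" where
  "beta_R Xn n Y = vjoin (beta_U (\<lambda>i. vfst (Xn i)) n Y) 0"

text \<open>The estimator beta-tilde; sigma is the (known) standard deviation, so sigma^2 is the variance.\<close>
definition beta_tilde :: "real \<Rightarrow> real \<Rightarrow> (nat \<Rightarrow> real^('k1::finite + 'k2::finite)) \<Rightarrow> nat \<Rightarrow> (nat \<Rightarrow> real)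
    \<Rightarrow> real^('k1::finite + 'k2::finite)" where
  "beta_tilde \<alpha> \<sigma> Xn n Y =
     (let bR = beta_R Xn n Y; bU = beta_U Xn n Y;
          d = (\<Sum>i<n. (Xn i \<bullet> (bR - bU))\<^sup>2);
          lam = 1 / (1 + exp (- 2 * \<alpha> * real CARD('k2)) * exp (\<alpha> * d / \<sigma>\<^sup>2))
      in lam *\<^sub>R bR + (1 - lam) *\<^sub>R bU)"

definition law_n :: "real \<Rightarrow> real \<Rightarrow> (nat \<Rightarrow> real^('k1::finite + 'k2::finite)) \<Rightarrow> nat \<Rightarrow> real^('k1::finite + 'k2::finite)
    \<Rightarrow> (real^('k1::finite + 'k2::finite)) measure" where
  "law_n \<alpha> \<sigma> Xn n \<beta> =
     distr (PiM {..<n} (\<lambda>_. density lborel (\<lambda>x. ennreal (normal_density 0 \<sigma> x)))) borel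
       (\<lambda>u. sqrt (real n) *\<^sub>R (beta_tilde \<alpha> \<sigma> Xn n (\<lambda>i. Xn i \<bullet> \<beta> + u i) - \<beta>))"

definition gauss_density :: "real^'k^'k \<Rightarrow> real^'k \<Rightarrow> real" where
  "gauss_density S t = exp (- (t \<bullet> (matrix_inv S *v t)) / 2) / sqrt ((2 * pi) ^ CARD('k) * det S)"

definition lim_var :: "real^('k1::finite + 'k2::finite)^('k1::finite + 'k2::finite) \<Rightarrow> real \<Rightarrow> real \<Rightarrow> real^'k2 \<Rightarrow> real^'k1 \<Rightarrow> real^'k2
    \<Rightarrow> real^('k1::finite + 'k2::finite)" where
  "lim_var Q \<sigma> \<alpha> \<gamma> Z1 Z2 =
     (let Q11i = matrix_inv (blk11 Q);
          S = blk22 Q - blk21 Q ** Q11i ** blk12 Q;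
          Bg = vjoin (Q11i ** blk12 Q *v \<gamma>) (- \<gamma>);
          CZ = vjoin (psd_sqrt (matrix_inv (blk11 Q)) *v Z1) 0;
          DZ = vjoin (- (Q11i ** blk12 Q ** psd_sqrt (matrix_inv S) *v Z2)) (psd_sqrt (matrix_inv S) *v Z2);
          w = 1 / (1 + exp (2 * \<alpha> * real CARD('k2)) * exp (- \<alpha> * (norm (Z2 + psd_sqrt S *v \<gamma>))\<^sup>2 / \<sigma>\<^sup>2))
      in Bg + CZ + w *\<^sub>R (DZ - Bg))"

definition lim_law :: "real^('k1::finite + 'k2::finite)^('k1::finite + 'k2::finite) \<Rightarrow> real \<Rightarrow> real \<Rightarrow> real^'k2 \<Rightarrow> (real^('k1::finite + 'k2::finite)) measure" where
  "lim_law Q \<sigma> \<alpha> \<gamma> =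
     distr (PiM (UNIV :: ('k1::finite + 'k2::finite) set) (\<lambda>_. density lborel (\<lambda>x. ennreal (normal_density 0 \<sigma> x)))) borel
       (\<lambda>z. lim_var Q \<sigma> \<alpha> \<gamma> (\<chi> p. z (Inl p)) (\<chi> q. z (Inr q)))"

end

theory Submission
  imports Defs
begin

text \<open>
  With \<open>b = sqrt n (\<beta>_U - \<beta>)\<close>, which is \<open>N(0, \<sigma>\<^sup>2 Q_n\<^sup>-\<^sup>1)\<close> for \<open>Q_n = X'X / n\<close>, and \<open>\<gamma>_n = sqrt n \<beta>_2\<close>, the scaled
  estimation error of the averaged estimator is \<open>G_n(b)\<close> for a smooth bijection \<open>G_n\<close> that depends on
  \<open>Q_n\<close> and \<open>\<gamma>_n\<close> only; the same map with \<open>Q\<close>, \<open>\<gamma>\<close> and \<open>b ~ N(0, \<sigma>\<^sup>2 Q\<^sup>-\<^sup>1)\<close> produces the limit law.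
  Total variation is invariant under bijections. Hence it suffices to compare the law of \<open>H_n(b)\<close> with a
  Gaussian law, where \<open>H_n = G\<^sup>-\<^sup>1 \<circ> G_n\<close> if \<open>\<gamma>_n\<close> converges and \<open>H_n = G_n\<close> if it diverges. In both cases
  \<open>H_n\<close> and its Jacobian determinant converge pointwise to the identity and to 1, so change of variables
  and Scheffe's lemma give convergence in total variation, which for laws with densities is
  convergence of the densities in \<open>L\<^sup>1\<close>.
\<close>

section \<open>Change of variables\<close>

text \<open>The inverse of \<open>G_n\<close> is not explicit, which makes the density of
  \<open>G_n(b)\<close> awkward to follow pointwise. Comparing laws moves the work to the source
  side, where only the forward map, its Jacobian and the pull-back of the target density occur.
  Bijectivity comes from a radial structure: the second block, shifted by \<open>\<gamma>_n\<close>,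
  is multiplied by a positive factor that does not decrease with its quadratic form, and the first
  block receives a vector determined by the second. Undoing \<open>G\<close> in the convergent case
  makes the target Gaussian there too, so that one comparison lemma serves both cases. In the
  divergent case the weight of the restricted estimator vanishes faster than the displacement it
  multiplies can grow. That \<open>b\<close> is Gaussian also needs an argument, since a sample may
  have more errors than coefficients and the map from errors to \<open>b\<close> is then not
  invertible: as many rows as coefficients are selected to form a basis, and the remaining rows
  enter one at a time, each by a rank-one update of the covariance.\<close>

text \<open>
  The change of variables theorem of HOL-Analysis is restricted to wellordered index types, which excludes
  sum types. It is transported along an enumeration of the index type.
\<close>

typedef 'a idx = "{..<CARD('a::finite)}"
  by (rule exI[of _ 0]) simp

instance idx :: (finite) finite
proof
  show "finite (UNIV :: 'a idx set)"
    unfolding type_definition.univ[OF type_definition_idx] by simp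
qed

instantiation idx :: (finite) linorder
begin
definition "x < y \<longleftrightarrow> Rep_idx x < Rep_idx y"
definition "x \<le> y \<longleftrightarrow> Rep_idx x \<le> Rep_idx y"
instance
  by intro_classes (auto simp: less_eq_idx_def less_idx_def Rep_idx_inject)
end

instance idx :: (finite) wellorder
proof -
  have "wf {(x :: 'a idx, y). x < y}"
    by (auto simp: trancl_def tranclp_less intro!: finite_acyclic_wf acyclicI)
  then show "OFCLASS('a idx, wellorder_class)"
    by (rule wf_wellorderI) intro_classes
qed

lemma card_idx: "CARD('a::finite idx) = CARD('a)"
  unfolding type_definition.card[OF type_definition_idx] by simp

definition idx_of :: "'a::finite \<Rightarrow> 'a idx" where
  "idx_of = (SOME f. bij f)"

lemma bij_idx_of: "bij (idx_of :: 'a::finite \<Rightarrow> 'a idx)"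
proof -
  have "\<exists>f :: 'a \<Rightarrow> 'a idx. bij f"
    using card_idx[where 'a='a] by (intro finite_same_card_bij) auto
  then show ?thesis unfolding idx_of_def by (rule someI_ex)
qed

lemma nn_integral_change_of_variables_wellorder:
  fixes g :: "real^'m::{finite,wellorder} \<Rightarrow> real^'m::_" and h :: "real^'m::_ \<Rightarrow> real"
  assumes der: "\<And>x. (g has_derivative g' x) (at x)" and inj: "inj g"
    and h: "integrable lborel h" "\<And>y. 0 \<le> h y"
  shows "(\<integral>\<^sup>+x. ennreal (\<bar>det (matrix (g' x))\<bar> * h (g x)) \<partial>lborel)
         = (\<integral>\<^sup>+y. ennreal (h y) * indicator (range g) y \<partial>lborel)"
proof -
  have cont: "continuous_on UNIV g"
    by (meson der has_derivative_continuous continuous_at_imp_continuous_on)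
  \<comment> \<open>Invariance of domain makes the range open, hence measurable, although
    \<open>g\<close> is not assumed surjective.\<close>
  have open_range: "open (range g)"
    by (rule invariance_of_domain[OF cont _ inj]) simp
  \<comment> \<open>The change of variables theorem speaks of vector-valued integrands, so the
    scalar \<open>h\<close> is wrapped as a vector of length one.\<close>
  define F :: "real^'m::_ \<Rightarrow> real^1" where "F y = vec (h y)" for y
  have "h absolutely_integrable_on UNIV"
    using h(1) by (simp add: set_integrable_def integrable_completion)
  then have habs: "h absolutely_integrable_on range g"
    by (rule set_integrable_subset) (use open_range in auto)
  have F_abs: "F absolutely_integrable_on range g"
    using habs unfolding F_def
    by (subst absolutely_integrable_componentwise_iff) (simp add: Basis_vec_def inner_axis)
  have D: "(\<lambda>x. \<bar>det (matrix (g' x))\<bar> *\<^sub>R F (g x)) absolutely_integrable_on UNIV \<and>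
           integral UNIV (\<lambda>x. \<bar>det (matrix (g' x))\<bar> *\<^sub>R F (g x)) = integral (range g) F"
    using has_absolute_integral_change_of_variables[of UNIV g g' F "integral (range g) F"]
      der inj F_abs by (simp add: has_derivative_at_withinI)
  then have int1: "(\<lambda>x. \<bar>det (matrix (g' x))\<bar> *\<^sub>R F (g x)) integrable_on UNIV"
    by (simp add: set_lebesgue_integral_eq_integral(1))
  have int2: "F integrable_on range g"
    using F_abs by (simp add: set_lebesgue_integral_eq_integral(1))
  have hi1: "((\<lambda>x. \<bar>det (matrix (g' x))\<bar> * h (g x)) has_integral (integral (range g) F $ 1)) UNIV"
    using has_integral_linear[OF integrable_integral[OF int1] bounded_linear_vec_nth[of 1]] D
    by (simp add: o_def F_def)
  have hi2: "(h has_integral (integral (range g) F $ 1)) (range g)"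
    using has_integral_linear[OF integrable_integral[OF int2] bounded_linear_vec_nth[of 1]]
    by (simp add: o_def F_def)
  have "(\<integral>\<^sup>+x. ennreal (\<bar>det (matrix (g' x))\<bar> * h (g x)) \<partial>lborel) = ennreal (integral (range g) F $ 1)"
    using nn_integral_has_integral_lebesgue[OF _ hi1] h(2) by simp
  moreover have "(\<integral>\<^sup>+y. ennreal (h y) * indicator (range g) y \<partial>lborel) = ennreal (integral (range g) F $ 1)"
    using nn_integral_has_integral_lebesgue[OF _ hi2] h(2)
    by (simp add: mult.commute ennreal_mult' ennreal_indicator)
  ultimately show ?thesis by simp
qed


text \<open>Conjugation with \<open>e\<close> is a sign-preserving bijection between the
  permutations of the two index types and matches the terms of the Leibniz formula.\<close>

lemma det_reindex:
  fixes e :: "'a::finite \<Rightarrow> 'b::finite" and A :: "'c::comm_ring_1^'b^'b"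
  assumes "bij e"
  shows "det (\<chi> i j. A $ e i $ e j) = det A"
proof -
  have inj: "inj e" and surj: "surj e" and biji: "bij (inv e)"
    using assms by (auto simp: bij_def bij_imp_bij_inv surj_imp_inj_inv inj_imp_surj_inv)
  have inv_e: "inv e (e x) = x" "e (inv e y) = y" for x y
    using inj surj by (simp_all add: surj_f_inv_f)
  let ?m = "map_permutation (UNIV :: 'a set) e" and ?m' = "map_permutation (UNIV :: 'b set) (inv e)"
  show ?thesis unfolding det_def
  proof (rule sum.reindex_bij_witness[of _ ?m' ?m])
    fix p :: "'a \<Rightarrow> 'a" assume "p \<in> {p. p permutes UNIV}"
    then have p: "p permutes UNIV" by simp
    show "?m' (?m p) = p"
      by (rule map_permutation_compose_inv) (use assms p inv_e in auto)
    show "?m p \<in> {p. p permutes UNIV}"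
      using map_permutation_permutes[OF assms p] by simp
    have ap: "?m p (e i) = e (p i)" for i
      by (rule map_permutation_apply) (use inj in auto)
    have "(\<Prod>i\<in>UNIV. A $ i $ ?m p i) = (\<Prod>i\<in>UNIV. A $ e i $ e (p i))"
      using prod.reindex_bij_betw[OF assms, of "\<lambda>i. A $ i $ ?m p i"] by (simp add: ap)
    then show "of_int (sign (?m p)) * (\<Prod>i\<in>UNIV. A $ i $ ?m p i)
        = of_int (sign p) * (\<Prod>i\<in>UNIV. (\<chi> i j. A $ e i $ e j) $ i $ p i)"
      by (simp add: sign_map_permutation[OF inj p])
  next
    fix p :: "'b \<Rightarrow> 'b" assume "p \<in> {p. p permutes UNIV}"
    then have p: "p permutes UNIV" by simp
    show "?m (?m' p) = p"
      by (rule map_permutation_compose_inv) (use biji p inv_e in auto)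
    show "?m' p \<in> {p. p permutes UNIV}"
      using map_permutation_permutes[OF biji p] by simp
  qed
qed

lemma prod_Basis_cart:
  fixes x :: "real^'n"
  shows "(\<Prod>b\<in>Basis. x \<bullet> b) = (\<Prod>i\<in>UNIV. x $ i)"
proof -
  have B: "(Basis :: (real^'n) set) = range (\<lambda>i::'n. axis i (1::real))"
    by (auto simp: Basis_vec_def)
  have inj: "inj (\<lambda>i::'n. axis i (1::real))"
    by (simp add: inj_on_def axis_eq_axis)
  show ?thesis
    unfolding B prod.reindex[OF inj] by (simp add: inner_axis)
qed

text \<open>Relabelling permutes the side lengths of a box, and Lebesgue measure is determined by
  its values on boxes.\<close>

lemma lborel_distr_reindex:
  fixes e :: "'a::finite \<Rightarrow> 'b::finite"
  assumes "bij e"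
  shows "distr lborel borel (\<lambda>v :: real^'b. (\<chi> i. v $ e i)) = (lborel :: (real^'a) measure)"
proof (rule lborel_eqI[symmetric])
  have inv_e: "inv e (e x) = x" "e (inv e y) = y" for x y
    using assms by (simp_all add: bij_is_inj bij_is_surj surj_f_inv_f)
  have meas: "(\<lambda>v :: real^'b. (\<chi> i. v $ e i)) \<in> borel_measurable borel"
    by (intro borel_measurable_continuous_onI continuous_intros)
  fix l u :: "real^'a" assume le: "\<And>b. b \<in> Basis \<Longrightarrow> l \<bullet> b \<le> u \<bullet> b"
  let ?t = "\<lambda>v::real^'a. (\<chi> j. v $ inv e j) :: real^'b"
  have le': "l $ i \<le> u $ i" for i
    using le[of "axis i 1"] by (simp add: inner_axis)
  have "(\<lambda>v. (\<chi> i. v $ e i)) -` box l u = box (?t l) (?t u)"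
    by (auto simp: mem_box_cart) (metis inv_e)+
  then have "emeasure (distr lborel borel (\<lambda>v. (\<chi> i. v $ e i))) (box l u) = emeasure lborel (box (?t l) (?t u))"
    using meas by (subst emeasure_distr) simp_all
  also have "\<dots> = (\<Prod>b\<in>Basis. (?t u - ?t l) \<bullet> b)"
    by (rule emeasure_lborel_box) (use le' in \<open>auto simp: Basis_vec_def inner_axis\<close>)
  also have "\<dots> = (\<Prod>b\<in>Basis. (u - l) \<bullet> b)"
    unfolding prod_Basis_cart using prod.reindex_bij_betw[OF assms, of "\<lambda>i. (?t u - ?t l) $ i"]
    by (simp add: inv_e)
  finally show "emeasure (distr lborel borel (\<lambda>v. (\<chi> i. v $ e i))) (box l u) = (\<Prod>b\<in>Basis. (u - l) \<bullet> b)" .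
qed simp

text \<open>Relabelling coordinates preserves both Lebesgue measure and determinants, so the result
  is carried over by conjugating \<open>g\<close> with it. The indicator of the range accounts for
  values that \<open>g\<close> omits. Measurability of the Jacobian allows the integral to be
  transported along the relabelling.\<close>

theorem nn_integral_change_of_variables:
  fixes g :: "real^'a::finite \<Rightarrow> real^'a" and h :: "real^'a \<Rightarrow> real"
  assumes der: "\<And>x. (g has_derivative g' x) (at x)" and inj: "inj g"
    and det_meas: "(\<lambda>x. det (matrix (g' x))) \<in> borel_measurable borel"
    and h: "integrable lborel h" "\<And>y. 0 \<le> h y"
  shows "(\<integral>\<^sup>+x. ennreal (\<bar>det (matrix (g' x))\<bar> * h (g x)) \<partial>lborel)
         = (\<integral>\<^sup>+y. ennreal (h y) * indicator (range g) y \<partial>lborel)"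
proof -
  let ?e = "idx_of :: 'a \<Rightarrow> 'a idx"
  have inv_e: "inv ?e (?e x) = x" "?e (inv ?e y) = y" for x y
    using bij_idx_of[where 'a='a] by (simp_all add: bij_is_inj bij_is_surj surj_f_inv_f)
  define R :: "real^'a \<Rightarrow> real^'a idx" where "R v = (\<chi> i. v $ inv ?e i)" for v
  define R' :: "real^'a idx \<Rightarrow> real^'a" where "R' w = (\<chi> j. w $ ?e j)" for w
  have RR': "R (R' w) = w" and R'R: "R' (R v) = v" for w v
    by (simp_all add: R_def R'_def vec_eq_iff inv_e)
  have lin: "linear R" "linear R'"
    by (auto simp: R_def R'_def linear_iff vec_eq_iff)
  have R'_lborel: "distr lborel borel R' = lborel"
    unfolding R'_def using lborel_distr_reindex[OF bij_idx_of[where 'a='a]] .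
  have [measurable]: "R \<in> borel_measurable borel" "R' \<in> borel_measurable borel"
    using lin by (auto intro!: borel_measurable_continuous_onI linear_continuous_on simp: linear_conv_bounded_linear)
  have g_cont: "continuous_on UNIV g"
    by (meson der has_derivative_continuous continuous_at_imp_continuous_on)
  have [measurable]: "g \<in> borel_measurable borel" "h \<in> borel_measurable borel"
    using h(1) g_cont by (auto intro: borel_measurable_continuous_onI)
  have [measurable]: "range g \<in> sets borel"
    using invariance_of_domain[OF g_cont _ inj] by simp
  note det_meas[measurable]
  define G where "G = R \<circ> g \<circ> R'"
  define G' where "G' w = R \<circ> g' (R' w) \<circ> R'" for w
  have derG: "(G has_derivative G' w) (at w)" for w
  proof -
    have dl: "(R has_derivative R) (at x)" "(R' has_derivative R') (at y)" for x y
      using lin by (auto intro: linear_imp_has_derivative)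
    show ?thesis unfolding G_def G'_def
      using diff_chain_at[OF diff_chain_at[OF dl(2) der] dl(1)] by (simp add: o_assoc)
  qed
  have injG: "inj G"
    using inj by (auto simp: G_def inj_on_def) (metis RR' R'R)
  have detG: "det (matrix (G' w)) = det (matrix (g' (R' w)))" for w
  proof -
    have "R' (axis j 1) = axis (inv ?e j) 1" for j
      by (auto simp: R'_def axis_def vec_eq_iff inv_e)
    note ax = this
    have "matrix (G' w) = (\<chi> i j. matrix (g' (R' w)) $ inv ?e i $ inv ?e j)"
      by (simp add: matrix_def G'_def R_def ax)
    then show ?thesis
      using det_reindex[OF bij_imp_bij_inv[OF bij_idx_of], of "matrix (g' (R' w))"] by simp
  qed
  have hi: "integrable lborel (\<lambda>w. h (R' w))"
    using h(1) by (subst (asm) R'_lborel[symmetric]) (simp add: integrable_distr_eq)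
  have "(\<integral>\<^sup>+x. ennreal (\<bar>det (matrix (g' x))\<bar> * h (g x)) \<partial>lborel)
      = (\<integral>\<^sup>+w. ennreal (\<bar>det (matrix (g' (R' w)))\<bar> * h (g (R' w))) \<partial>lborel)"
    by (subst R'_lborel[symmetric]) (simp add: nn_integral_distr)
  also have "\<dots> = (\<integral>\<^sup>+w. ennreal (\<bar>det (matrix (G' w))\<bar> * h (R' (G w))) \<partial>lborel)"
    by (simp add: detG G_def R'R)
  also have "\<dots> = (\<integral>\<^sup>+w. ennreal (h (R' w)) * indicator (range G) w \<partial>lborel)"
    by (rule nn_integral_change_of_variables_wellorder[OF derG injG hi]) (simp add: h(2))
  also have "\<dots> = (\<integral>\<^sup>+w. ennreal (h (R' w)) * indicator (range g) (R' w) \<partial>lborel)"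
  proof (intro nn_integral_cong arg_cong2[where f="(*)"] refl)
    fix w
    have "w \<in> range G \<longleftrightarrow> R' w \<in> range g"
      by (auto simp: G_def image_iff) (metis RR' R'R)+
    then show "(indicator (range G) w :: ennreal) = indicator (range g) (R' w)"
      by (simp add: indicator_def)
  qed
  also have "\<dots> = (\<integral>\<^sup>+y. ennreal (h y) * indicator (range g) y \<partial>lborel)"
    by (subst R'_lborel[symmetric]) (simp add: nn_integral_distr)
  finally show ?thesis .
qed

section \<open>Positive definite matrices\<close>

text \<open>A maximiser of \<open>x \<bullet> f x\<close> on the unit sphere of \<open>S\<close> is
  an eigenvector, and self-adjointness makes its orthogonal complement in \<open>S\<close> invariant
  again. Stating the result for invariant subspaces lets the induction on dimension pass to that
  complement.\<close>

lemma selfadjoint_eigenbasis: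
  fixes f :: "'a::euclidean_space \<Rightarrow> 'a"
  assumes lin: "linear f" and sa: "\<And>x y. x \<bullet> f y = f x \<bullet> y"
  assumes "subspace S" "f ` S \<subseteq> S"
  shows "\<exists>B \<subseteq> S. finite B \<and> pairwise orthogonal B \<and> (\<forall>v\<in>B. norm v = 1) \<and> span B = S
           \<and> (\<forall>v\<in>B. \<exists>l. f v = l *\<^sub>R v)"
  using assms(3,4)
proof (induction "dim S" arbitrary: S rule: less_induct)
  case less
  note S = \<open>subspace S\<close> \<open>f ` S \<subseteq> S\<close>
  show ?case
  proof (cases "S = {0}")
    case True
    then show ?thesis by (intro exI[of _ "{}"]) auto
  next
    case False
    then obtain x0 where x0: "x0 \<in> S" "x0 \<noteq> 0"
      using subspace_0[OF S(1)] by auto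
    let ?K = "sphere 0 1 \<inter> S"
    have "compact ?K"
      by (intro compact_Int_closed compact_sphere closed_subspace S)
    moreover have "x0 /\<^sub>R norm x0 \<in> ?K"
      using x0 S(1) by (simp add: subspace_scale)
    then have "?K \<noteq> {}" by blast
    moreover have "continuous_on ?K (\<lambda>x. x \<bullet> f x)"
      using lin by (intro continuous_intros linear_continuous_on) (simp add: linear_conv_bounded_linear)
    ultimately obtain v where v: "v \<in> ?K" and vmax: "\<And>x. x \<in> ?K \<Longrightarrow> x \<bullet> f x \<le> v \<bullet> f v"
      using continuous_attains_sup[of ?K "\<lambda>x. x \<bullet> f x"] by blast
    define l where "l = v \<bullet> f v"
    have vn: "norm v = 1" "v \<bullet> v = 1" "v \<in> S"
      using v by (auto simp: norm_eq_1)
    have max': "x \<bullet> f x \<le> l * (x \<bullet> x)" if "x \<in> S" for x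
    proof (cases "x = 0")
      case True then show ?thesis using linear_0[OF lin] by simp
    next
      case False
      have "(x /\<^sub>R norm x) \<bullet> f (x /\<^sub>R norm x) \<le> l"
        unfolding l_def using False that S(1) by (intro vmax) (simp add: subspace_scale)
      then have "(x \<bullet> f x) / (norm x)\<^sup>2 \<le> l"
        using linear_scale[OF lin] by (simp add: power2_eq_square divide_inverse mult_ac)
      then show ?thesis using False
        by (simp add: divide_le_eq power2_norm_eq_inner)
    qed
    have orth: "w \<bullet> f v = 0" if w: "w \<in> S" "w \<bullet> v = 0" for w
    proof (rule ccontr)
      assume nz: "w \<bullet> f v \<noteq> 0"
      define p where "p = w \<bullet> f v"
      define q where "q = l * (w \<bullet> w) - w \<bullet> f w"
      \<comment> \<open>Maximality tested at \<open>v + t *\<^sub>R w\<close> is a quadratic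
        inequality in \<open>t\<close> with linear coefficient governed by \<open>p\<close>. The
        choice \<open>t = p\<close> gives \<open>q > 0\<close>; then \<open>t = p / q\<close> gives
        \<open>2 * p\<^sup>2 \<le> p\<^sup>2\<close>, which contradicts
        \<open>p \<noteq> 0\<close>.\<close>
      have key: "2 * t * p \<le> t\<^sup>2 * q" for t
      proof -
        have "v + t *\<^sub>R w \<in> S" using w vn S(1) by (simp add: subspace_add subspace_scale)
        from max'[OF this] have "l + 2 * t * p + t\<^sup>2 * (w \<bullet> f w) \<le> l * (1 + t\<^sup>2 * (w \<bullet> w))"
          using w sa[of v w]
          by (simp add: linear_add[OF lin] linear_scale[OF lin] inner_add_left inner_add_right l_def[symmetric]
              inner_commute[of v w] p_def vn power2_eq_square inner_commute[of "f v" w] algebra_simps)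
        then show ?thesis by (simp add: q_def algebra_simps)
      qed
      have q: "0 < q"
      proof -
        have "2 * p * p \<le> p\<^sup>2 * q" using key[of p] by simp
        moreover have "0 < p * p" using nz by (auto simp: p_def zero_less_mult_iff linorder_neq_iff)
        ultimately have "p\<^sup>2 * 2 \<le> p\<^sup>2 * q" "0 < p\<^sup>2" by (simp_all add: power2_eq_square)
        then show ?thesis using mult_le_cancel_left_pos[of "p\<^sup>2" 2 q] by simp
      qed
      have "2 * (p / q) * p \<le> (p / q)\<^sup>2 * q" by (rule key)
      then have "2 * p\<^sup>2 \<le> p\<^sup>2" using q by (simp add: power2_eq_square field_simps)
      then show False using nz by (simp add: p_def)
    qed
    have fv: "f v = l *\<^sub>R v"
    proof -
      let ?w = "f v - l *\<^sub>R v"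
      have "?w \<in> S" using vn S by (auto intro!: subspace_diff subspace_scale)
      moreover have wv: "?w \<bullet> v = 0"
        by (simp add: inner_diff_left vn l_def inner_commute[of "f v" v])
      ultimately have "?w \<bullet> f v = 0" by (rule orth)
      with wv have "?w \<bullet> ?w = 0"
        unfolding inner_diff_right[of ?w "f v"] by simp
      then show ?thesis by simp
    qed
    define T where "T = {x \<in> S. v \<bullet> x = 0}"
    have T: "subspace T" "T \<subseteq> S"
      using S(1) by (auto simp: T_def subspace_def inner_add_right)
    have fT: "f ` T \<subseteq> T"
      using S(2) sa[of v] fv by (auto simp: T_def)
    have "v \<notin> T" using vn by (simp add: T_def)
    then have "dim T < dim S"
      using subspace_dim_equal[OF T(1) S(1) T(2)] vn(3) by force
    from less.hyps[OF this T(1) fT] obtain B where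
      B: "B \<subseteq> T" "finite B" "pairwise orthogonal B" "\<forall>v\<in>B. norm v = 1" "span B = T" "\<forall>v\<in>B. \<exists>l. f v = l *\<^sub>R v"
      by blast
    have "span (insert v B) = S"
    proof
      show "span (insert v B) \<subseteq> S"
        using B(1) T(2) vn(3) S(1) by (intro span_minimal) auto
      show "S \<subseteq> span (insert v B)"
      proof
        fix x assume x: "x \<in> S"
        have "x - (v \<bullet> x) *\<^sub>R v \<in> T"
          using x vn S(1) by (simp add: T_def inner_diff_right subspace_diff subspace_scale)
        then have "x - (v \<bullet> x) *\<^sub>R v \<in> span B" using B by simp
        then show "x \<in> span (insert v B)" using span_breakdown_eq by blast
      qed
    qed
    moreover have "pairwise orthogonal (insert v B)"
      using B(1,3) by (auto simp: pairwise_insert orthogonal_def T_def inner_commute)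
    ultimately show ?thesis
      using B T vn fv by (intro exI[of _ "insert v B"]) auto
  qed
qed

section \<open>Symmetry, invertibility and inverses\<close>

lemma inner_matrix_vector: "x \<bullet> ((A :: real^'n^'m) *v y) = (transpose A *v x) \<bullet> y"
  by (simp add: dot_lmul_matrix)

lemma posdef_sym:
  assumes "posdef A"
  shows "x \<bullet> (A *v y) = (A *v x) \<bullet> y"
proof -
  have t: "transpose A = A" using assms by (simp add: posdef_def)
  show ?thesis unfolding inner_matrix_vector t ..
qed

lemma posdef_nonneg: "posdef A \<Longrightarrow> 0 \<le> x \<bullet> (A *v x)"
  by (cases "x = 0") (auto simp: posdef_def less_imp_le)

lemma posdef_invertible: "posdef (A :: real^'n^'n) \<Longrightarrow> invertible A"
proof -
  assume A: "posdef A"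
  have "A *v x = 0 \<Longrightarrow> x = 0" for x
    using A by (force simp: posdef_def)
  then show ?thesis
    unfolding invertible_left_inverse matrix_left_invertible_ker by blast
qed

lemma matrix_inv:
  assumes "invertible (A :: real^'n^'n)"
  shows "A ** matrix_inv A = mat 1" "matrix_inv A ** A = mat 1"
proof -
  have "\<exists>B. A ** B = mat 1 \<and> B ** A = mat 1"
    using assms by (simp add: invertible_def)
  from someI_ex[OF this] show "A ** matrix_inv A = mat 1" "matrix_inv A ** A = mat 1"
    by (simp_all add: matrix_inv_def)
qed

lemma matrix_inv_vector:
  assumes "invertible (A :: real^'n^'n)"
  shows "A *v (matrix_inv A *v x) = x" "matrix_inv A *v (A *v x) = x"
  using assms by (simp_all add: matrix_inv matrix_vector_mul_assoc)

lemma matrix_inv_eqI: 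
  assumes "(A :: real^'n^'n) ** B = mat 1"
  shows "matrix_inv A = B"
proof -
  have inv: "invertible A" using assms by (auto simp: invertible_right_inverse)
  have "matrix_inv A = matrix_inv A ** (A ** B)" by (simp add: assms)
  also have "\<dots> = B" unfolding matrix_mul_assoc by (simp add: matrix_inv[OF inv])
  finally show ?thesis .
qed

lemma posdef_matrix_inv: "posdef (A :: real^'n^'n) \<Longrightarrow> posdef (matrix_inv A)"
proof -
  assume A: "posdef A"
  note inv = posdef_invertible[OF A]
  have "transpose (A ** matrix_inv A) = mat 1"
    by (simp add: matrix_inv[OF inv] transpose_mat)
  then have "transpose (matrix_inv A) ** A = mat 1"
    using A by (simp add: matrix_transpose_mul posdef_def)
  then have "A ** transpose (matrix_inv A) = mat 1"
    by (simp add: matrix_left_right_inverse)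
  then have "transpose (matrix_inv A) = matrix_inv A"
    by (rule matrix_inv_eqI[symmetric])
  moreover have "x \<bullet> (matrix_inv A *v x) > 0" if "x \<noteq> 0" for x
  proof -
    let ?y = "matrix_inv A *v x"
    have Ay: "A *v ?y = x" using inv by (simp add: matrix_inv_vector)
    then have "?y \<noteq> 0" using that by auto
    then have "?y \<bullet> (A *v ?y) > 0" using A by (auto simp: posdef_def)
    then show ?thesis by (simp add: Ay inner_commute)
  qed
  ultimately show ?thesis by (simp add: posdef_def)
qed

section \<open>Symmetric positive definite square roots\<close>

lemma posdef_sqrt_exists:
  assumes A: "posdef (A :: real^'n^'n)"
  shows "\<exists>B. posdef B \<and> B ** B = A"
proof -
  obtain E where E: "finite E" "pairwise orthogonal E" "\<forall>v\<in>E. norm v = 1" "span E = (UNIV :: (real^'n) set)"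
    "\<forall>v\<in>E. \<exists>l. A *v v = l *\<^sub>R v"
    using selfadjoint_eigenbasis[of "(*v) A" UNIV] posdef_sym[OF A] by (auto simp: matrix_vector_mul_linear)
  from bchoice[OF this(5)] obtain l where "\<forall>v\<in>E. A *v v = l v *\<^sub>R v" by blast
  then have l: "A *v v = l v *\<^sub>R v" if "v \<in> E" for v using that by blast
  have EE: "v \<bullet> w = (if v = w then 1 else 0)" if "v \<in> E" "w \<in> E" for v w
    using E(2,3) that by (auto simp: pairwise_def orthogonal_def norm_eq_1)
  have lpos: "l v > 0" if "v \<in> E" for v
  proof -
    have "v \<noteq> 0" using E(3) that by auto
    then have "v \<bullet> (A *v v) > 0" using A by (auto simp: posdef_def)
    then show ?thesis using l[OF that] EE[OF that that] by simp
  qed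
  have expand: "x = (\<Sum>v\<in>E. (v \<bullet> x) *\<^sub>R v)" for x
  proof -
    have res: "(x - (\<Sum>v\<in>E. (v \<bullet> x) *\<^sub>R v)) \<bullet> w = 0" if "w \<in> E" for w
    proof -
      have "(\<Sum>v\<in>E. (v \<bullet> x) * (v \<bullet> w)) = (\<Sum>v\<in>E. if v = w then v \<bullet> x else 0)"
        using that by (intro sum.cong) (auto simp: EE)
      then show ?thesis
        using that E(1) by (simp add: inner_diff_left inner_sum_left inner_commute[of x])
    qed
    have "orthogonal (x - (\<Sum>v\<in>E. (v \<bullet> x) *\<^sub>R v)) y" if "y \<in> span E" for y
      using that by (rule orthogonal_to_span) (simp add: res orthogonal_def)
    then have "orthogonal (x - (\<Sum>v\<in>E. (v \<bullet> x) *\<^sub>R v)) (x - (\<Sum>v\<in>E. (v \<bullet> x) *\<^sub>R v))"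
      using E(4) by blast
    then show ?thesis by (simp add: orthogonal_self)
  qed
  \<comment> \<open>The root has the same eigenvectors as \<open>A\<close> and the roots of its
    eigenvalues. Positivity of every \<open>l v\<close> makes \<open>sqrt (l v)\<close> square back
    to \<open>l v\<close> and keeps the root positive definite.\<close>
  define f where "f x = (\<Sum>v\<in>E. (sqrt (l v) * (v \<bullet> x)) *\<^sub>R v)" for x
  have lin: "linear f"
    unfolding f_def linear_iff
    by (auto simp: inner_add_right algebra_simps sum.distrib scaleR_sum_right)
  define B where "B = matrix f"
  have Bf: "B *v x = f x" for x unfolding B_def by (rule fun_cong[OF matrix_vector_mul(2)[OF lin]])
  have vf: "w \<bullet> f x = sqrt (l w) * (w \<bullet> x)" if "w \<in> E" for w x
  proof -
    have "w \<bullet> f x = (\<Sum>v\<in>E. if v = w then sqrt (l v) * (v \<bullet> x) else 0)"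
      unfolding f_def inner_sum_right using that by (intro sum.cong) (auto simp: EE)
    then show ?thesis using that E(1) by simp
  qed
  have Ax: "A *v x = (\<Sum>v\<in>E. (l v * (v \<bullet> x)) *\<^sub>R v)" for x
  proof -
    have "A *v x = A *v (\<Sum>v\<in>E. (v \<bullet> x) *\<^sub>R v)" using expand[of x] by simp
    also have "\<dots> = (\<Sum>v\<in>E. (v \<bullet> x) *\<^sub>R (A *v v))"
      by (simp add: linear_sum[OF matrix_vector_mul_linear] matrix_vector_mult_scaleR)
    finally show ?thesis using l by (simp add: mult.commute)
  qed
  have "B ** B = A"
  proof (rule matrix_eq[THEN iffD2], rule allI)
    fix x
    have "f (f x) = (\<Sum>v\<in>E. (sqrt (l v) * (v \<bullet> f x)) *\<^sub>R v)" by (simp add: f_def[of "f x"])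
    also have "\<dots> = (\<Sum>v\<in>E. (l v * (v \<bullet> x)) *\<^sub>R v)"
      by (intro sum.cong refl) (simp add: vf lpos less_imp_le mult.assoc[symmetric])
    finally show "(B ** B) *v x = A *v x"
      by (simp add: matrix_vector_mul_assoc[symmetric] Bf Ax)
  qed
  moreover have "posdef B"
    unfolding posdef_def
  proof (intro conjI allI impI)
    have "x \<bullet> f y = f x \<bullet> y" for x y
      unfolding f_def by (simp add: inner_sum_left inner_sum_right inner_commute mult_ac)
    then have "(transpose B *v x) \<bullet> y = (B *v x) \<bullet> y" for x y
      by (simp add: Bf inner_matrix_vector[symmetric] del: transpose_matrix_vector)
    then have "transpose B *v x = B *v x" for x
      using vector_eq_ldot[of "transpose B *v x" "B *v x"] by (simp add: inner_commute del: transpose_matrix_vector)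
    then show "transpose B = B"
      unfolding matrix_eq by blast
    fix x :: "real^'n" assume "x \<noteq> 0"
    have "\<exists>v\<in>E. v \<bullet> x \<noteq> 0"
    proof (rule ccontr)
      assume "\<not> ?thesis"
      then have "(\<Sum>v\<in>E. (v \<bullet> x) *\<^sub>R v) = 0" by simp
      with expand[of x] \<open>x \<noteq> 0\<close> show False by simp
    qed
    then obtain w where w: "w \<in> E" "w \<bullet> x \<noteq> 0" by blast
    have "x \<bullet> f x = (\<Sum>v\<in>E. sqrt (l v) * (v \<bullet> x)\<^sup>2)"
      unfolding f_def by (simp add: inner_sum_right inner_commute power2_eq_square mult_ac)
    also have "\<dots> > 0"
      using w lpos E(1) by (intro sum_pos2[of _ w]) (auto intro!: mult_nonneg_nonneg less_imp_le[OF lpos])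
    finally show "0 < x \<bullet> (B *v x)" by (simp add: Bf)
  qed
  ultimately show ?thesis by blast
qed

text \<open>The difference \<open>D\<close> of the two roots is self-adjoint, so it suffices that it
  vanishes on its eigenvectors. If \<open>D v = l *\<^sub>R v\<close>, then in the sum of
  \<open>v \<bullet> (B *v D v)\<close> and \<open>v \<bullet> (C *v D v)\<close> the equal squares
  and the mixed terms cancel. What remains is \<open>l\<close> times the form of
  \<open>B + C\<close> at \<open>v\<close>, which is positive unless \<open>v = 0\<close>.\<close>

lemma posdef_sqrt_unique:
  assumes B: "posdef (B :: real^'n^'n)" and C: "posdef C" and eq: "B ** B = C ** C"
  shows "B = C"
proof -
  define D where "D x = B *v x - C *v x" for x
  have sa: "x \<bullet> D y = D x \<bullet> y" for x y
    using posdef_sym[OF B] posdef_sym[OF C] by (simp add: D_def inner_diff_left inner_diff_right)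
  have linD: "linear D"
    unfolding D_def by (intro linear_compose_sub matrix_vector_mul_linear)
  have BC: "B *v (B *v x) = C *v (C *v x)" for x
    using eq by (simp add: matrix_vector_mul_assoc)
  obtain E where E: "finite E" "(UNIV :: (real^'n) set) = span E" "\<forall>v\<in>E. \<exists>l. D v = l *\<^sub>R v"
    using selfadjoint_eigenbasis[OF linD sa, of UNIV] by auto
  have "D v = 0" if "v \<in> E" for v
  proof -
    from bspec[OF E(3) that] obtain l where l: "D v = l *\<^sub>R v" ..
    have "v \<bullet> (B *v D v) = v \<bullet> (B *v (B *v v)) - (B *v v) \<bullet> (C *v v)"
      using posdef_sym[OF B] by (simp add: D_def matrix_vector_mult_diff_distrib inner_diff_right)
    moreover have "v \<bullet> (C *v D v) = (C *v v) \<bullet> (B *v v) - v \<bullet> (C *v (C *v v))"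
      using posdef_sym[OF C] by (simp add: D_def matrix_vector_mult_diff_distrib inner_diff_right)
    ultimately have "l * (v \<bullet> (B *v v) + v \<bullet> (C *v v)) = 0"
      by (simp add: l matrix_vector_mult_scaleR BC inner_commute algebra_simps)
    moreover have "v \<bullet> (B *v v) + v \<bullet> (C *v v) > 0 \<or> v = 0"
      using B C by (auto simp: posdef_def add_pos_pos)
    ultimately show ?thesis using l by auto
  qed
  then have "D x = 0" for x
    using linear_eq_0_on_span[OF linD, of E x] E(2) by auto
  then show ?thesis by (simp add: D_def matrix_eq)
qed

lemma psd_sqrt:
  assumes "posdef (A :: real^'n^'n)"
  shows "posdef (psd_sqrt A)" "psd_sqrt A ** psd_sqrt A = A"
proof -
  have "\<exists>!B. posdef B \<and> B ** B = A"
    using posdef_sqrt_exists[OF assms] posdef_sqrt_unique by (intro ex_ex1I) auto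
  from theI'[OF this] show "posdef (psd_sqrt A)" "psd_sqrt A ** psd_sqrt A = A"
    by (simp_all add: psd_sqrt_def)
qed

lemma psd_sqrt_eqI: "posdef B \<Longrightarrow> B ** B = A \<Longrightarrow> psd_sqrt A = (B :: real^'n^'n)"
  unfolding psd_sqrt_def using posdef_sqrt_unique by (intro the_equality) auto

text \<open>The limit variable contains the root of the Schur complement next to the root of its
  inverse; as mutually inverse matrices they cancel.\<close>

lemma psd_sqrt_matrix_inv:
  assumes "posdef (A :: real^'n^'n)"
  shows "psd_sqrt (matrix_inv A) = matrix_inv (psd_sqrt A)"
proof (rule psd_sqrt_eqI)
  note s = psd_sqrt[OF assms] 
  note inv = matrix_inv[OF posdef_invertible[OF s(1)]]
  show "posdef (matrix_inv (psd_sqrt A))" by (rule posdef_matrix_inv[OF s(1)])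
  let ?B = "psd_sqrt A" and ?C = "matrix_inv (psd_sqrt A)"
  have "(?B ** ?B) ** (?C ** ?C) = ?B ** (?B ** ?C) ** ?C" by (simp add: matrix_mul_assoc)
  then have "A ** (?C ** ?C) = mat 1" by (simp add: s inv)
  then show "?C ** ?C = matrix_inv A" by (simp add: matrix_inv_eqI)
qed

lemma posdef_det_pos: "posdef (A :: real^'n^'n) \<Longrightarrow> det A > 0"
proof -
  assume A: "posdef A"
  have "det A = det (psd_sqrt A) * det (psd_sqrt A)"
    by (simp add: det_mul[symmetric] psd_sqrt(2)[OF A])
  moreover have "det A \<noteq> 0"
    using posdef_invertible[OF A] by (simp add: invertible_det_nz)
  ultimately show ?thesis by (auto simp: zero_less_mult_iff linorder_neq_iff)
qed

section \<open>Total variation\<close>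

text \<open>Densities are compared at the source, so no inverse of \<open>H n\<close> occurs.
  Injectivity suffices because points outside the range of \<open>H n\<close> only lower the mass of
  the pull-back, which does no harm to an upper bound.\<close>

lemma total_variation_pushforward:
  fixes H :: "nat \<Rightarrow> real^'k::finite \<Rightarrow> real^'k" and \<phi> :: "real^'k \<Rightarrow> real" and \<phi>n :: "nat \<Rightarrow> real^'k \<Rightarrow> real"
  assumes der: "\<And>n x. (H n has_derivative H' n x) (at x)"
    and inj: "\<And>n. inj (H n)"
    and det_meas: "\<And>n. (\<lambda>x. det (matrix (H' n x))) \<in> borel_measurable borel"
    and limH: "\<And>x. (\<lambda>n. H n x) \<longlonglongrightarrow> x"
    and lim_det: "\<And>x. (\<lambda>n. det (matrix (H' n x))) \<longlonglongrightarrow> 1"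
    and cont: "continuous_on UNIV \<phi>" and nonneg: "\<And>x. 0 \<le> \<phi> x"
    and total: "(\<integral>\<^sup>+x. ennreal (\<phi> x) \<partial>lborel) = 1"
    and meas_n: "\<And>n. \<phi>n n \<in> borel_measurable borel" and nonneg_n: "\<And>n x. 0 \<le> \<phi>n n x"
    and total_n: "\<And>n. (\<integral>\<^sup>+x. ennreal (\<phi>n n x) \<partial>lborel) = 1"
    and lim_n: "\<And>x. (\<lambda>n. \<phi>n n x) \<longlonglongrightarrow> \<phi> x"
  shows "\<exists>\<epsilon>. \<epsilon> \<longlonglongrightarrow> 0 \<and> (\<forall>n. \<forall>A\<in>sets borel.
      \<bar>measure (distr (density lborel (\<lambda>x. ennreal (\<phi>n n x))) borel (H n)) A
        - measure (density lborel (\<lambda>x. ennreal (\<phi> x))) A\<bar> \<le> \<epsilon> n)"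
proof -
  have H_cont: "continuous_on UNIV (H n)" for n
    by (meson der has_derivative_continuous continuous_at_imp_continuous_on)
  have [measurable]: "H n \<in> borel_measurable borel" for n
    by (rule borel_measurable_continuous_onI[OF H_cont])
  have [measurable]: "\<phi> \<in> borel_measurable borel"
    by (rule borel_measurable_continuous_onI[OF cont])
  note meas_n[measurable] det_meas[measurable]
  have int: "integrable lborel \<phi>"
    using total nonneg by (intro integrableI_nonneg) auto
  \<comment> \<open>\<open>q n\<close> is the pull-back of \<open>\<phi>\<close> along \<open>H n\<close>. Its mass may escape, but only the positive part of
    \<open>\<phi>n n - q n\<close> enters the one-sided bound, and that part is dominated; complements give the other side.\<close>
  define q where "q n x = \<bar>det (matrix (H' n x))\<bar> * \<phi> (H n x)" for n x
  have [measurable]: "q n \<in> borel_measurable borel" for n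
    unfolding q_def by measurable
  have q_nonneg: "0 \<le> q n x" for n x by (simp add: q_def nonneg)
  have q_lim: "(\<lambda>n. q n x) \<longlonglongrightarrow> \<phi> x" for x
  proof -
    have "(\<lambda>n. \<phi> (H n x)) \<longlonglongrightarrow> \<phi> x"
      using continuous_on_tendsto_compose[OF cont limH] by simp
    from tendsto_mult[OF tendsto_rabs[OF lim_det] this] show ?thesis
      by (simp add: q_def)
  qed
  \<comment> \<open>\<open>ennreal\<close> sends negative reals to 0, so this is the integral of the
    positive part only.\<close>
  define e where "e n = (\<integral>\<^sup>+x. ennreal (\<phi>n n x - q n x) \<partial>lborel)" for n
  have e_fin: "e n < \<infinity>" for n
  proof -
    have "e n \<le> (\<integral>\<^sup>+x. ennreal (\<phi>n n x) \<partial>lborel)"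
      unfolding e_def using q_nonneg by (intro nn_integral_mono ennreal_leI) (simp add: algebra_simps)
    also have "\<dots> < \<infinity>" by (simp add: total_n)
    finally show ?thesis .
  qed
  \<comment> \<open>Pointwise convergence together with equal total masses upgrades to convergence
    in \<open>L1\<close>.\<close>
  have scheffe: "(\<lambda>n. \<integral>\<^sup>+x. ennreal (norm (\<phi>n n x - \<phi> x)) \<partial>lborel) \<longlonglongrightarrow> 0"
    by (rule Scheffe_lemma2) (use int lim_n in \<open>auto simp: total total_n nonneg nonneg_n\<close>)
  have dom: "(\<lambda>n. \<integral>\<^sup>+x. ennreal (\<phi> x - q n x) \<partial>lborel) \<longlonglongrightarrow> (\<integral>\<^sup>+x. (0::ennreal) \<partial>(lborel :: (real^'k) measure))"
  proof (rule nn_integral_dominated_convergence[where w="\<lambda>x. ennreal (\<phi> x)"])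
    show "AE x in lborel. (\<lambda>n. ennreal (\<phi> x - q n x)) \<longlonglongrightarrow> 0"
    proof (rule AE_I2)
      show "(\<lambda>n. ennreal (\<phi> x - q n x)) \<longlonglongrightarrow> 0" for x
        using tendsto_ennrealI[OF tendsto_diff[OF tendsto_const[of "\<phi> x"] q_lim[of x]]] by simp
    qed
    show "AE x in lborel. ennreal (\<phi> x - q n x) \<le> ennreal (\<phi> x)" for n
      using q_nonneg by (intro AE_I2 ennreal_leI) (simp add: algebra_simps)
  qed (simp_all add: total)
  have e_lim: "e \<longlonglongrightarrow> 0"
  proof (rule tendsto_sandwich[OF _ _ tendsto_const])
    show "\<forall>\<^sub>F n in sequentially. e n \<le> (\<integral>\<^sup>+x. ennreal (norm (\<phi>n n x - \<phi> x)) \<partial>lborel)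
        + (\<integral>\<^sup>+x. ennreal (\<phi> x - q n x) \<partial>lborel)"
    proof (intro always_eventually allI)
      fix n
      have "e n \<le> (\<integral>\<^sup>+x. ennreal (norm (\<phi>n n x - \<phi> x)) + ennreal (\<phi> x - q n x) \<partial>lborel)"
        unfolding e_def
      proof (intro nn_integral_mono)
        fix x
        have "ennreal (\<phi>n n x - q n x) \<le> ennreal (norm (\<phi>n n x - \<phi> x) + max 0 (\<phi> x - q n x))"
          by (intro ennreal_leI) auto
        also have "\<dots> = ennreal (norm (\<phi>n n x - \<phi> x)) + ennreal (\<phi> x - q n x)"
          by (subst ennreal_plus) (auto simp: max_def ennreal_neg)
        finally show "ennreal (\<phi>n n x - q n x) \<le> ennreal (norm (\<phi>n n x - \<phi> x)) + ennreal (\<phi> x - q n x)" .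
      qed
      also have "\<dots> = (\<integral>\<^sup>+x. ennreal (norm (\<phi>n n x - \<phi> x)) \<partial>lborel) + (\<integral>\<^sup>+x. ennreal (\<phi> x - q n x) \<partial>lborel)"
        by (rule nn_integral_add) simp_all
      finally show "e n \<le> \<dots>" .
    qed
    show "(\<lambda>n. (\<integral>\<^sup>+x. ennreal (norm (\<phi>n n x - \<phi> x)) \<partial>lborel)
        + (\<integral>\<^sup>+x. ennreal (\<phi> x - q n x) \<partial>lborel)) \<longlonglongrightarrow> 0"
      using tendsto_add[OF scheffe dom] by simp
  qed simp
  define P where "P = density lborel (\<lambda>x. ennreal (\<phi> x))"
  define Pn where "Pn n = distr (density lborel (\<lambda>x. ennreal (\<phi>n n x))) borel (H n)" for n
  have P: "prob_space P"
    unfolding P_def by (rule prob_spaceI) (simp add: emeasure_density total)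
  have Pn: "prob_space (Pn n)" for n
    unfolding Pn_def
    by (rule prob_space.prob_space_distr) (auto intro!: prob_spaceI simp: emeasure_density total_n)
  have sets: "sets P = sets borel" "sets (Pn n) = sets borel" for n
    by (simp_all add: P_def Pn_def)
  \<comment> \<open>On the preimage of \<open>A\<close> the density \<open>\<phi>n n\<close> is at
    most \<open>q n\<close> plus the positive part of the difference. Change of variables turns the
    \<open>q n\<close> term into the mass that \<open>P\<close> gives to the part of
    \<open>A\<close> inside the range; the rest contributes at most \<open>e n\<close>.\<close>
  have one_sided: "measure (Pn n) A \<le> measure P A + enn2real (e n)" if A: "A \<in> sets borel" for A n
  proof -
    note A[measurable]
    have [measurable]: "H n -` A \<in> sets borel"
      using measurable_sets[of "H n" borel borel A] by simp
    have hA: "integrable lborel (\<lambda>x. \<phi> x * indicator A x)"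
      using integrable_mult_indicator[OF _ int, of A] by (simp add: mult.commute)
    have "emeasure (Pn n) A = (\<integral>\<^sup>+x. ennreal (\<phi>n n x) * indicator (H n -` A) x \<partial>lborel)"
      unfolding Pn_def by (simp add: emeasure_distr emeasure_density)
    also have "\<dots> \<le> (\<integral>\<^sup>+x. ennreal (q n x * indicator A (H n x)) + ennreal (\<phi>n n x - q n x) \<partial>lborel)"
    proof (intro nn_integral_mono)
      fix x
      have "ennreal (\<phi>n n x) \<le> ennreal (q n x + max 0 (\<phi>n n x - q n x))"
        by (intro ennreal_leI) auto
      also have "\<dots> = ennreal (q n x) + ennreal (\<phi>n n x - q n x)"
        using q_nonneg by (subst ennreal_plus) (auto simp: max_def ennreal_neg)
      finally show "ennreal (\<phi>n n x) * indicator (H n -` A) x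
          \<le> ennreal (q n x * indicator A (H n x)) + ennreal (\<phi>n n x - q n x)"
        by (auto simp: indicator_def)
    qed
    also have "\<dots> = (\<integral>\<^sup>+x. ennreal (q n x * indicator A (H n x)) \<partial>lborel) + e n"
      unfolding e_def by (rule nn_integral_add) simp_all
    also have "(\<integral>\<^sup>+x. ennreal (q n x * indicator A (H n x)) \<partial>lborel)
        = (\<integral>\<^sup>+y. ennreal (\<phi> y * indicator A y) * indicator (range (H n)) y \<partial>lborel)"
      using nn_integral_change_of_variables[OF der inj det_meas hA] nonneg
      by (simp add: q_def mult.assoc)
    also have "\<dots> \<le> (\<integral>\<^sup>+y. ennreal (\<phi> y) * indicator A y \<partial>lborel)"
      by (intro nn_integral_mono) (auto simp: indicator_def)
    also have "\<dots> = emeasure P A"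
      unfolding P_def by (simp add: emeasure_density)
    finally have "emeasure (Pn n) A \<le> emeasure P A + e n" by (simp add: add_right_mono)
    moreover have "emeasure P A < \<top>"
      using finite_measure.emeasure_finite[of P A] P by (simp add: prob_space_def top.not_eq_extremum)
    ultimately have "enn2real (emeasure (Pn n) A) \<le> enn2real (emeasure P A + e n)"
      using e_fin[of n] by (intro enn2real_mono) auto
    then show ?thesis
      using e_fin[of n] \<open>emeasure P A < \<top>\<close> by (simp add: measure_def enn2real_plus)
  qed
  have "\<bar>measure (Pn n) A - measure P A\<bar> \<le> enn2real (e n)" if A: "A \<in> sets borel" for A n
  proof -
    have "measure (Pn n) (- A) = 1 - measure (Pn n) A" "measure P (- A) = 1 - measure P A"
      using prob_space.prob_compl[OF Pn, of A n] prob_space.prob_compl[OF P, of A] A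
      by (simp_all add: sets sets_eq_imp_space_eq[OF sets(1)] sets_eq_imp_space_eq[OF sets(2)] Compl_eq_Diff_UNIV)
    moreover have "measure (Pn n) (- A) \<le> measure P (- A) + enn2real (e n)"
      using A by (intro one_sided) auto
    ultimately show ?thesis using one_sided[OF A, of n] by linarith
  qed
  moreover have "(\<lambda>n. enn2real (e n)) \<longlonglongrightarrow> 0"
    using tendsto_enn2real[of e 0 sequentially] e_lim by simp
  ultimately show ?thesis
    unfolding P_def Pn_def by (intro exI[of _ "\<lambda>n. enn2real (e n)"]) simp
qed

text \<open>On the set where \<open>f\<close> exceeds \<open>g\<close>, and on its complement, the
  integral of the absolute difference is a difference of probabilities. Each is at most \<epsilon>,
  whence the factor 2.\<close>

lemma L1_distance_le_total_variation:
  fixes f g :: "'a \<Rightarrow> real"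
  assumes [measurable]: "f \<in> borel_measurable M" "g \<in> borel_measurable M"
    and nonneg: "\<And>x. 0 \<le> f x" "\<And>x. 0 \<le> g x"
    and P: "prob_space (density M (\<lambda>x. ennreal (f x)))" "prob_space (density M (\<lambda>x. ennreal (g x)))"
    and tv: "\<And>A. A \<in> sets M \<Longrightarrow> \<bar>measure (density M (\<lambda>x. ennreal (f x))) A - measure (density M (\<lambda>x. ennreal (g x))) A\<bar> \<le> \<epsilon>"
  shows "(\<integral>\<^sup>+x. ennreal \<bar>f x - g x\<bar> \<partial>M) \<le> ennreal (2 * \<epsilon>)"
proof -
  have one: "(\<integral>\<^sup>+x. ennreal (f x) \<partial>M) = 1" "(\<integral>\<^sup>+x. ennreal (g x) \<partial>M) = 1"
    using prob_space.emeasure_space_1[OF P(1)] prob_space.emeasure_space_1[OF P(2)]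
    by (simp_all add: emeasure_density cong: nn_integral_cong)
  have int: "integrable M f" "integrable M g"
    using one nonneg by (auto intro!: integrableI_nonneg)
  define A where "A = {x \<in> space M. f x > g x}"
  define B where "B = space M - A"
  have [measurable]: "A \<in> sets M" "B \<in> sets M"
    by (auto simp: A_def B_def)
  have meas: "measure (density M (\<lambda>x. ennreal (h x))) C = (\<integral>x. h x * indicator C x \<partial>M)"
    if "integrable M h" "\<And>x. 0 \<le> h x" "C \<in> sets M" for h :: "'a \<Rightarrow> real" and C
  proof -
    have "emeasure (density M (\<lambda>x. ennreal (h x))) C = (\<integral>\<^sup>+x. ennreal (h x * indicator C x) \<partial>M)"
      using that by (subst emeasure_density) (auto intro!: nn_integral_cong simp: indicator_def)
    also have "\<dots> = ennreal (\<integral>x. h x * indicator C x \<partial>M)"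
      using that integrable_mult_indicator[OF that(3,1)]
      by (intro nn_integral_eq_integral) (auto simp: mult.commute)
    finally show ?thesis
      using that by (simp add: measure_def)
  qed
  have ints: "integrable M (\<lambda>x. h x * indicator C x)" if "integrable M h" "C \<in> sets M" for h :: "'a \<Rightarrow> real" and C
    using integrable_mult_indicator[OF that(2,1)] by (simp add: mult.commute)
  have "(\<integral>\<^sup>+x. ennreal \<bar>f x - g x\<bar> \<partial>M) = ennreal (\<integral>x. \<bar>f x - g x\<bar> \<partial>M)"
    using int by (intro nn_integral_eq_integral) auto
  also have "(\<integral>x. \<bar>f x - g x\<bar> \<partial>M)
      = (\<integral>x. (f x * indicator A x - g x * indicator A x) + (g x * indicator B x - f x * indicator B x) \<partial>M)"
    by (rule Bochner_Integration.integral_cong) (auto simp: A_def B_def indicator_def)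
  also have "\<dots> = ((\<integral>x. f x * indicator A x \<partial>M) - (\<integral>x. g x * indicator A x \<partial>M))
      + ((\<integral>x. g x * indicator B x \<partial>M) - (\<integral>x. f x * indicator B x \<partial>M))"
    using int by (simp add: ints)
  also have "\<dots> \<le> 2 * \<epsilon>"
    using tv[of A] tv[of B] int nonneg by (simp add: meas)
  finally show ?thesis by (simp add: ennreal_leI)
qed

section \<open>Gaussian laws\<close>

abbreviation normal_law :: "real \<Rightarrow> real measure" where
  "normal_law \<sigma> \<equiv> density lborel (\<lambda>x. ennreal (normal_density 0 \<sigma> x))"

text \<open>Product measures live on functions, while the densities are taken on vectors; the
  coordinate map passes from one to the other.\<close>

lemma distr_PiM_lborel_cart:
  "distr (PiM (UNIV :: 'k::finite set) (\<lambda>_. lborel)) borel (\<lambda>z. \<chi> i. z i) = (lborel :: (real^'k) measure)"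
proof (rule lborel_eqI[symmetric])
  interpret product_sigma_finite "\<lambda>_::'k. lborel :: real measure"
    by unfold_locales
  have meas: "(\<lambda>z. (\<chi> i. z i) :: real^'k) \<in> borel_measurable (PiM UNIV (\<lambda>_. lborel))"
    by (subst borel_measurable_euclidean_space) (auto simp: Basis_vec_def inner_axis)
  fix l u :: "real^'k" assume le: "\<And>b. b \<in> Basis \<Longrightarrow> l \<bullet> b \<le> u \<bullet> b"
  have le': "l $ i \<le> u $ i" for i
    using le[of "axis i 1"] by (simp add: inner_axis)
  have "(\<lambda>z. \<chi> i. z i) -` box l u \<inter> space (PiM UNIV (\<lambda>_. lborel)) = (\<Pi>\<^sub>E i\<in>UNIV. {l $ i<..<u $ i})"
    by (auto simp: mem_box_cart space_PiM PiE_iff)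
  then have "emeasure (distr (PiM UNIV (\<lambda>_. lborel)) borel (\<lambda>z. \<chi> i. z i)) (box l u)
      = emeasure (PiM UNIV (\<lambda>_. lborel)) (\<Pi>\<^sub>E i\<in>UNIV. {l $ i<..<u $ i})"
    using meas by (subst emeasure_distr) simp_all
  also have "\<dots> = (\<Prod>i\<in>UNIV. ennreal (u $ i - l $ i))"
    using le' by (subst emeasure_PiM) simp_all
  also have "\<dots> = ennreal (\<Prod>b\<in>Basis. (u - l) \<bullet> b)"
    unfolding prod_Basis_cart using le' by (simp add: prod_ennreal)
  finally show "emeasure (distr (PiM UNIV (\<lambda>_. lborel)) borel (\<lambda>z. \<chi> i. z i)) (box l u) = (\<Prod>b\<in>Basis. (u - l) \<bullet> b)" .
qed simp

lemma PiM_density_cart: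
  fixes f :: "real \<Rightarrow> real"
  assumes [measurable]: "f \<in> borel_measurable borel" and nonneg: "\<And>x. 0 \<le> f x"
    and total: "prob_space (density lborel (\<lambda>x. ennreal (f x)))"
  shows "distr (PiM (UNIV :: 'k::finite set) (\<lambda>_. density lborel (\<lambda>x. ennreal (f x)))) borel (\<lambda>z. \<chi> i. z i)
    = density (lborel :: (real^'k) measure) (\<lambda>x. ennreal (\<Prod>i\<in>UNIV. f (x $ i)))"
proof -
  let ?D = "density lborel (\<lambda>x. ennreal (f x))"
  interpret L: product_sigma_finite "\<lambda>_::'k. lborel :: real measure"
    by unfold_locales
  interpret D: product_prob_space "\<lambda>_::'k. ?D"
    using total by (simp add: product_prob_space_def product_prob_space_axioms_def product_sigma_finite_def prob_space_imp_sigma_finite)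
  have [measurable]: "(\<lambda>z. (\<chi> i. z i) :: real^'k) \<in> borel_measurable (PiM UNIV (\<lambda>_. lborel))"
    by (subst borel_measurable_euclidean_space) (auto simp: Basis_vec_def inner_axis)
  have PiM: "density (PiM (UNIV :: 'k set) (\<lambda>_. lborel)) (\<lambda>z. ennreal (\<Prod>i\<in>UNIV. f (z i))) = PiM UNIV (\<lambda>_. ?D)"
  proof (rule D.PiM_eqI)
    fix A :: "'k \<Rightarrow> real set" assume "\<And>i. i \<in> UNIV \<Longrightarrow> A i \<in> sets ?D"
    then have [measurable]: "A i \<in> sets borel" for i by simp
    have [measurable]: "Pi\<^sub>E UNIV A \<in> sets (PiM UNIV (\<lambda>_. lborel))"
      by (intro sets_PiM_I_finite) auto
    have "emeasure (density (PiM UNIV (\<lambda>_. lborel)) (\<lambda>z. ennreal (\<Prod>i\<in>UNIV. f (z i)))) (Pi\<^sub>E UNIV A)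
        = (\<integral>\<^sup>+z. (\<Prod>i\<in>UNIV. ennreal (f (z i)) * indicator (A i) (z i)) \<partial>PiM UNIV (\<lambda>_. lborel))"
    proof (subst emeasure_density)
      have *: "indicator (Pi\<^sub>E UNIV A) z = (\<Prod>i\<in>UNIV. indicator (A i) (z i) :: ennreal)" for z
      proof (cases "z \<in> Pi\<^sub>E UNIV A")
        case False
        then obtain i where "z i \<notin> A i" by (auto simp: PiE_def)
        then have "(\<Prod>i\<in>UNIV. indicator (A i) (z i) :: ennreal) = 0"
          by (intro prod_zero) (auto intro!: exI[of _ i])
        with False show ?thesis by simp
      qed (auto simp: PiE_def Pi_def)
      show "(\<integral>\<^sup>+z. ennreal (\<Prod>i\<in>UNIV. f (z i)) * indicator (Pi\<^sub>E UNIV A) z \<partial>PiM UNIV (\<lambda>_. lborel))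
        = (\<integral>\<^sup>+z. (\<Prod>i\<in>UNIV. ennreal (f (z i)) * indicator (A i) (z i)) \<partial>PiM UNIV (\<lambda>_. lborel))"
        by (simp add: * prod_ennreal[symmetric] nonneg prod.distrib)
    qed measurable
    also have "\<dots> = (\<Prod>i\<in>UNIV. \<integral>\<^sup>+x. ennreal (f x) * indicator (A i) x \<partial>lborel)"
      by (rule L.product_nn_integral_prod) auto
    also have "\<dots> = (\<Prod>i\<in>UNIV. emeasure ?D (A i))"
      by (simp add: emeasure_density)
    finally show "emeasure (density (PiM UNIV (\<lambda>_. lborel)) (\<lambda>z. ennreal (\<Prod>i\<in>UNIV. f (z i)))) (Pi\<^sub>E UNIV A)
      = (\<Prod>i\<in>UNIV. emeasure ?D (A i))" .
  qed (auto intro!: sets_PiM_cong)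
  have "density (lborel :: (real^'k) measure) (\<lambda>x. ennreal (\<Prod>i\<in>UNIV. f (x $ i)))
      = distr (density (PiM (UNIV :: 'k set) (\<lambda>_. lborel)) (\<lambda>z. ennreal (\<Prod>i\<in>UNIV. f (z i)))) borel (\<lambda>z. \<chi> i. z i)"
    by (subst distr_PiM_lborel_cart[symmetric], subst density_distr) simp_all
  then show ?thesis by (simp add: PiM)
qed

text \<open>The change of variables is applied to the inverse matrix, so that the variable of
  integration on the Jacobian side is the image point \<open>t\<close> at which the new density is
  evaluated.\<close>

lemma distr_density_linear:
  fixes M :: "real^'k::finite^'k" and \<phi> :: "real^'k \<Rightarrow> real"
  assumes M: "invertible M" and int: "integrable lborel \<phi>" and nonneg: "\<And>x. 0 \<le> \<phi> x"
  shows "distr (density lborel (\<lambda>x. ennreal (\<phi> x))) borel ((*v) M)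
    = density lborel (\<lambda>t. ennreal (\<phi> (matrix_inv M *v t) / \<bar>det M\<bar>))"
proof (rule measure_eqI)
  have cont: "continuous_on UNIV ((*v) (N :: real^'k^'k))" for N
    by (intro linear_continuous_on) (simp add: matrix_vector_mul_linear linear_conv_bounded_linear[symmetric])
  have [measurable]: "(*v) (N :: real^'k^'k) \<in> borel_measurable borel" for N
    by (rule borel_measurable_continuous_onI[OF cont])
  have [measurable]: "\<phi> \<in> borel_measurable borel" using int by simp
  note inv = matrix_inv_vector[OF M]
  have "det M * det (matrix_inv M) = 1"
    using matrix_inv(1)[OF M] by (simp add: det_mul[symmetric])
  then have det_inv: "\<bar>det (matrix_inv M)\<bar> = 1 / \<bar>det M\<bar>"
    by (metis abs_1 abs_mult mult_zero_left nonzero_eq_divide_eq mult.commute abs_eq_0 zero_neq_one)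
  fix A assume "A \<in> sets (distr (density lborel (\<lambda>x. ennreal (\<phi> x))) borel ((*v) M))"
  then have A[measurable]: "A \<in> sets borel" by simp
  let ?h = "\<lambda>y. \<phi> y * indicator ((*v) M -` A) y"
  have [measurable]: "(*v) M -` A \<in> sets borel"
    using measurable_sets[of "(*v) M" borel borel A] by simp
  have h: "integrable lborel ?h"
    using integrable_mult_indicator[OF _ int, of "(*v) M -` A"] by (simp add: mult.commute)
  have inj: "inj ((*v) (matrix_inv M))"
    by (rule inj_on_inverseI[where g="(*v) M"]) (simp add: inv)
  have "surj ((*v) (matrix_inv M))"
    by (rule surjI[where f="(*v) M"]) (simp add: inv)
  note cov = nn_integral_change_of_variables[where g="(*v) (matrix_inv M)" and g'="\<lambda>_. (*v) (matrix_inv M)", OF _ inj _ h]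
  have "(\<integral>\<^sup>+x. ennreal (\<bar>det (matrix_inv M)\<bar> * ?h (matrix_inv M *v x)) \<partial>lborel)
      = (\<integral>\<^sup>+y. ennreal (?h y) * indicator (range ((*v) (matrix_inv M))) y \<partial>lborel)"
    using nonneg cov by (simp add: linear_imp_has_derivative matrix_vector_mul_linear)
  moreover have "emeasure (distr (density lborel (\<lambda>x. ennreal (\<phi> x))) borel ((*v) M)) A
      = (\<integral>\<^sup>+y. ennreal (?h y) * indicator (range ((*v) (matrix_inv M))) y \<partial>lborel)"
    using \<open>surj _\<close> by (simp add: emeasure_distr emeasure_density) (auto intro!: nn_integral_cong simp: indicator_def)
  moreover have "emeasure (density lborel (\<lambda>t. ennreal (\<phi> (matrix_inv M *v t) / \<bar>det M\<bar>))) A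
      = (\<integral>\<^sup>+x. ennreal (\<bar>det (matrix_inv M)\<bar> * ?h (matrix_inv M *v x)) \<partial>lborel)"
    by (subst emeasure_density) (auto intro!: nn_integral_cong simp: indicator_def inv det_inv)
  ultimately show "emeasure (distr (density lborel (\<lambda>x. ennreal (\<phi> x))) borel ((*v) M)) A
      = emeasure (density lborel (\<lambda>t. ennreal (\<phi> (matrix_inv M *v t) / \<bar>det M\<bar>))) A" by simp
qed simp


section \<open>Gram matrices of finite families of rows\<close>

definition row_gram :: "('i \<Rightarrow> real^'k) \<Rightarrow> 'i set \<Rightarrow> real^'k^'k" where
  "row_gram x J = (\<chi> a b. \<Sum>i\<in>J. x i $ a * x i $ b)"

lemma row_gram_vector: "row_gram x J *v v = (\<Sum>i\<in>J. (x i \<bullet> v) *\<^sub>R x i)"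
proof -
  have "(row_gram x J *v v) $ a = (\<Sum>i\<in>J. (x i \<bullet> v) *\<^sub>R x i) $ a" for a
  proof -
    have "(row_gram x J *v v) $ a = (\<Sum>b\<in>UNIV. \<Sum>i\<in>J. x i $ a * x i $ b * v $ b)"
      by (simp add: row_gram_def matrix_vector_mult_def sum_distrib_right)
    also have "\<dots> = (\<Sum>i\<in>J. \<Sum>b\<in>UNIV. x i $ a * x i $ b * v $ b)"
      by (rule sum.swap)
    also have "\<dots> = (\<Sum>i\<in>J. (x i \<bullet> v) *\<^sub>R x i) $ a"
      by (simp add: inner_vec_def sum_distrib_left sum_distrib_right mult_ac)
    finally show ?thesis .
  qed
  then show ?thesis by (simp add: vec_eq_iff)
qed

lemma inner_row_gram: "v \<bullet> (row_gram x J *v v) = (\<Sum>i\<in>J. (x i \<bullet> v)\<^sup>2)"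
  by (simp add: row_gram_vector inner_sum_right power2_eq_square inner_commute)

lemma posdef_row_gram:
  fixes x :: "'i \<Rightarrow> real^'k::finite"
  assumes "finite J" "\<And>c. (\<And>i. i \<in> J \<Longrightarrow> x i \<bullet> c = 0) \<Longrightarrow> c = 0"
  shows "posdef (row_gram x J)"
  unfolding posdef_def
proof (intro conjI allI impI)
  show "transpose (row_gram x J) = row_gram x J"
    by (simp add: row_gram_def transpose_def vec_eq_iff mult.commute)
  fix v :: "real^'k" assume "v \<noteq> 0"
  then obtain i where "i \<in> J" "x i \<bullet> v \<noteq> 0" using assms(2) by blast
  then show "0 < v \<bullet> (row_gram x J *v v)"
    unfolding inner_row_gram using assms(1) by (intro sum_pos2[of _ i]) auto
qed

lemma posdef_scaleR: "posdef A \<Longrightarrow> c > 0 \<Longrightarrow> posdef (c *\<^sub>R (A :: real^'n^'n))"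
  by (auto simp: posdef_def transpose_scalar scaleR_matrix_vector_assoc[symmetric])

lemma det_scaleR: "det (c *\<^sub>R (A :: real^'n^'n)) = c ^ CARD('n) * det A"
  by (simp add: det_def prod.distrib sum_distrib_left mult_ac)

lemma scaleR_matrix_mult:
  "(c *\<^sub>R A) ** (B :: real^'m^'n) = c *\<^sub>R (A ** B)" "A ** (c *\<^sub>R B) = c *\<^sub>R (A ** B)"
  by (simp_all add: matrix_matrix_mult_def vec_eq_iff sum_distrib_left mult_ac)

lemma prob_space_normal_law: "0 < \<sigma> \<Longrightarrow> prob_space (normal_law \<sigma>)"
  by (rule prob_space_normal_density)

text \<open>The product of the coordinate densities depends on the Euclidean norm only. Substituting
  \<open>matrix_inv M *v t\<close> turns the squared norm into the quadratic form of the inverse of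
  \<open>M ** transpose M\<close>, and the absolute determinant of \<open>M\<close> is the root of
  the determinant of that product.\<close>

lemma gauss_density_linear_image:
  fixes M :: "real^'k::finite^'k"
  assumes M: "invertible M" and \<sigma>: "0 < \<sigma>"
  shows "distr (PiM (UNIV :: 'k set) (\<lambda>_. normal_law \<sigma>)) borel (\<lambda>z. M *v (\<chi> i. z i))
    = density lborel (\<lambda>t. ennreal (gauss_density (\<sigma>\<^sup>2 *\<^sub>R (M ** transpose M)) t))"
proof -
  let ?\<phi> = "\<lambda>x::real^'k. \<Prod>i\<in>UNIV. normal_density 0 \<sigma> (x $ i)"
  have P: "distr (PiM (UNIV :: 'k set) (\<lambda>_. normal_law \<sigma>)) borel (\<lambda>z. \<chi> i. z i)
      = density (lborel :: (real^'k) measure) (\<lambda>x. ennreal (?\<phi> x))"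
    by (rule PiM_density_cart) (use prob_space_normal_law[OF \<sigma>] in auto)
  have meas: "(\<lambda>z. (\<chi> i. z i) :: real^'k) \<in> borel_measurable (PiM UNIV (\<lambda>_. normal_law \<sigma>))"
    by (subst borel_measurable_euclidean_space) (auto simp: Basis_vec_def inner_axis)
  have \<phi>_meas[measurable]: "?\<phi> \<in> borel_measurable borel"
    unfolding normal_density_def by (intro borel_measurable_continuous_onI continuous_intros) (use \<sigma> in auto)
  have "prob_space (density (lborel :: (real^'k) measure) (\<lambda>x. ennreal (?\<phi> x)))"
    unfolding P[symmetric] by (intro prob_space.prob_space_distr prob_space_PiM prob_space_normal_law \<sigma> meas)
  then have "(\<integral>\<^sup>+x. ennreal (?\<phi> x) \<partial>lborel) = 1"
    using prob_space.emeasure_space_1 by (fastforce simp: emeasure_density)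
  then have int: "integrable lborel ?\<phi>"
    by (intro integrableI_nonneg) (auto intro!: prod_nonneg)
  have cont: "continuous_on UNIV ((*v) M)"
    by (intro linear_continuous_on) (simp add: matrix_vector_mul_linear linear_conv_bounded_linear[symmetric])
  have "distr (PiM (UNIV :: 'k set) (\<lambda>_. normal_law \<sigma>)) borel (\<lambda>z. M *v (\<chi> i. z i))
      = distr (distr (PiM (UNIV :: 'k set) (\<lambda>_. normal_law \<sigma>)) borel (\<lambda>z. \<chi> i. z i)) borel ((*v) M)"
    using meas borel_measurable_continuous_onI[OF cont] by (subst distr_distr) (simp_all add: o_def)
  also have "\<dots> = density lborel (\<lambda>t. ennreal (?\<phi> (matrix_inv M *v t) / \<bar>det M\<bar>))"
    unfolding P by (rule distr_density_linear[OF M int]) (simp add: prod_nonneg)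
  also have "\<dots> = density lborel (\<lambda>t. ennreal (gauss_density (\<sigma>\<^sup>2 *\<^sub>R (M ** transpose M)) t))"
  proof -
    have "?\<phi> (matrix_inv M *v t) / \<bar>det M\<bar> = gauss_density (\<sigma>\<^sup>2 *\<^sub>R (M ** transpose M)) t" for t
    proof -
      let ?y = "matrix_inv M *v t"
      have tM: "transpose M ** transpose (matrix_inv M) = mat 1"
        by (simp add: matrix_inv(2)[OF M] matrix_transpose_mul[symmetric] transpose_mat)
      have "(M ** transpose M) ** (transpose (matrix_inv M) ** matrix_inv M)
          = M ** (transpose M ** transpose (matrix_inv M)) ** matrix_inv M"
        by (simp add: matrix_mul_assoc)
      then have "(M ** transpose M) ** (transpose (matrix_inv M) ** matrix_inv M) = mat 1"
        by (simp add: tM matrix_inv(1)[OF M])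
      then have "(\<sigma>\<^sup>2 *\<^sub>R (M ** transpose M)) ** ((1 / \<sigma>\<^sup>2) *\<^sub>R (transpose (matrix_inv M) ** matrix_inv M)) = mat 1"
        using \<sigma> by (simp add: scaleR_matrix_mult)
      then have inv: "matrix_inv (\<sigma>\<^sup>2 *\<^sub>R (M ** transpose M)) = (1 / \<sigma>\<^sup>2) *\<^sub>R (transpose (matrix_inv M) ** matrix_inv M)"
        by (rule matrix_inv_eqI)
      have quad: "t \<bullet> (matrix_inv (\<sigma>\<^sup>2 *\<^sub>R (M ** transpose M)) *v t) = (?y \<bullet> ?y) / \<sigma>\<^sup>2"
        unfolding inv by (simp add: scaleR_matrix_vector_assoc[symmetric] matrix_vector_mul_assoc[symmetric]
            inner_matrix_vector transpose_transpose del: transpose_matrix_vector)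
      have "?\<phi> ?y = (\<Prod>i\<in>(UNIV :: 'k set). 1 / sqrt (2 * pi * \<sigma>\<^sup>2)) * (\<Prod>i\<in>UNIV. exp (- (?y $ i)\<^sup>2 / (2 * \<sigma>\<^sup>2)))"
        unfolding normal_density_def prod.distrib[symmetric] by simp
      also have "(\<Prod>i\<in>UNIV. exp (- (?y $ i)\<^sup>2 / (2 * \<sigma>\<^sup>2))) = exp (- (?y \<bullet> ?y / \<sigma>\<^sup>2) / 2)"
        by (simp add: exp_sum[symmetric] inner_vec_def power2_eq_square sum_divide_distrib sum_negf mult_ac)
      finally have "?\<phi> ?y = (1 / sqrt (2 * pi * \<sigma>\<^sup>2)) ^ CARD('k) * exp (- (?y \<bullet> ?y / \<sigma>\<^sup>2) / 2)"
        by simp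
      moreover have "sqrt ((2 * pi) ^ CARD('k) * det (\<sigma>\<^sup>2 *\<^sub>R (M ** transpose M)))
          = sqrt (2 * pi * \<sigma>\<^sup>2) ^ CARD('k) * \<bar>det M\<bar>"
      proof -
        have eq: "(2 * pi) ^ CARD('k) * det (\<sigma>\<^sup>2 *\<^sub>R (M ** transpose M)) = (2 * pi * \<sigma>\<^sup>2) ^ CARD('k) * (det M)\<^sup>2"
          by (simp add: det_scaleR det_mul power2_eq_square power_mult_distrib)
        show ?thesis
          unfolding eq real_sqrt_mult[of "(2 * pi * \<sigma>\<^sup>2) ^ CARD('k)"] real_sqrt_abs
            real_sqrt_power[of "2 * pi * \<sigma>\<^sup>2"] ..
      qed
      ultimately show ?thesis
        unfolding gauss_density_def quad by (simp add: power_divide)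
    qed
    then show ?thesis by simp
  qed
  finally show ?thesis .
qed


lemma continuous_on_gauss_density: "continuous_on A (gauss_density (\<Gamma> :: real^'k::finite^'k))"
proof -
  have "continuous_on A (\<lambda>t. exp (- (t \<bullet> (matrix_inv \<Gamma> *v t)) / 2) * c)" for c :: real
    by (intro continuous_intros linear_continuous_on)
      (auto simp: matrix_vector_mul_linear linear_conv_bounded_linear[symmetric])
  from this[of "1 / sqrt ((2 * pi) ^ CARD('k) * det \<Gamma>)"] show ?thesis
    by (simp add: gauss_density_def[abs_def])
qed

lemma borel_measurable_gauss_density[measurable]: "gauss_density (\<Gamma> :: real^'k::finite^'k) \<in> borel_measurable borel"
  by (intro borel_measurable_continuous_onI continuous_on_gauss_density)

text \<open>No integral is evaluated: the density is the law of \<open>psd_sqrt \<Gamma>\<close>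
  applied to independent standard normals, hence has mass 1.\<close>

lemma nn_integral_gauss_density:
  assumes "posdef (\<Gamma> :: real^'k::finite^'k)"
  shows "(\<integral>\<^sup>+t. ennreal (gauss_density \<Gamma> t) \<partial>lborel) = 1"
proof -
  let ?M = "psd_sqrt \<Gamma>"
  have sq: "posdef ?M" "?M ** ?M = \<Gamma>" by (rule psd_sqrt[OF assms])+
  have \<Gamma>: "1\<^sup>2 *\<^sub>R (?M ** transpose ?M) = \<Gamma>"
    using sq by (simp add: posdef_def)
  have meas: "(\<lambda>z. ?M *v (\<chi> i. z i)) \<in> borel_measurable (PiM UNIV (\<lambda>_. normal_law 1))"
    by (subst borel_measurable_euclidean_space)
      (auto simp: Basis_vec_def inner_axis matrix_vector_mult_def)
  have "prob_space (density lborel (\<lambda>t. ennreal (gauss_density \<Gamma> t)))"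
    using gauss_density_linear_image[OF posdef_invertible[OF sq(1)] zero_less_one] unfolding \<Gamma>
    by (metis (no_types) meas prob_space.prob_space_distr prob_space_PiM prob_space_normal_law zero_less_one)
  then have "emeasure (density lborel (\<lambda>t. ennreal (gauss_density \<Gamma> t))) UNIV = 1"
    using prob_space.emeasure_space_1 by fastforce
  then show ?thesis by (simp add: emeasure_density)
qed

lemma gauss_density_nonneg: "posdef \<Gamma> \<Longrightarrow> 0 \<le> gauss_density \<Gamma> t"
  using posdef_det_pos[of \<Gamma>] by (simp add: gauss_density_def)

text \<open>
  Completing the square, with the inverse of \<open>\<Gamma>'\<close> given by the Sherman-Morrison formula. The constant is left
  unspecified: it is determined afterwards, since both sides are densities of probability measures.
\<close>

lemma gauss_density_rank_one_update:
  fixes \<Gamma> :: "real^'k::finite^'k" and x :: "real^'k"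
  assumes \<Gamma>: "posdef \<Gamma>" and \<sigma>: "0 < \<sigma>"
    and \<Gamma>': "posdef \<Gamma>'" "\<And>v. \<Gamma>' *v v = \<Gamma> *v v + (\<sigma>\<^sup>2 * (x \<bullet> v)) *\<^sub>R x"
  shows "\<exists>C. \<forall>t. (\<integral>\<^sup>+y. ennreal (normal_density 0 \<sigma> y * gauss_density \<Gamma> (t - y *\<^sub>R x)) \<partial>lborel)
      = ennreal (C * gauss_density \<Gamma>' t)"
proof -
  define P where "P = matrix_inv \<Gamma>"
  note P = posdef_matrix_inv[OF \<Gamma>, folded P_def]
  note \<Gamma>P = matrix_inv_vector(1)[OF posdef_invertible[OF \<Gamma>], folded P_def]
  define a where "a = x \<bullet> (P *v x)"
  \<comment> \<open>This is the conditional variance of the coefficient \<open>y\<close> given the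
    sum \<open>t\<close>: the precisions \<open>1 / \<sigma>\<^sup>2\<close> and \<open>a\<close>
    add up. The same number is the coefficient in the Sherman-Morrison correction.\<close>
  define \<kappa> where "\<kappa> = \<sigma>\<^sup>2 / (1 + \<sigma>\<^sup>2 * a)"
  have a: "0 \<le> a" unfolding a_def by (rule posdef_nonneg[OF P])
  have pos: "0 < 1 + \<sigma>\<^sup>2 * a" using a by (simp add: add_pos_nonneg)
  have \<kappa>: "0 < \<kappa>" using \<sigma> pos by (simp add: \<kappa>_def)
  have \<kappa>_eq: "\<kappa> * (1 + \<sigma>\<^sup>2 * a) = \<sigma>\<^sup>2" using pos by (simp add: \<kappa>_def)
  have \<kappa>_inv: "1 / \<kappa> = 1 / \<sigma>\<^sup>2 + a" using \<sigma> pos by (simp add: \<kappa>_def field_simps)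
  have Pinv: "matrix_inv \<Gamma>' *v v = P *v v - (\<kappa> * (x \<bullet> (P *v v))) *\<^sub>R (P *v x)" for v
  proof -
    let ?w = "P *v v - (\<kappa> * (x \<bullet> (P *v v))) *\<^sub>R (P *v x)"
    define b where "b = x \<bullet> (P *v v)"
    have "\<Gamma>' *v ?w = v - (\<kappa> * b) *\<^sub>R x + (\<sigma>\<^sup>2 * (b - \<kappa> * b * a)) *\<^sub>R x"
      unfolding \<Gamma>' b_def[symmetric]
      by (simp add: matrix_vector_mult_diff_distrib matrix_vector_mult_scaleR \<Gamma>P inner_diff_right a_def b_def)
    also have "\<dots> = v + (\<sigma>\<^sup>2 * b - b * (\<kappa> * (1 + \<sigma>\<^sup>2 * a))) *\<^sub>R x"
      by (simp add: algebra_simps)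
    also have "\<dots> = v" unfolding \<kappa>_eq by (simp add: mult.commute)
    finally have "matrix_inv \<Gamma>' *v v = matrix_inv \<Gamma>' *v (\<Gamma>' *v ?w)" by simp
    then show ?thesis by (simp add: matrix_inv_vector(2)[OF posdef_invertible[OF \<Gamma>'(1)]])
  qed
  let ?D = "\<lambda>\<Gamma>. sqrt ((2 * pi) ^ CARD('k) * det (\<Gamma> :: real^'k^'k))"
  have D: "0 < ?D \<Gamma>" "0 < ?D \<Gamma>'"
    using posdef_det_pos[OF \<Gamma>] posdef_det_pos[OF \<Gamma>'(1)] by simp_all
  define C where "C = sqrt (2 * pi * \<kappa>) / sqrt (2 * pi * \<sigma>\<^sup>2) * ?D \<Gamma>' / ?D \<Gamma>"
  have C: "0 < C" using \<kappa> \<sigma> D by (simp add: C_def)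
  \<comment> \<open>The joint density factors into the marginal density of \<open>t\<close>, up to
    the constant \<open>C\<close>, and the conditional density of \<open>y\<close>, which is normal
    and integrates to 1.\<close>
  have point: "normal_density 0 \<sigma> y * gauss_density \<Gamma> (t - y *\<^sub>R x)
      = C * gauss_density \<Gamma>' t * normal_density (\<kappa> * (x \<bullet> (P *v t))) (sqrt \<kappa>) y" for y t
  proof -
    define b where "b = x \<bullet> (P *v t)"
    have tPx: "t \<bullet> (P *v x) = b" using posdef_sym[OF P, of t x] by (simp add: b_def inner_commute)
    have e1: "(t - y *\<^sub>R x) \<bullet> (P *v (t - y *\<^sub>R x)) = t \<bullet> (P *v t) - 2 * y * b + y\<^sup>2 * a"
      using tPx by (simp add: matrix_vector_mult_diff_distrib matrix_vector_mult_scaleR inner_diff_left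
          inner_diff_right a_def b_def power2_eq_square algebra_simps)
    have e2: "t \<bullet> (matrix_inv \<Gamma>' *v t) = t \<bullet> (P *v t) - \<kappa> * b\<^sup>2"
      unfolding Pinv by (simp add: inner_diff_right tPx b_def[symmetric] power2_eq_square)
    have e3: "(y - \<kappa> * b)\<^sup>2 / \<kappa> = y\<^sup>2 * (1 / \<sigma>\<^sup>2 + a) - 2 * y * b + \<kappa> * b\<^sup>2"
      unfolding \<kappa>_inv[symmetric] using \<kappa> by (simp add: power2_eq_square field_simps)
    have "- y\<^sup>2 / (2 * \<sigma>\<^sup>2) + - ((t - y *\<^sub>R x) \<bullet> (P *v (t - y *\<^sub>R x))) / 2
        = - (t \<bullet> (matrix_inv \<Gamma>' *v t)) / 2 + - (y - \<kappa> * b)\<^sup>2 / (2 * \<kappa>)"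
    proof -
      have "- (y - \<kappa> * b)\<^sup>2 / (2 * \<kappa>) = - ((y - \<kappa> * b)\<^sup>2 / \<kappa>) / 2" by simp
      then show ?thesis unfolding e1 e2 e3 by (simp add: algebra_simps add_divide_distrib diff_divide_distrib)
    qed
    then have E: "exp (- y\<^sup>2 / (2 * \<sigma>\<^sup>2)) * exp (- ((t - y *\<^sub>R x) \<bullet> (P *v (t - y *\<^sub>R x))) / 2)
        = exp (- (t \<bullet> (matrix_inv \<Gamma>' *v t)) / 2) * exp (- (y - \<kappa> * b)\<^sup>2 / (2 * \<kappa>))"
      unfolding exp_add[symmetric] by simp
    have arrange: "1 / s0 * e1 * (e2 / d) = sk / s0 * d' / d * (e3 / d') * (1 / sk * e4)"
      if "e1 * e2 = e3 * e4" "0 < s0" "0 < sk" "0 < d" "0 < d'" for e1 e2 e3 e4 s0 sk d d' :: real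
      using that by (simp add: field_simps)
    have sk: "(sqrt \<kappa>)\<^sup>2 = \<kappa>" using \<kappa> by simp
    show ?thesis
      unfolding normal_density_def gauss_density_def P_def[symmetric] C_def b_def[symmetric] sk diff_0_right
      by (rule arrange[OF E]) (use \<kappa> \<sigma> D in simp_all)
  qed
  show ?thesis
  proof (intro exI allI)
    fix t
    let ?N = "normal_density (\<kappa> * (x \<bullet> (P *v t))) (sqrt \<kappa>)"
    have "(\<integral>\<^sup>+y. ennreal (?N y) \<partial>lborel) = 1"
      using prob_space.emeasure_space_1[OF prob_space_normal_density[of "sqrt \<kappa>"]] \<kappa>
      by (simp add: emeasure_density)
    then show "(\<integral>\<^sup>+y. ennreal (normal_density 0 \<sigma> y * gauss_density \<Gamma> (t - y *\<^sub>R x)) \<partial>lborel)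
      = ennreal (C * gauss_density \<Gamma>' t)"
      unfolding point using C gauss_density_nonneg[OF \<Gamma>'(1)]
      by (simp add: ennreal_mult' nn_integral_cmult)
  qed
qed


text \<open>The new error is independent of the old sum, so by Fubini the new density is a mixture
  of translates of the old one along \<open>x j\<close>, which the rank-one update evaluates. The
  constant left open there must be 1, since the law and the Gaussian density both have mass
  1.\<close>

lemma gauss_density_insert_row:
  fixes x :: "'i \<Rightarrow> real^'k::finite"
  assumes J: "finite J" "j \<notin> J" and \<sigma>: "0 < \<sigma>" and \<Gamma>: "posdef (row_gram x J)"
    and law: "distr (PiM J (\<lambda>_. normal_law \<sigma>)) borel (\<lambda>u. \<Sum>i\<in>J. u i *\<^sub>R x i)
      = density lborel (\<lambda>t. ennreal (gauss_density (\<sigma>\<^sup>2 *\<^sub>R row_gram x J) t))"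
  shows "posdef (row_gram x (insert j J))"
    and "distr (PiM (insert j J) (\<lambda>_. normal_law \<sigma>)) borel (\<lambda>u. \<Sum>i\<in>insert j J. u i *\<^sub>R x i)
      = density lborel (\<lambda>t. ennreal (gauss_density (\<sigma>\<^sup>2 *\<^sub>R row_gram x (insert j J)) t))"
proof -
  interpret N: prob_space "normal_law \<sigma>" by (rule prob_space_normal_law[OF \<sigma>])
  interpret product_prob_space "\<lambda>_::'i. normal_law \<sigma>"
    by (simp add: product_prob_space_def product_prob_space_axioms_def product_sigma_finite_def
        N.sigma_finite_measure_axioms N.prob_space_axioms)
  show pd: "posdef (row_gram x (insert j J))"
  proof (rule posdef_row_gram)
    fix c assume c: "\<And>i. i \<in> insert j J \<Longrightarrow> x i \<bullet> c = 0"
    then have "c \<bullet> (row_gram x J *v c) = 0" by (simp add: inner_row_gram)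
    then show "c = 0" using \<Gamma> by (force simp: posdef_def)
  qed (use J in simp)
  define \<Gamma>' where "\<Gamma>' = \<sigma>\<^sup>2 *\<^sub>R row_gram x (insert j J)"
  have \<sigma>2: "0 < \<sigma>\<^sup>2" using \<sigma> by simp
  have "\<exists>C. \<forall>t. (\<integral>\<^sup>+y. ennreal (normal_density 0 \<sigma> y * gauss_density (\<sigma>\<^sup>2 *\<^sub>R row_gram x J) (t - y *\<^sub>R x j)) \<partial>lborel)
      = ennreal (C * gauss_density \<Gamma>' t)"
    by (rule gauss_density_rank_one_update[OF posdef_scaleR[OF \<Gamma> \<sigma>2] \<sigma>])
      (use J in \<open>simp_all add: \<Gamma>'_def posdef_scaleR[OF pd \<sigma>2] scaleR_matrix_vector_assoc[symmetric]
          row_gram_vector scaleR_add_right add.commute\<close>)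
  then obtain C where C: "(\<integral>\<^sup>+y. ennreal (normal_density 0 \<sigma> y * gauss_density (\<sigma>\<^sup>2 *\<^sub>R row_gram x J) (t - y *\<^sub>R x j)) \<partial>lborel)
      = ennreal (C * gauss_density \<Gamma>' t)" for t by blast
  let ?W = "\<lambda>J u. \<Sum>i\<in>J. u i *\<^sub>R x i"
  let ?L = "distr (PiM (insert j J) (\<lambda>_. normal_law \<sigma>)) borel (?W (insert j J))"
  have measW: "?W K \<in> borel_measurable (PiM K (\<lambda>_. normal_law \<sigma>))" if "finite K" for K
    by (intro borel_measurable_sum borel_measurable_scaleR) simp_all
  note measW[OF J(1), measurable]
  have eq: "?L = density lborel (\<lambda>t. ennreal (C * gauss_density \<Gamma>' t))"
  proof (rule measure_eqI)
    fix A assume "A \<in> sets ?L"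
    then have A[measurable]: "A \<in> sets borel" by simp
    have [measurable]: "(\<lambda>u. indicator A (?W (insert j J) u) :: ennreal) \<in> borel_measurable (PiM (insert j J) (\<lambda>_. normal_law \<sigma>))"
      using measurable_compose[OF measW[of "insert j J"], of "indicator A"] J by simp
    have "emeasure ?L A = (\<integral>\<^sup>+u. indicator A (?W (insert j J) u) \<partial>PiM (insert j J) (\<lambda>_. normal_law \<sigma>))"
      using measW[of "insert j J"] J by (simp add: nn_integral_distr flip: nn_integral_indicator)
    also have "\<dots> = (\<integral>\<^sup>+y. \<integral>\<^sup>+u. indicator A (?W (insert j J) (u(j := y))) \<partial>PiM J (\<lambda>_. normal_law \<sigma>) \<partial>normal_law \<sigma>)"
      by (rule product_nn_integral_insert_rev) (use J in auto)
    also have "\<dots> = (\<integral>\<^sup>+y. \<integral>\<^sup>+t. indicator A (t + y *\<^sub>R x j) \<partial>distr (PiM J (\<lambda>_. normal_law \<sigma>)) borel (?W J) \<partial>normal_law \<sigma>)"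
    proof (rule nn_integral_cong)
      fix y
      have "?W (insert j J) (u(j := y)) = ?W J u + y *\<^sub>R x j" for u
      proof -
        have "?W J (u(j := y)) = ?W J u" using J by (intro sum.cong) auto
        then show ?thesis using J by (simp add: add.commute)
      qed
      then show "(\<integral>\<^sup>+u. indicator A (?W (insert j J) (u(j := y))) \<partial>PiM J (\<lambda>_. normal_law \<sigma>))
          = (\<integral>\<^sup>+t. indicator A (t + y *\<^sub>R x j) \<partial>distr (PiM J (\<lambda>_. normal_law \<sigma>)) borel (?W J))"
        by (subst nn_integral_distr) simp_all
    qed
    also have "\<dots> = (\<integral>\<^sup>+y. ennreal (normal_density 0 \<sigma> y) * (\<integral>\<^sup>+t. ennreal (gauss_density (\<sigma>\<^sup>2 *\<^sub>R row_gram x J) t) * indicator A (t + y *\<^sub>R x j) \<partial>lborel) \<partial>lborel)"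
      unfolding law by (simp add: nn_integral_density)
    also have "\<dots> = (\<integral>\<^sup>+y. \<integral>\<^sup>+t. ennreal (normal_density 0 \<sigma> y * gauss_density (\<sigma>\<^sup>2 *\<^sub>R row_gram x J) (t - y *\<^sub>R x j)) * indicator A t \<partial>lborel \<partial>lborel)"
    proof (rule nn_integral_cong)
      fix y
      have "(\<integral>\<^sup>+t. ennreal (gauss_density (\<sigma>\<^sup>2 *\<^sub>R row_gram x J) t) * indicator A (t + y *\<^sub>R x j) \<partial>lborel)
          = (\<integral>\<^sup>+t. ennreal (gauss_density (\<sigma>\<^sup>2 *\<^sub>R row_gram x J) (- (y *\<^sub>R x j) + t)) * indicator A t \<partial>lborel)"
        by (subst lborel_distr_plus[of "- (y *\<^sub>R x j)", symmetric]) (simp add: nn_integral_distr)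
      then show "ennreal (normal_density 0 \<sigma> y) * (\<integral>\<^sup>+t. ennreal (gauss_density (\<sigma>\<^sup>2 *\<^sub>R row_gram x J) t) * indicator A (t + y *\<^sub>R x j) \<partial>lborel)
          = (\<integral>\<^sup>+t. ennreal (normal_density 0 \<sigma> y * gauss_density (\<sigma>\<^sup>2 *\<^sub>R row_gram x J) (t - y *\<^sub>R x j)) * indicator A t \<partial>lborel)"
        by (simp add: nn_integral_cmult[symmetric] ennreal_mult' mult.assoc)
    qed
    also have "\<dots> = (\<integral>\<^sup>+t. \<integral>\<^sup>+y. ennreal (normal_density 0 \<sigma> y * gauss_density (\<sigma>\<^sup>2 *\<^sub>R row_gram x J) (t - y *\<^sub>R x j)) * indicator A t \<partial>lborel \<partial>lborel)"
      by (rule lborel_pair.Fubini') measurable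
    also have "\<dots> = (\<integral>\<^sup>+t. ennreal (C * gauss_density \<Gamma>' t) * indicator A t \<partial>lborel)"
      by (simp add: nn_integral_multc C)
    also have "\<dots> = emeasure (density lborel (\<lambda>t. ennreal (C * gauss_density \<Gamma>' t))) A"
      by (simp add: emeasure_density)
    finally show "emeasure ?L A = emeasure (density lborel (\<lambda>t. ennreal (C * gauss_density \<Gamma>' t))) A" .
  qed simp
  have pd': "posdef \<Gamma>'" unfolding \<Gamma>'_def by (rule posdef_scaleR[OF pd \<sigma>2])
  have "C = 1"
  proof -
    have "prob_space ?L"
      using J by (intro prob_space.prob_space_distr prob_space_PiM N.prob_space_axioms measW) simp
    then have "emeasure (density lborel (\<lambda>t. ennreal (C * gauss_density \<Gamma>' t))) UNIV = 1"
      unfolding eq using prob_space.emeasure_space_1 by fastforce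
    then have "(\<integral>\<^sup>+t. ennreal (C * gauss_density \<Gamma>' t) \<partial>lborel) = 1"
      by (simp add: emeasure_density)
    moreover have "(\<integral>\<^sup>+t. ennreal (C * gauss_density \<Gamma>' t) \<partial>lborel) = ennreal C"
      using gauss_density_nonneg[OF pd'] nn_integral_gauss_density[OF pd']
      by (simp add: ennreal_mult'' nn_integral_cmult)
    ultimately show ?thesis by simp
  qed
  then show "?L = density lborel (\<lambda>t. ennreal (gauss_density (\<sigma>\<^sup>2 *\<^sub>R row_gram x (insert j J)) t))"
    using eq by (simp add: \<Gamma>'_def)
qed

text \<open>The map from errors to the sum is in general not invertible. Among the rows there is a
  basis; its part of the sum is an invertible linear image of independent normals, and the remaining
  rows are added singly.\<close>

theorem gauss_density_law:
  fixes x :: "'i \<Rightarrow> real^'k::finite"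
  assumes J: "finite J" and span: "\<And>c. (\<And>i. i \<in> J \<Longrightarrow> x i \<bullet> c = 0) \<Longrightarrow> c = 0" and \<sigma>: "0 < \<sigma>"
  shows "distr (PiM J (\<lambda>_. normal_law \<sigma>)) borel (\<lambda>u. \<Sum>i\<in>J. u i *\<^sub>R x i)
      = density lborel (\<lambda>t. ennreal (gauss_density (\<sigma>\<^sup>2 *\<^sub>R row_gram x J) t))"
proof -
  have "span (x ` J) = UNIV"
  proof (rule ccontr)
    assume "\<not> ?thesis"
    then obtain c where c: "c \<noteq> 0" "\<And>v. v \<in> span (x ` J) \<Longrightarrow> orthogonal c v"
      using orthogonal_to_subspace_exists_gen[of "x ` J" UNIV] by (metis (no_types) iso_tuple_UNIV_I orthogonal_to_subspace_exists psubset_eq subset_UNIV span_UNIV)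
    have "x i \<bullet> c = 0" if "i \<in> J" for i
      using c(2)[OF span_base[of "x i" "x ` J"]] that by (simp add: orthogonal_def inner_commute[of c])
    with span c(1) show False by blast
  qed
  obtain B where B: "B \<subseteq> x ` J" "independent B" "x ` J \<subseteq> span B"
    using maximal_independent_subset[of "x ` J"] by blast
  then have spanB: "span B = UNIV"
    using \<open>span (x ` J) = UNIV\<close> by (metis span_mono span_span top.extremum_unique)
  have "card B = CARD('k)"
    using B(2) spanB by (metis DIM_cart DIM_real dim_UNIV dim_span_eq_card_independent mult.right_neutral)
  obtain J0 where J0: "J0 \<subseteq> J" "inj_on x J0" "B = x ` J0"
    using B(1) by (auto simp: subset_image_inj)
  have fin0: "finite J0" using J J0(1) by (rule finite_subset[rotated])
  have "card J0 = CARD('k)"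
    using J0 \<open>card B = _\<close> by (simp add: card_image)
  then obtain \<pi> :: "'k \<Rightarrow> 'i" where \<pi>: "bij_betw \<pi> UNIV J0"
    using finite_same_card_bij[of "UNIV :: 'k set" J0] fin0 by auto
  then have inj\<pi>: "inj \<pi>" and im\<pi>: "range \<pi> = J0" by (auto simp: bij_betw_def)
  \<comment> \<open>The selected rows become the columns, so that \<open>M\<close> sends a vector of
    errors to their weighted sum and \<open>M ** transpose M\<close> is the Gram matrix of the
    selection.\<close>
  define M where "M = (\<chi> a b. x (\<pi> b) $ a)"
  have Mv: "M *v v = (\<Sum>b\<in>UNIV. v $ b *\<^sub>R x (\<pi> b))" for v
    by (simp add: M_def matrix_vector_mult_def vec_eq_iff mult.commute)
  have "transpose M *v c = 0 \<Longrightarrow> c = 0" for c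
  proof -
    assume "transpose M *v c = 0"
    then have "x (\<pi> b) \<bullet> c = 0" for b
      by (simp add: M_def transpose_def matrix_vector_mult_def vec_eq_iff inner_vec_def del: transpose_matrix_vector)
    then have "orthogonal c v" if "v \<in> B" for v
      using that J0(3) im\<pi> by (auto simp: orthogonal_def inner_commute)
    then have "orthogonal c c" using orthogonal_to_span[of c B c] spanB by auto
    then show "c = 0" by (simp add: orthogonal_self)
  qed
  then have "invertible (transpose M)"
    unfolding invertible_left_inverse matrix_left_invertible_ker by blast
  then have M: "invertible M" by (simp add: invertible_det_nz)
  have MM: "M ** transpose M = row_gram x J0"
    by (simp add: vec_eq_iff M_def row_gram_def transpose_def matrix_matrix_mult_def
        sum.reindex[OF inj\<pi>, folded im\<pi>, unfolded im\<pi>[symmetric]] im\<pi>[symmetric] sum.reindex[OF inj\<pi>])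
  have N: "prob_space (normal_law \<sigma>)" by (rule prob_space_normal_law[OF \<sigma>])
  \<comment> \<open>Relabelling \<open>J0\<close> by \<open>'k\<close> turns the errors with indices
    in \<open>J0\<close> into a vector to which \<open>M\<close> can be applied.\<close>
  have re: "distr (PiM J0 (\<lambda>_. normal_law \<sigma>)) (PiM UNIV (\<lambda>_. normal_law \<sigma>)) (\<lambda>\<omega>. \<lambda>n\<in>UNIV. \<omega> (\<pi> n)) = PiM UNIV (\<lambda>_. normal_law \<sigma>)"
    by (rule distr_PiM_reindex) (use N inj\<pi> im\<pi> in auto)
  have meas: "(\<lambda>z. M *v (\<chi> i. z i)) \<in> borel_measurable (PiM UNIV (\<lambda>_. normal_law \<sigma>))"
    unfolding Mv by (intro borel_measurable_sum borel_measurable_scaleR) simp_all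
  have base: "distr (PiM J0 (\<lambda>_. normal_law \<sigma>)) borel (\<lambda>u. \<Sum>i\<in>J0. u i *\<^sub>R x i)
      = density lborel (\<lambda>t. ennreal (gauss_density (\<sigma>\<^sup>2 *\<^sub>R row_gram x J0) t))"
  proof -
    have "distr (PiM UNIV (\<lambda>_. normal_law \<sigma>)) borel (\<lambda>z. M *v (\<chi> i. z i))
        = distr (PiM J0 (\<lambda>_. normal_law \<sigma>)) borel ((\<lambda>z. M *v (\<chi> i. z i)) \<circ> (\<lambda>\<omega>. \<lambda>n\<in>UNIV. \<omega> (\<pi> n)))"
      using meas
      by (subst re[symmetric], subst distr_distr) (auto intro!: measurable_restrict measurable_component_singleton simp: im\<pi>[symmetric])
    also have "(\<lambda>z. M *v (\<chi> i. z i)) \<circ> (\<lambda>\<omega>. \<lambda>n\<in>UNIV. \<omega> (\<pi> n)) = (\<lambda>u. \<Sum>i\<in>J0. u i *\<^sub>R x i)"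
      by (simp add: fun_eq_iff Mv im\<pi>[symmetric] sum.reindex[OF inj\<pi>])
    finally show ?thesis
      using gauss_density_linear_image[OF M \<sigma>] unfolding MM by simp
  qed
  have pd0: "posdef (row_gram x J0)"
  proof (rule posdef_row_gram[OF fin0])
    fix c assume "\<And>i. i \<in> J0 \<Longrightarrow> x i \<bullet> c = 0"
    then have "orthogonal c v" if "v \<in> B" for v
      using that J0(3) by (auto simp: orthogonal_def inner_commute)
    then have "orthogonal c c" using orthogonal_to_span[of c B c] spanB by auto
    then show "c = 0" by (simp add: orthogonal_self)
  qed
  \<comment> \<open>Starting from a basis instead of the empty set keeps every intermediate Gram
    matrix positive definite, so that a density exists at every stage.\<close>
  have "posdef (row_gram x (J0 \<union> K)) \<and> distr (PiM (J0 \<union> K) (\<lambda>_. normal_law \<sigma>)) borel (\<lambda>u. \<Sum>i\<in>J0 \<union> K. u i *\<^sub>R x i)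
      = density lborel (\<lambda>t. ennreal (gauss_density (\<sigma>\<^sup>2 *\<^sub>R row_gram x (J0 \<union> K)) t))"
    if "finite K" "K \<inter> J0 = {}" for K
    using that
  proof (induction K rule: finite_induct)
    case empty
    then show ?case using base pd0 by simp
  next
    case (insert j K)
    have "finite (J0 \<union> K)" "j \<notin> J0 \<union> K" using insert fin0 by auto
    from gauss_density_insert_row[OF this \<sigma>] insert show ?case by auto
  qed
  from this[of "J - J0"] J J0(1) show ?thesis
    by (simp add: Un_absorb1 Diff_Int_distrib2)
qed

section \<open>The averaging map\<close>

lemma vjoin_nth [simp]: "vjoin a b $ Inl p = a $ p" "vjoin a b $ Inr q = b $ q"
  by (simp_all add: vjoin_def)

lemma vfst_nth [simp]: "vfst v $ p = v $ Inl p" and vsnd_nth [simp]: "vsnd v $ q = v $ Inr q"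
  by (simp_all add: vfst_def vsnd_def)

lemma vec_sum_eqI: "vfst v = vfst w \<Longrightarrow> vsnd v = vsnd w \<Longrightarrow> v = (w :: real^('a::finite + 'b::finite))"
  by (simp add: vec_eq_iff split_sum_all)

lemma vfst_vjoin [simp]: "vfst (vjoin a b) = a" and vsnd_vjoin [simp]: "vsnd (vjoin a b) = b"
  by (simp_all add: vec_eq_iff)

lemma vsnd_linear: "linear vsnd"
  by (simp add: linear_iff vec_eq_iff)

lemma vfst_simps [simp]: "vfst (v + w) = vfst v + vfst w" "vfst (v - w) = vfst v - vfst w"
    "vfst (c *\<^sub>R v) = c *\<^sub>R vfst v" "vfst 0 = 0"
  and vsnd_simps [simp]: "vsnd (v + w) = vsnd v + vsnd w" "vsnd (v - w) = vsnd v - vsnd w"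
    "vsnd (c *\<^sub>R v) = c *\<^sub>R vsnd v" "vsnd 0 = 0"
  by (simp_all add: vec_eq_iff)

lemma sum_UNIV_Plus: "(\<Sum>i\<in>(UNIV :: ('a::finite + 'b::finite) set). f i) = (\<Sum>p\<in>UNIV. f (Inl p)) + (\<Sum>q\<in>UNIV. f (Inr q))"
  unfolding UNIV_Plus_UNIV[symmetric] by (subst sum.Plus) simp_all

lemma inner_vec_sum: "v \<bullet> w = vfst v \<bullet> vfst w + vsnd v \<bullet> vsnd (w :: real^('a::finite + 'b::finite))"
  by (simp add: inner_vec_def sum_UNIV_Plus)

section \<open>Limits of matrix expressions\<close>

lemma tendsto_matrix_vector_mult:
  fixes A :: "'z \<Rightarrow> real^'n::finite^'m::finite"
  assumes "(A \<longlongrightarrow> A0) F" "(x \<longlongrightarrow> x0) F"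
  shows "((\<lambda>n. A n *v x n) \<longlongrightarrow> A0 *v x0) F"
  unfolding matrix_vector_mult_def
  by (intro tendsto_vec_lambda tendsto_sum tendsto_mult tendsto_vec_nth assms)

lemma tendsto_vjoin:
  assumes "(a \<longlongrightarrow> a0) F" "(b \<longlongrightarrow> b0) F"
  shows "((\<lambda>n. vjoin (a n) (b n)) \<longlongrightarrow> vjoin a0 b0) F"
  unfolding vjoin_def
  by (intro tendsto_vec_lambda) (auto split: sum.split intro!: tendsto_vec_nth assms)

lemma tendsto_vsnd: "(v \<longlongrightarrow> v0) F \<Longrightarrow> ((\<lambda>n. vsnd (v n)) \<longlongrightarrow> vsnd v0) F"
  unfolding vsnd_def by (intro tendsto_vec_lambda tendsto_vec_nth)

lemma tendsto_det:
  fixes M :: "'z \<Rightarrow> real^'n::finite^'n"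
  assumes "(M \<longlongrightarrow> L) F"
  shows "((\<lambda>n. det (M n)) \<longlongrightarrow> det L) F"
  unfolding det_def by (intro tendsto_sum tendsto_mult tendsto_prod tendsto_const tendsto_vec_nth assms)

text \<open>By Cramer's rule each entry of the inverse is a quotient of determinants, hence
  continuous wherever the denominator is nonzero.\<close>

lemma tendsto_matrix_inv:
  fixes M :: "'z \<Rightarrow> real^'n::finite^'n"
  assumes M: "(M \<longlongrightarrow> L) F" and inv: "\<forall>\<^sub>F n in F. invertible (M n)" "invertible L"
  shows "((\<lambda>n. matrix_inv (M n)) \<longlongrightarrow> matrix_inv L) F"
proof -
  let ?c = "\<lambda>(M :: real^'n^'n). \<chi> k l. det (\<chi> i j. if j = k then axis l 1 $ i else M $ i $ j) / det M"
  have cramer_inv: "matrix_inv A = ?c A" if "invertible A" for A :: "real^'n^'n"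
  proof -
    have "matrix_inv A *v axis l 1 = (\<chi> k. det (\<chi> i j. if j = k then axis l 1 $ i else A $ i $ j) / det A)" for l
      using cramer[of A "matrix_inv A *v axis l 1" "axis l 1"] that
      by (simp add: invertible_det_nz[symmetric] matrix_inv_vector)
    moreover have "matrix_inv A $ k $ l = (matrix_inv A *v axis l 1) $ k" for k l
      by (simp add: matrix_vector_mult_basis column_def)
    ultimately show ?thesis by (simp add: vec_eq_iff)
  qed
  have "((\<lambda>n. ?c (M n)) \<longlongrightarrow> ?c L) F"
  proof (intro tendsto_vec_lambda tendsto_divide tendsto_det M)
    show "((\<lambda>n. if j = k then axis l 1 $ i else M n $ i $ j) \<longlongrightarrow> (if j = k then axis l 1 $ i else L $ i $ j)) F" for i j k l
      by (auto intro!: tendsto_vec_nth[OF tendsto_vec_nth[OF M]])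
    show "det L \<noteq> 0" using inv(2) by (simp add: invertible_det_nz)
  qed
  moreover have "\<forall>\<^sub>F n in F. ?c (M n) = matrix_inv (M n)"
    using inv(1) by eventually_elim (simp add: cramer_inv)
  ultimately show ?thesis
    unfolding cramer_inv[OF inv(2)] by (rule Lim_transform_eventually)
qed

text \<open>For \<open>A = regr Q\<close> this is the matrix B of the limit distribution, applied to
  \<open>c\<close>.\<close>

definition shift_dir :: "real^'b::finite^'a::finite \<Rightarrow> real^'b \<Rightarrow> real^('a + 'b)" where
  "shift_dir A c = vjoin (A *v c) (- c)"

lemma shift_dir_linear: "linear (shift_dir A)"
  unfolding linear_iff
  by (auto simp: shift_dir_def vec_eq_iff split_sum_all matrix_vector_right_distrib matrix_vector_mult_scaleR)

lemmas shift_dir_scaleR = linear_scale[OF shift_dir_linear]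

lemma tendsto_shift_dir:
  assumes "(A \<longlongrightarrow> A0) F" "(c \<longlongrightarrow> c0) F"
  shows "((\<lambda>n. shift_dir (A n) (c n)) \<longlongrightarrow> shift_dir A0 c0) F"
  unfolding shift_dir_def by (intro tendsto_vjoin tendsto_matrix_vector_mult tendsto_minus assms)

text \<open>The weight of the restricted estimator as a function of the squared distance
  \<open>q\<close>, with \<open>L = exp (- 2 * \<alpha> * k2)\<close> and
  \<open>\<tau> = \<alpha> / \<sigma>\<^sup>2\<close>.\<close>

definition avg_weight :: "real \<Rightarrow> real \<Rightarrow> real \<Rightarrow> real" where
  "avg_weight L \<tau> q = 1 / (1 + L * exp (\<tau> * q))"

text \<open>
  The scaled error of the averaged estimator as a function of the scaled error \<open>x\<close> of the unrestricted one:
  \<open>c\<close> is the scaled second block of the unrestricted estimator and \<open>shift_dir A c\<close> the scaled difference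
  between the restricted and the unrestricted estimator.
\<close>

definition avg_map :: "real \<Rightarrow> real \<Rightarrow> real^'b::finite^'a::finite \<Rightarrow> real^'b^'b \<Rightarrow> real^'b \<Rightarrow> real^('a + 'b) \<Rightarrow> real^('a + 'b)" where
  "avg_map L \<tau> A S \<gamma> x =
     (let c = vsnd x + \<gamma> in x + avg_weight L \<tau> (c \<bullet> (S *v c)) *\<^sub>R shift_dir A c)"

definition avg_map_deriv :: "real \<Rightarrow> real \<Rightarrow> real^'b::finite^'a::finite \<Rightarrow> real^'b^'b \<Rightarrow> real^'b \<Rightarrow> real^('a + 'b) \<Rightarrow> real^('a + 'b) \<Rightarrow> real^('a + 'b)" where
  "avg_map_deriv L \<tau> A S \<gamma> x h =
     (let c = vsnd x + \<gamma>; l = avg_weight L \<tau> (c \<bullet> (S *v c))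
      in h + l *\<^sub>R shift_dir A (vsnd h)
         - (\<tau> * l * (1 - l) * (vsnd h \<bullet> (S *v c) + c \<bullet> (S *v vsnd h))) *\<^sub>R shift_dir A c)"

lemma avg_weight_bounds:
  assumes "0 < L" shows "0 < avg_weight L \<tau> q" "avg_weight L \<tau> q < 1"
  using assms by (simp_all add: avg_weight_def add_pos_pos divide_less_eq)

lemma avg_weight_deriv:
  assumes L: "0 < L"
  shows "(avg_weight L \<tau> has_real_derivative - (\<tau> * avg_weight L \<tau> q * (1 - avg_weight L \<tau> q))) (at q)"
proof -
  have pos: "0 < 1 + L * exp (\<tau> * q)" using L by (simp add: add_pos_pos)
  have "((\<lambda>q. 1 / (1 + L * exp (\<tau> * q))) has_real_derivative
      - (L * (\<tau> * exp (\<tau> * q))) / (1 + L * exp (\<tau> * q))\<^sup>2) (at q)"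
    using pos by (auto intro!: derivative_eq_intros simp: power2_eq_square)
  moreover have "- (L * (\<tau> * exp (\<tau> * q))) / (1 + L * exp (\<tau> * q))\<^sup>2
      = - (\<tau> * avg_weight L \<tau> q * (1 - avg_weight L \<tau> q))"
    using pos by (simp add: avg_weight_def power2_eq_square field_simps)
  ultimately show ?thesis by (simp add: avg_weight_def[abs_def])
qed

lemma avg_map_has_derivative:
  assumes L: "0 < L"
  shows "(avg_map L \<tau> A S \<gamma> has_derivative avg_map_deriv L \<tau> A S \<gamma> x) (at x)"
proof -
  have bl: "bounded_linear vsnd" "bounded_linear (shift_dir A)" "bounded_linear ((*v) S)"
    by (simp_all add: vsnd_linear shift_dir_linear matrix_vector_mul_linear linear_conv_bounded_linear[symmetric])
  let ?c = "\<lambda>x :: real^('a + 'b). vsnd x + \<gamma>"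
  let ?q = "\<lambda>x. ?c x \<bullet> (S *v ?c x)"
  have dc: "(?c has_derivative vsnd) (at x)"
    using has_derivative_add[OF bounded_linear_imp_has_derivative[OF bl(1)] has_derivative_const] by simp
  have dSc: "((\<lambda>x. S *v ?c x) has_derivative (\<lambda>h. S *v vsnd h)) (at x)"
    by (rule bounded_linear.has_derivative[OF bl(3) dc])
  have dq: "(?q has_derivative (\<lambda>h. ?c x \<bullet> (S *v vsnd h) + vsnd h \<bullet> (S *v ?c x))) (at x)"
    by (rule has_derivative_inner[OF dc dSc])
  let ?l = "avg_weight L \<tau> (?q x)"
  have dl: "((\<lambda>x. avg_weight L \<tau> (?q x)) has_derivative
      (\<lambda>h. - (\<tau> * ?l * (1 - ?l)) * (?c x \<bullet> (S *v vsnd h) + vsnd h \<bullet> (S *v ?c x)))) (at x)"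
    using has_derivative_compose[OF dq avg_weight_deriv[OF L, of \<tau> "?q x", unfolded has_field_derivative_def]]
    by simp
  have dE: "((\<lambda>x. shift_dir A (?c x)) has_derivative (\<lambda>h. shift_dir A (vsnd h))) (at x)"
    by (rule bounded_linear.has_derivative[OF bl(2) dc])
  have "((\<lambda>x. x + avg_weight L \<tau> (?q x) *\<^sub>R shift_dir A (?c x)) has_derivative
     (\<lambda>h. h + (?l *\<^sub>R shift_dir A (vsnd h)
        + (- (\<tau> * ?l * (1 - ?l)) * (?c x \<bullet> (S *v vsnd h) + vsnd h \<bullet> (S *v ?c x))) *\<^sub>R shift_dir A (?c x)))) (at x)"
    by (intro has_derivative_add has_derivative_ident has_derivative_scaleR dl dE)
  then show ?thesis
    unfolding avg_map_def[abs_def] avg_map_deriv_def[abs_def] Let_def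
    by (rule has_derivative_eq_rhs) (simp add: fun_eq_iff algebra_simps)
qed

lemma tendsto_avg_weight:
  assumes "0 < L" "(q \<longlongrightarrow> q0) F"
  shows "((\<lambda>n. avg_weight L \<tau> (q n)) \<longlongrightarrow> avg_weight L \<tau> q0) F"
proof -
  have "1 + L * exp (\<tau> * q0) \<noteq> 0" using assms(1) by (smt (verit) exp_gt_zero mult_pos_pos)
  then show ?thesis unfolding avg_weight_def by (intro tendsto_intros assms)
qed

lemma tendsto_avg_map:
  assumes L: "0 < L" and "(A \<longlongrightarrow> A0) F" "(S \<longlongrightarrow> S0) F" "(\<gamma> \<longlongrightarrow> \<gamma>0) F" "(x \<longlongrightarrow> x0) F"
  shows "((\<lambda>n. avg_map L \<tau> (A n) (S n) (\<gamma> n) (x n)) \<longlongrightarrow> avg_map L \<tau> A0 S0 \<gamma>0 x0) F"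
  unfolding avg_map_def Let_def
  by (intro tendsto_add tendsto_scaleR tendsto_avg_weight tendsto_inner tendsto_matrix_vector_mult
      tendsto_shift_dir tendsto_vsnd assms)

lemma tendsto_avg_map_deriv:
  assumes L: "0 < L" and "(A \<longlongrightarrow> A0) F" "(S \<longlongrightarrow> S0) F" "(\<gamma> \<longlongrightarrow> \<gamma>0) F" "(x \<longlongrightarrow> x0) F"
  shows "((\<lambda>n. det (matrix (avg_map_deriv L \<tau> (A n) (S n) (\<gamma> n) (x n)))) \<longlongrightarrow> det (matrix (avg_map_deriv L \<tau> A0 S0 \<gamma>0 x0))) F"
  unfolding matrix_def avg_map_deriv_def Let_def
  by (intro tendsto_det tendsto_vec_lambda tendsto_vec_nth tendsto_add tendsto_diff tendsto_scaleR tendsto_mult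
      tendsto_avg_weight tendsto_inner tendsto_matrix_vector_mult tendsto_shift_dir tendsto_vsnd tendsto_const assms)

lemma continuous_on_avg_map: "0 < L \<Longrightarrow> continuous_on UNIV (avg_map L \<tau> A S \<gamma>)"
  unfolding continuous_on_def by (auto intro!: tendsto_avg_map tendsto_ident_at)

lemma continuous_on_det_avg_map_deriv: "0 < L \<Longrightarrow> continuous_on UNIV (\<lambda>x. det (matrix (avg_map_deriv L \<tau> A S \<gamma> x)))"
  unfolding continuous_on_def by (auto intro!: tendsto_avg_map_deriv tendsto_ident_at)

text \<open>The source of bijectivity: the shifted second block is only rescaled, and by a factor
  that depends on its own quadratic form alone.\<close>

lemma vsnd_avg_map:
  "vsnd (avg_map L \<tau> A S \<gamma> x) + \<gamma>
    = (1 - avg_weight L \<tau> ((vsnd x + \<gamma>) \<bullet> (S *v (vsnd x + \<gamma>)))) *\<^sub>R (vsnd x + \<gamma>)"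
  by (simp add: avg_map_def shift_dir_def Let_def algebra_simps)

lemma avg_weight_mono: "0 < L \<Longrightarrow> 0 < \<tau> \<Longrightarrow> q \<le> q' \<Longrightarrow> avg_weight L \<tau> q' \<le> avg_weight L \<tau> q"
  unfolding avg_weight_def by (intro divide_left_mono add_left_mono mult_left_mono) (auto simp: add_pos_pos)

text \<open>Two shifted second blocks with the same image are positive multiples of each other. The
  one with the larger form has the at least equally large factor, so equal images force equal
  vectors. With the second blocks equal, the first blocks are moved by the same vector.\<close>

lemma inj_avg_map:
  assumes L: "0 < L" and \<tau>: "0 < \<tau>" and S: "posdef S"
  shows "inj (avg_map L \<tau> A S \<gamma>)"
proof (rule injI)
  fix x y assume eq: "avg_map L \<tau> A S \<gamma> x = avg_map L \<tau> A S \<gamma> y"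
  let ?q = "\<lambda>c. c \<bullet> (S *v c)"
  let ?w = "\<lambda>c. 1 - avg_weight L \<tau> (?q c)"
  have wpos: "0 < ?w c" for c using avg_weight_bounds[OF L] by simp
  \<comment> \<open>Here \<open>c\<close> is \<open>d\<close> times a ratio of at most 1, while its
    form is at least that of \<open>d\<close>; hence the ratio is 1. The order of the two forms may
    be assumed by symmetry.\<close>
  have radial: "c = d" if cd: "?w c *\<^sub>R c = ?w d *\<^sub>R d" and le: "?q d \<le> ?q c" for c d
  proof -
    have c: "c = (?w d / ?w c) *\<^sub>R d"
      using arg_cong[OF cd, of "\<lambda>v. (1 / ?w c) *\<^sub>R v"] wpos[of c] by simp
    have "?w d \<le> ?w c" using avg_weight_mono[OF L \<tau> le] by simp
    then have r: "?w d / ?w c \<le> 1" "0 < ?w d / ?w c" using wpos[of c] wpos[of d] by (simp_all add: divide_le_eq)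
    show ?thesis
    proof (cases "d = 0")
      case True then show ?thesis using c by simp
    next
      case False
      have "?q c = (?w d / ?w c)\<^sup>2 * ?q d"
        by (subst (1 2) c) (simp add: matrix_vector_mult_scaleR power2_eq_square)
      moreover have "0 < ?q d" using S False by (simp add: posdef_def)
      ultimately have "1 * ?q d \<le> (?w d / ?w c)\<^sup>2 * ?q d" using le by linarith
      then have "1 \<le> (?w d / ?w c)\<^sup>2" using \<open>0 < ?q d\<close> by (rule mult_right_le_imp_le)
      with r have "?w d / ?w c = 1"
        by (smt (verit) power2_eq_square mult_less_cancel_left1 mult_left_le)
      then show ?thesis using c by simp
    qed
  qed
  let ?c = "vsnd x + \<gamma>" and ?d = "vsnd y + \<gamma>"
  have "?w ?c *\<^sub>R ?c = ?w ?d *\<^sub>R ?d"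
    using vsnd_avg_map[of L \<tau> A S \<gamma> x] vsnd_avg_map[of L \<tau> A S \<gamma> y] eq by simp
  then have cd: "?c = ?d"
    using radial[of ?c ?d] radial[of ?d ?c] by (metis linear)
  with eq show "x = y" by (simp add: avg_map_def Let_def)
qed

text \<open>The preimage of the second block is sought on the ray through its shifted value, where
  the intermediate value theorem finds the scaling; the first block is then corrected
  explicitly.\<close>

lemma surj_avg_map:
  assumes L: "0 < L" and S: "posdef S"  and \<tau>: "0 < \<tau>"
  shows "surj (avg_map L \<tau> A S \<gamma>)"
proof -
  have "\<exists>x. avg_map L \<tau> A S \<gamma> x = y" for y
  proof -
    define e where "e = vsnd y + \<gamma>"
    define r where "r = e \<bullet> (S *v e)"
    have r: "0 \<le> r" unfolding r_def by (rule posdef_nonneg[OF S])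
    let ?f = "\<lambda>s. s * (1 - avg_weight L \<tau> (s\<^sup>2 * r))"
    \<comment> \<open>The weight never exceeds its value at 0, which is
      \<open>1 / (1 + L) = 1 - 1 / s1\<close>. Hence scaling by \<open>s1\<close> already
      compensates the largest possible shrinkage.\<close>
    define s1 where "s1 = 1 + 1 / L"
    have s1: "0 < s1" using L by (simp add: s1_def add_pos_pos)
    have "?f 0 \<le> 1" by simp
    moreover have "1 \<le> ?f s1"
    proof -
      have "avg_weight L \<tau> (s1\<^sup>2 * r) \<le> avg_weight L \<tau> 0"
        using r by (intro avg_weight_mono L \<tau>) simp
      also have "\<dots> = 1 - 1 / s1" using L by (simp add: avg_weight_def s1_def field_simps)
      finally have "1 / s1 \<le> 1 - avg_weight L \<tau> (s1\<^sup>2 * r)" by simp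
      then show ?thesis using s1 by (simp add: divide_le_eq mult.commute)
    qed
    moreover have "continuous_on {0..s1} ?f"
      unfolding continuous_on_def
      by (auto intro!: tendsto_intros tendsto_avg_weight L tendsto_ident_at)
    ultimately obtain s where s: "?f s = 1"
      using IVT'[of ?f 0 1 s1] s1 by auto
    define c where "c = s *\<^sub>R e"
    have q: "c \<bullet> (S *v c) = s\<^sup>2 * r"
      by (simp add: c_def r_def matrix_vector_mult_scaleR power2_eq_square)
    let ?l = "avg_weight L \<tau> (s\<^sup>2 * r)"
    define x where "x = vjoin (vfst y - ?l *\<^sub>R (A *v c)) (c - \<gamma>)"
    have "avg_map L \<tau> A S \<gamma> x = y"
    proof (rule vec_sum_eqI)
      show "vfst (avg_map L \<tau> A S \<gamma> x) = vfst y"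
        by (simp add: avg_map_def x_def shift_dir_def Let_def q)
      have "(1 - ?l) *\<^sub>R c = e"
        using s unfolding c_def by (simp add: mult.commute)
      then have "vsnd (avg_map L \<tau> A S \<gamma> x) + \<gamma> = vsnd y + \<gamma>"
        unfolding vsnd_avg_map by (simp add: x_def q e_def)
      then show "vsnd (avg_map L \<tau> A S \<gamma> x) = vsnd y" by simp
    qed
    then show ?thesis ..
  qed
  then show ?thesis by (metis surjI)
qed

text \<open>For \<open>h\<close> in the kernel the second block forces \<open>vsnd h\<close> to be a
  multiple of \<open>c\<close>. Pairing with \<open>c\<close> under \<open>S\<close> gives
  \<open>p\<close> times a number of at least 1 equal to 0, so \<open>p = 0\<close>; then
  \<open>vsnd h\<close> and finally \<open>h\<close> vanish.\<close>

lemma avg_map_deriv_det_nz: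
  assumes L: "0 < L" and \<tau>: "0 < \<tau>" and S: "posdef S"
  shows "det (matrix (avg_map_deriv L \<tau> A S \<gamma> x)) \<noteq> 0"
proof -
  let ?D = "avg_map_deriv L \<tau> A S \<gamma> x"
  have bl: "bounded_linear ?D"
    using avg_map_has_derivative[OF L] by (rule has_derivative_bounded_linear)
  have "h = 0" if h0: "?D h = 0" for h
  proof -
    define c where "c = vsnd x + \<gamma>"
    define l where "l = avg_weight L \<tau> (c \<bullet> (S *v c))"
    have l: "0 < l" "l < 1" unfolding l_def using avg_weight_bounds[OF L] by simp_all
    define p where "p = c \<bullet> (S *v vsnd h)"
    have p': "vsnd h \<bullet> (S *v c) = p" using posdef_sym[OF S, of "vsnd h" c] by (simp add: p_def inner_commute)
    have D: "?D h = h + l *\<^sub>R shift_dir A (vsnd h) - (\<tau> * l * (1 - l) * (2 * p)) *\<^sub>R shift_dir A c"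
      by (simp add: avg_map_deriv_def Let_def c_def[symmetric] l_def[symmetric] p_def[symmetric] p')
    have "vsnd (?D h) = (1 - l) *\<^sub>R (vsnd h + (\<tau> * l * (2 * p)) *\<^sub>R c)"
      unfolding D by (simp add: shift_dir_def algebra_simps)
    then have h2: "vsnd h + (\<tau> * l * (2 * p)) *\<^sub>R c = 0" using l h0 by simp
    have "p + \<tau> * l * (2 * p) * (c \<bullet> (S *v c))
        = c \<bullet> (S *v (vsnd h + (\<tau> * l * (2 * p)) *\<^sub>R c))"
      by (simp add: matrix_vector_right_distrib matrix_vector_mult_scaleR inner_add_right p_def)
    also have "\<dots> = 0" unfolding h2 by simp
    finally have "p * (1 + \<tau> * l * 2 * (c \<bullet> (S *v c))) = 0" by (simp add: algebra_simps)
    moreover have "0 < 1 + \<tau> * l * 2 * (c \<bullet> (S *v c))"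
      using \<tau> l posdef_nonneg[OF S, of c] by (intro add_pos_nonneg) auto
    ultimately have "p = 0" by simp
    with h2 have "vsnd h = 0" by simp
    with \<open>p = 0\<close> D h0 show "h = 0" by (simp add: linear_0[OF shift_dir_linear])
  qed
  then have "\<And>h. matrix ?D *v h = 0 \<Longrightarrow> h = 0"
    using matrix_vector_mul(3)[OF bl] by metis
  then have "invertible (matrix ?D)"
    unfolding invertible_left_inverse matrix_left_invertible_ker by blast
  then show ?thesis by (simp add: invertible_det_nz)
qed

text \<open>The form of the limit has a positive minimum \<open>m\<close> on the unit sphere, and
  half of it survives small perturbations. Uniformity in \<open>v\<close> matters because the bound
  is later used at vectors that vary with \<open>n\<close>.\<close>

lemma posdef_uniform_lower_bound:
  fixes S :: "real^'n::finite^'n"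
  assumes S: "posdef S" and lim: "(M \<longlongrightarrow> S) F"
  shows "\<exists>s>0. \<forall>\<^sub>F n in F. \<forall>v. s * (norm v)\<^sup>2 \<le> v \<bullet> (M n *v v)"
proof -
  let ?K = "sphere 0 1 :: (real^'n) set"
  have "continuous_on ?K (\<lambda>v. v \<bullet> (S *v v))"
    by (intro continuous_intros linear_continuous_on) (simp add: matrix_vector_mul_linear linear_conv_bounded_linear[symmetric])
  moreover have "(axis undefined 1 :: real^'n) \<in> ?K" by (simp add: norm_axis_1)
  then have "?K \<noteq> {}" by blast
  ultimately obtain v0 where v0: "v0 \<in> ?K" and min: "\<And>v. v \<in> ?K \<Longrightarrow> v0 \<bullet> (S *v v0) \<le> v \<bullet> (S *v v)"
    using continuous_attains_inf[OF compact_sphere, of 0 1 "\<lambda>v. v \<bullet> (S *v v)"] by blast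
  define m where "m = v0 \<bullet> (S *v v0)"
  have "v0 \<noteq> 0" using v0 by auto
  then have m: "0 < m" using S by (simp add: m_def posdef_def)
  have lower: "m * (norm v)\<^sup>2 \<le> v \<bullet> (S *v v)" for v
  proof (cases "v = 0")
    case False
    have "m \<le> (v /\<^sub>R norm v) \<bullet> (S *v (v /\<^sub>R norm v))"
      unfolding m_def using False by (intro min) simp
    also have "\<dots> = (v \<bullet> (S *v v)) / (norm v)\<^sup>2"
      by (simp add: matrix_vector_mult_scaleR power2_eq_square divide_inverse mult_ac)
    finally show ?thesis using False by (simp add: le_divide_eq)
  qed simp
  \<comment> \<open>The sum of absolute entries bounds the operator norm and tends to 0 with the
    entries.\<close>
  let ?e = "\<lambda>n. \<Sum>i\<in>UNIV. \<Sum>j\<in>UNIV. \<bar>(M n - S) $ i $ j\<bar>"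
  have "(?e \<longlongrightarrow> (\<Sum>i\<in>(UNIV::'n set). \<Sum>j\<in>(UNIV::'n set). \<bar>(S - S) $ i $ j\<bar>)) F"
    by (intro tendsto_sum tendsto_rabs tendsto_vec_nth tendsto_diff tendsto_const lim)
  then have "(?e \<longlongrightarrow> 0) F" by simp
  then have "\<forall>\<^sub>F n in F. ?e n < m / 2"
    using m by (intro order_tendstoD(2)) auto
  then have "\<forall>\<^sub>F n in F. \<forall>v. m / 2 * (norm v)\<^sup>2 \<le> v \<bullet> (M n *v v)"
  proof eventually_elim
    case (elim n)
    show ?case
    proof
      fix v
      have "\<bar>v \<bullet> ((M n - S) *v v)\<bar> \<le> norm v * norm ((M n - S) *v v)"
        by (rule Cauchy_Schwarz_ineq2)
      also have "\<dots> \<le> norm v * (onorm ((*v) (M n - S)) * norm v)"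
        by (intro mult_left_mono onorm) (simp_all add: matrix_vector_mul_linear linear_conv_bounded_linear[symmetric])
      also have "\<dots> \<le> norm v * (m / 2 * norm v)"
        using onorm_le_matrix_component_sum[of "M n - S"] elim
        by (intro mult_left_mono mult_right_mono) auto
      finally have "\<bar>v \<bullet> (M n *v v) - v \<bullet> (S *v v)\<bar> \<le> m / 2 * (norm v)\<^sup>2"
        by (simp add: matrix_vector_mult_diff_rdistrib inner_diff_right power2_eq_square mult_ac)
      then show "m / 2 * (norm v)\<^sup>2 \<le> v \<bullet> (M n *v v)" using lower[of v] by linarith
    qed
  qed
  then show ?thesis using m by (intro exI[of _ "m / 2"]) simp
qed

lemma avg_weight_le_exp: "0 < L \<Longrightarrow> avg_weight L \<tau> q \<le> exp (- (\<tau> * q)) / L"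
proof -
  assume L: "0 < L"
  then have "avg_weight L \<tau> q \<le> 1 / (L * exp (\<tau> * q))"
    unfolding avg_weight_def by (intro divide_left_mono) (auto simp: add_pos_pos)
  then show ?thesis by (simp add: exp_minus divide_inverse mult.commute)
qed

text \<open>The weight decays exponentially in the square of \<open>norm c\<close>, while the other terms grow at most quadratically.\<close>

lemma avg_map_diverging_shift:
  fixes \<gamma> :: "nat \<Rightarrow> real^'b::finite" and A :: "nat \<Rightarrow> real^'b^'a::finite"
  assumes L: "0 < L" and \<tau>: "0 < \<tau>" and A: "A \<longlonglongrightarrow> A0" and S: "S \<longlonglongrightarrow> S0" and S0: "posdef S0"
    and \<gamma>: "filterlim (\<lambda>n. norm (\<gamma> n)) at_top sequentially"
  shows "(\<lambda>n. avg_map L \<tau> (A n) (S n) (\<gamma> n) x) \<longlonglongrightarrow> x"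
    and "(\<lambda>n. det (matrix (avg_map_deriv L \<tau> (A n) (S n) (\<gamma> n) x))) \<longlonglongrightarrow> 1"
proof -
  define c where "c n = vsnd x + \<gamma> n" for n
  define l where "l n = avg_weight L \<tau> (c n \<bullet> (S n *v c n))" for n
  have l: "0 < l n" "l n < 1" for n unfolding l_def using avg_weight_bounds[OF L] by simp_all
  obtain s where s: "0 < s" "\<forall>\<^sub>F n in sequentially. \<forall>v. s * (norm v)\<^sup>2 \<le> v \<bullet> (S n *v v)"
    using posdef_uniform_lower_bound[OF S0 S] by blast
  have c_inf: "filterlim (\<lambda>n. norm (c n)) at_top sequentially"
  proof (rule filterlim_at_top_mono)
    show "filterlim (\<lambda>n. - norm (vsnd x) + norm (\<gamma> n)) at_top sequentially"
      by (rule filterlim_tendsto_add_at_top[OF tendsto_const \<gamma>])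
    show "\<forall>\<^sub>F n in sequentially. - norm (vsnd x) + norm (\<gamma> n) \<le> norm (c n)"
      using norm_triangle_ineq2[of "\<gamma> _" "- vsnd x"] by (intro always_eventually) (simp add: c_def add.commute)
  qed
  \<comment> \<open>Eventually a lower bound for the exponent in the weight, by the uniform bound on
    the forms.\<close>
  define z where "z n = \<tau> * s * (norm (c n))\<^sup>2" for n
  have "filterlim (\<lambda>n. (norm (c n))\<^sup>2) at_top sequentially"
    by (rule filterlim_pow_at_top[OF _ c_inf]) simp
  then have z_inf: "filterlim z at_top sequentially"
    unfolding z_def using \<tau> s(1) by (intro filterlim_tendsto_pos_mult_at_top[OF tendsto_const]) simp_all
  \<comment> \<open>A single null sequence that dominates the weight alone and its products with the
    norm of \<open>c n\<close> and with the squared norm.\<close>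
  define m where "m n = l n * (1 + (norm (c n))\<^sup>2)" for n
  have m_lim: "m \<longlonglongrightarrow> 0"
  proof (rule tendsto_sandwich[OF _ _ tendsto_const])
    show "\<forall>\<^sub>F n in sequentially. 0 \<le> m n"
      using l by (intro always_eventually) (simp add: m_def less_imp_le)
    \<comment> \<open>The powers 0 and 1 of \<open>z n\<close> are written out so that both summands
      are instances of the limit of a power over the exponential.\<close>
    show "\<forall>\<^sub>F n in sequentially. m n \<le> (z n ^ 0 / exp (z n) + z n ^ 1 / exp (z n) / (\<tau> * s)) / L"
      using s(2)
    proof eventually_elim
      case (elim n)
      have "l n \<le> exp (- (\<tau> * (c n \<bullet> (S n *v c n)))) / L"
        unfolding l_def by (rule avg_weight_le_exp[OF L])
      also have "\<dots> \<le> exp (- z n) / L"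
        using elim L \<tau> by (intro divide_right_mono) (simp_all add: z_def mult.assoc)
      finally have "m n \<le> exp (- z n) / L * (1 + (norm (c n))\<^sup>2)"
        unfolding m_def by (intro mult_right_mono) auto
      also have "(norm (c n))\<^sup>2 = z n / (\<tau> * s)" using \<tau> s(1) by (simp add: z_def)
      finally show ?case by (simp add: exp_minus divide_inverse algebra_simps)
    qed
    have "(\<lambda>n. (z n ^ 0 / exp (z n) + z n ^ 1 / exp (z n) / (\<tau> * s)) / L) \<longlonglongrightarrow> (0 + 0 / (\<tau> * s)) / L"
      by (intro tendsto_divide tendsto_add tendsto_const
          filterlim_compose[OF tendsto_power_div_exp_0 z_inf]) (use \<tau> s L in auto)
    then show "(\<lambda>n. (z n ^ 0 / exp (z n) + z n ^ 1 / exp (z n) / (\<tau> * s)) / L) \<longlonglongrightarrow> 0" by simp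
  qed
  have l_lim: "l \<longlonglongrightarrow> 0"
  proof (rule Lim_null_comparison[OF always_eventually m_lim], intro allI)
    show "norm (l n) \<le> m n" for n
      using l[of n] mult_left_mono[of 1 "1 + (norm (c n))\<^sup>2" "l n"] by (simp add: m_def)
  qed
  have lc_lim: "(\<lambda>n. l n *\<^sub>R c n) \<longlonglongrightarrow> 0"
  proof (rule Lim_null_comparison[OF always_eventually m_lim], intro allI)
    fix n
    have "norm (c n) \<le> 1 + (norm (c n))\<^sup>2"
      using sum_squares_bound[of 1 "norm (c n)"] by (simp add: power2_eq_square) (smt (verit) norm_ge_zero)
    then show "norm (l n *\<^sub>R c n) \<le> m n"
      using l[of n] by (simp add: m_def mult_left_mono)
  qed
  have "(\<lambda>n. x + shift_dir (A n) (l n *\<^sub>R c n)) \<longlonglongrightarrow> x + shift_dir A0 0"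
    by (intro tendsto_add tendsto_const tendsto_shift_dir A lc_lim)
  then show "(\<lambda>n. avg_map L \<tau> (A n) (S n) (\<gamma> n) x) \<longlonglongrightarrow> x"
    by (simp add: avg_map_def Let_def c_def[symmetric] l_def[symmetric] shift_dir_scaleR linear_0[OF shift_dir_linear])
  have deriv: "(\<lambda>n. avg_map_deriv L \<tau> (A n) (S n) (\<gamma> n) x h) \<longlonglongrightarrow> h" for h
  proof -
    \<comment> \<open>Transposing collects the two bilinear terms as an inner product of
      \<open>c n\<close> with a convergent, hence bounded, vector. The correction \<open>p\<close>
      is then quadratic in \<open>c n\<close> and controlled by \<open>m\<close>.\<close>
    define w where "w n = transpose (S n) *v vsnd h + S n *v vsnd h" for n
    have w_lim: "w \<longlonglongrightarrow> transpose S0 *v vsnd h + S0 *v vsnd h"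
      unfolding w_def transpose_def
      by (intro tendsto_add tendsto_matrix_vector_mult tendsto_vec_lambda tendsto_vec_nth S tendsto_const)
    have w: "vsnd h \<bullet> (S n *v c n) + c n \<bullet> (S n *v vsnd h) = w n \<bullet> c n" for n
      unfolding w_def inner_add_left inner_matrix_vector[symmetric] by (simp add: inner_commute)
    define p where "p n = (\<tau> * l n * (1 - l n) * (w n \<bullet> c n)) *\<^sub>R c n" for n
    have p_lim: "p \<longlonglongrightarrow> 0"
    proof (rule Lim_null_comparison[OF always_eventually], intro allI)
      fix n
      have "norm (p n) = (\<tau> * l n) * ((1 - l n) * (\<bar>w n \<bullet> c n\<bar> * norm (c n)))"
        using l[of n] \<tau> by (simp add: p_def abs_mult)
      also have "\<dots> \<le> (\<tau> * l n) * (1 * ((norm (w n) * norm (c n)) * norm (c n)))"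
        using l[of n] \<tau> by (intro mult_left_mono mult_mono mult_right_mono Cauchy_Schwarz_ineq2) auto
      also have "\<dots> = \<tau> * (l n * (norm (c n))\<^sup>2) * norm (w n)" by (simp add: power2_eq_square)
      also have "\<dots> \<le> \<tau> * m n * norm (w n)"
        using l[of n] \<tau> by (intro mult_left_mono mult_right_mono) (auto simp: m_def)
      finally show "norm (p n) \<le> \<tau> * m n * norm (w n)" .
    next
      show "(\<lambda>n. \<tau> * m n * norm (w n)) \<longlonglongrightarrow> 0"
        using tendsto_mult[OF tendsto_mult[OF tendsto_const m_lim, of \<tau>] tendsto_norm[OF w_lim]] by simp
    qed
    have "(\<lambda>n. h + shift_dir (A n) (l n *\<^sub>R vsnd h) - shift_dir (A n) (p n)) \<longlonglongrightarrow> h + shift_dir A0 (0 *\<^sub>R vsnd h) - shift_dir A0 0"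
      by (intro tendsto_add tendsto_diff tendsto_const tendsto_shift_dir tendsto_scaleR A l_lim p_lim)
    moreover have "avg_map_deriv L \<tau> (A n) (S n) (\<gamma> n) x h = h + shift_dir (A n) (l n *\<^sub>R vsnd h) - shift_dir (A n) (p n)" for n
      by (simp add: avg_map_deriv_def Let_def c_def[symmetric] l_def[symmetric] w p_def shift_dir_scaleR)
    ultimately show ?thesis by (simp add: linear_0[OF shift_dir_linear])
  qed
  have "(\<lambda>n. matrix (avg_map_deriv L \<tau> (A n) (S n) (\<gamma> n) x)) \<longlonglongrightarrow> (\<chi> i j. axis j 1 $ i)"
    unfolding matrix_def by (intro tendsto_vec_lambda tendsto_vec_nth deriv)
  moreover have "(\<chi> i j. axis j 1 $ i) = (mat 1 :: real^('a + 'b)^('a + 'b))"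
    by (simp add: mat_def axis_def vec_eq_iff)
  ultimately show "(\<lambda>n. det (matrix (avg_map_deriv L \<tau> (A n) (S n) (\<gamma> n) x))) \<longlonglongrightarrow> 1"
    using tendsto_det by fastforce
qed

section \<open>Block matrices\<close>

text \<open>For a Gram matrix these are the least squares coefficients of the second group of
  regressors on the first.\<close>

definition regr :: "real^('a::finite + 'b::finite)^('a + 'b) \<Rightarrow> real^'b^'a" where
  "regr Q = matrix_inv (blk11 Q) ** blk12 Q"

definition schur :: "real^('a::finite + 'b::finite)^('a + 'b) \<Rightarrow> real^'b^'b" where
  "schur Q = blk22 Q - blk21 Q ** matrix_inv (blk11 Q) ** blk12 Q"

lemma vfst_matrix: "vfst (Q *v x) = blk11 Q *v vfst x + blk12 Q *v vsnd x"
  and vsnd_matrix: "vsnd (Q *v x) = blk21 Q *v vfst x + blk22 Q *v vsnd x"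
  by (simp_all add: vec_eq_iff matrix_vector_mult_def sum_UNIV_Plus blk11_def blk12_def blk21_def blk22_def)

lemma posdef_blk11:
  assumes Q: "posdef Q" shows "posdef (blk11 Q)"
  unfolding posdef_def
proof (intro conjI allI impI)
  have "Q $ i $ j = Q $ j $ i" for i j
    using Q by (simp add: posdef_def transpose_def vec_eq_iff)
  then show "transpose (blk11 Q) = blk11 Q"
    by (simp add: transpose_def blk11_def vec_eq_iff)
  fix x :: "real^'a" assume "x \<noteq> 0"
  then have "(vjoin x 0 :: real^('a + 'b)) \<noteq> 0" by (auto simp: vec_eq_iff split_sum_all)
  then have "0 < vjoin x 0 \<bullet> (Q *v vjoin x 0)" using Q by (simp add: posdef_def)
  then show "0 < x \<bullet> (blk11 Q *v x)" by (simp add: inner_vec_sum vfst_matrix)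
qed

lemma transpose_blocks:
  assumes Q: "posdef Q"
  shows "transpose (blk12 Q) = blk21 Q" "transpose (blk21 Q) = blk12 Q" "transpose (blk22 Q) = blk22 Q"
proof -
  have "Q $ i $ j = Q $ j $ i" for i j
    using Q by (simp add: posdef_def transpose_def vec_eq_iff)
  then show "transpose (blk12 Q) = blk21 Q" "transpose (blk21 Q) = blk12 Q" "transpose (blk22 Q) = blk22 Q"
    by (simp_all add: transpose_def blk12_def blk21_def blk22_def vec_eq_iff)
qed

lemma blk11_regr: "posdef Q \<Longrightarrow> blk11 Q *v (regr Q *v y) = blk12 Q *v y"
  by (simp add: regr_def matrix_vector_mul_assoc[symmetric] matrix_inv_vector posdef_invertible posdef_blk11)

text \<open>Completing the square in the first block; the cross terms match because the off-diagonal
  blocks are transposes of each other.\<close>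

lemma quadratic_form_schur:
  assumes Q: "posdef Q"
  shows "x \<bullet> (Q *v x) = (vfst x + regr Q *v vsnd x) \<bullet> (blk11 Q *v (vfst x + regr Q *v vsnd x))
      + vsnd x \<bullet> (schur Q *v vsnd x)"
proof -
  let ?x1 = "vfst x" and ?x2 = "vsnd x" and ?a = "regr Q *v vsnd x"
  have S: "?x2 \<bullet> (schur Q *v ?x2) = ?x2 \<bullet> (blk22 Q *v ?x2) - ?x2 \<bullet> (blk21 Q *v ?a)"
    by (simp add: schur_def regr_def matrix_vector_mult_diff_rdistrib inner_diff_right matrix_vector_mul_assoc matrix_mul_assoc)
  have tr: "y \<bullet> (blk21 Q *v v) = (blk12 Q *v y) \<bullet> v" for y v
    unfolding inner_matrix_vector transpose_blocks[OF Q] ..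
  have Qa: "blk11 Q *v ?a = blk12 Q *v ?x2" by (rule blk11_regr[OF Q])
  have aQ: "?a \<bullet> (blk11 Q *v ?x1) = (blk12 Q *v ?x2) \<bullet> ?x1"
    using posdef_sym[OF posdef_blk11[OF Q], of ?a ?x1] Qa by simp
  show ?thesis
    unfolding S using aQ by (simp add: inner_vec_sum vfst_matrix vsnd_matrix matrix_vector_right_distrib Qa
        inner_add_left inner_add_right tr inner_commute)
qed

lemma posdef_schur:
  assumes Q: "posdef Q" shows "posdef (schur Q)"
  unfolding posdef_def
proof (intro conjI allI impI)
  have "transpose (matrix_inv (blk11 Q)) = matrix_inv (blk11 Q)"
    using posdef_matrix_inv[OF posdef_blk11[OF Q]] by (simp add: posdef_def)
  then have "transpose (blk21 Q ** matrix_inv (blk11 Q) ** blk12 Q) = blk21 Q ** matrix_inv (blk11 Q) ** blk12 Q"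
    by (simp add: matrix_transpose_mul transpose_blocks[OF Q] matrix_mul_assoc)
  then show "transpose (schur Q) = schur Q"
    using transpose_blocks(3)[OF Q] by (simp add: schur_def transpose_def vec_eq_iff)
  fix y :: "real^'b" assume y: "y \<noteq> 0"
  \<comment> \<open>This first block makes the completed square vanish, leaving only the form of the
    Schur complement.\<close>
  let ?x = "vjoin (- (regr Q *v y)) y"
  have "?x \<noteq> 0" using y by (auto simp: vec_eq_iff split_sum_all)
  then have "0 < ?x \<bullet> (Q *v ?x)" using Q by (simp add: posdef_def)
  then show "0 < y \<bullet> (schur Q *v y)" by (simp add: quadratic_form_schur[OF Q])
qed

lemma tendsto_blocks:
  assumes "(Q \<longlongrightarrow> Q0) F"
  shows "((\<lambda>n. blk11 (Q n)) \<longlongrightarrow> blk11 Q0) F" "((\<lambda>n. blk12 (Q n)) \<longlongrightarrow> blk12 Q0) F"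
    "((\<lambda>n. blk21 (Q n)) \<longlongrightarrow> blk21 Q0) F" "((\<lambda>n. blk22 (Q n)) \<longlongrightarrow> blk22 Q0) F"
  unfolding blk11_def blk12_def blk21_def blk22_def
  by (intro tendsto_vec_lambda tendsto_vec_nth assms)+

lemma tendsto_matrix_mult:
  fixes A :: "'z \<Rightarrow> real^'n::finite^'m::finite" and B :: "'z \<Rightarrow> real^'l::finite^'n"
  assumes "(A \<longlongrightarrow> A0) F" "(B \<longlongrightarrow> B0) F"
  shows "((\<lambda>n. A n ** B n) \<longlongrightarrow> A0 ** B0) F"
  unfolding matrix_matrix_mult_def
  by (intro tendsto_vec_lambda tendsto_sum tendsto_mult tendsto_vec_nth assms)

lemma tendsto_regr_schur:
  assumes Q: "(Q \<longlongrightarrow> Q0) F" and pd: "\<And>n. posdef (Q n)" "posdef Q0"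
  shows "((\<lambda>n. regr (Q n)) \<longlongrightarrow> regr Q0) F" "((\<lambda>n. schur (Q n)) \<longlongrightarrow> schur Q0) F"
proof -
  have inv: "((\<lambda>n. matrix_inv (blk11 (Q n))) \<longlongrightarrow> matrix_inv (blk11 Q0)) F"
    by (intro tendsto_matrix_inv tendsto_blocks Q always_eventually allI posdef_invertible posdef_blk11 pd)
  show "((\<lambda>n. regr (Q n)) \<longlongrightarrow> regr Q0) F" "((\<lambda>n. schur (Q n)) \<longlongrightarrow> schur Q0) F"
    unfolding regr_def schur_def
    by (intro tendsto_diff tendsto_matrix_mult tendsto_blocks[OF Q] inv)+
qed

lemma matrix_inv_scaleR:
  assumes "invertible (A :: real^'n^'n)" "c \<noteq> 0"
  shows "matrix_inv (c *\<^sub>R A) = (1 / c) *\<^sub>R matrix_inv A"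
  by (rule matrix_inv_eqI) (use assms in \<open>simp add: scaleR_matrix_mult matrix_inv\<close>)

lemma blk_scaleR: "blk11 (c *\<^sub>R Q) = c *\<^sub>R blk11 Q" "blk12 (c *\<^sub>R Q) = c *\<^sub>R blk12 Q"
  "blk21 (c *\<^sub>R Q) = c *\<^sub>R blk21 Q" "blk22 (c *\<^sub>R Q) = c *\<^sub>R blk22 Q"
  by (simp_all add: blk11_def blk12_def blk21_def blk22_def vec_eq_iff)

lemma regr_schur_scaleR:
  assumes Q: "posdef Q" and c: "0 < c"
  shows "regr (c *\<^sub>R Q) = regr Q" "schur (c *\<^sub>R Q) = c *\<^sub>R schur Q"
  using c matrix_inv_scaleR[OF posdef_invertible[OF posdef_blk11[OF Q]], of c]
  by (simp_all add: regr_def schur_def blk_scaleR scaleR_matrix_mult scaleR_diff_right)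

lemma tendsto_gauss_density:
  fixes \<Gamma> :: "'z \<Rightarrow> real^'k::finite^'k"
  assumes \<Gamma>: "(\<Gamma> \<longlongrightarrow> \<Gamma>0) F" and pd: "\<And>n. posdef (\<Gamma> n)" "posdef \<Gamma>0"
  shows "((\<lambda>n. gauss_density (\<Gamma> n) t) \<longlongrightarrow> gauss_density \<Gamma>0 t) F"
proof -
  have "sqrt ((2 * pi) ^ CARD('k) * det \<Gamma>0) \<noteq> 0" using posdef_det_pos[OF pd(2)] by simp
  moreover have "((\<lambda>n. matrix_inv (\<Gamma> n)) \<longlongrightarrow> matrix_inv \<Gamma>0) F"
    by (intro tendsto_matrix_inv \<Gamma> always_eventually allI posdef_invertible pd)
  ultimately show ?thesis
    unfolding gauss_density_def
    by (intro tendsto_divide tendsto_exp tendsto_minus tendsto_inner tendsto_matrix_vector_mult tendsto_const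
        tendsto_real_sqrt tendsto_mult tendsto_det \<Gamma>) simp_all
qed

section \<open>The linear model\<close>

lemma gram_eq_row_gram: "gram Xn n = row_gram Xn {..<n}"
  by (simp add: gram_def row_gram_def)

lemma posdef_gram: "full_col_rank Xn n \<Longrightarrow> posdef (gram (Xn :: nat \<Rightarrow> real^'k::finite) n)"
  unfolding gram_eq_row_gram by (rule posdef_row_gram) (auto simp: full_col_rank_def)

lemma xty_linear_model: "xty Xn n (\<lambda>i. Xn i \<bullet> \<beta> + u i) = gram Xn n *v \<beta> + xty Xn n u"
  by (simp add: xty_def gram_eq_row_gram row_gram_vector scaleR_add_left sum.distrib)

lemma vfst_sum: "vfst (sum f A) = (\<Sum>i\<in>A. vfst (f i))"
  by (simp add: vec_eq_iff)

text \<open>The first block of the normal equations for the unrestricted estimator also determines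
  the restricted one: solving it with the second coefficient set to 0 adds \<open>regr\<close> times
  the dropped coefficient.\<close>

lemma beta_R_eq:
  assumes G: "posdef (gram Xn n)"
  shows "beta_R Xn n Y = beta_U Xn n Y + shift_dir (regr (gram Xn n)) (vsnd (beta_U Xn n Y))"
proof -
  let ?G = "gram Xn n" and ?b = "beta_U Xn n Y"
  have g11: "gram (\<lambda>i. vfst (Xn i)) n = blk11 ?G"
    by (simp add: gram_def blk11_def)
  have "xty (\<lambda>i. vfst (Xn i)) n Y = vfst (xty Xn n Y)"
    by (simp add: xty_def vfst_sum)
  also have "xty Xn n Y = ?G *v ?b"
    by (simp add: beta_U_def matrix_inv_vector[OF posdef_invertible[OF G]])
  also have "vfst (?G *v ?b) = blk11 ?G *v (vfst ?b + regr ?G *v vsnd ?b)"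
    by (simp add: vfst_matrix matrix_vector_right_distrib blk11_regr[OF G])
  finally have "beta_U (\<lambda>i. vfst (Xn i)) n Y = vfst ?b + regr ?G *v vsnd ?b"
    by (simp add: beta_U_def g11 matrix_inv_vector[OF posdef_invertible[OF posdef_blk11[OF G]]])
  then show ?thesis
    by (intro vec_sum_eqI) (simp_all add: beta_R_def shift_dir_def)
qed

lemma matrix_vector_minus: "(A :: real^'n^'m) *v (- x) = - (A *v x)"
  by (simp add: matrix_vector_mult_def vec_eq_iff sum_negf)

lemma sqrt_mult_sqrt:
  "sqrt (real n) * (sqrt (real n) * a) = real n * a" "sqrt (real n) * a * sqrt (real n) = real n * a"
  by (simp_all add: mult.assoc[symmetric] mult.commute[of _ a])

lemma quadratic_form_shift_dir:
  "posdef Q \<Longrightarrow> shift_dir (regr Q) c \<bullet> (Q *v shift_dir (regr Q) c) = c \<bullet> (schur Q *v c)"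
  by (simp add: quadratic_form_schur shift_dir_def matrix_vector_minus)

text \<open>The weight and the displacement depend on the data only through the second block of the
  unrestricted estimator, so \<beta> enters solely through \<open>vsnd \<beta>\<close>. The error
  term is left as a sum over rows, the form required by \<open>gauss_density_law\<close>.\<close>

lemma beta_tilde_avg_map:
  fixes Xn :: "nat \<Rightarrow> real^('k1::finite + 'k2::finite)"
  assumes rank: "full_col_rank Xn n" and n: "0 < n"
  defines "Qn \<equiv> (1 / real n) *\<^sub>R gram Xn n"
  shows "sqrt (real n) *\<^sub>R (beta_tilde \<alpha> \<sigma> Xn n (\<lambda>i. Xn i \<bullet> \<beta> + u i) - \<beta>)
    = avg_map (exp (- 2 * \<alpha> * real CARD('k2))) (\<alpha> / \<sigma>\<^sup>2) (regr Qn) (schur Qn) (sqrt (real n) *\<^sub>R vsnd \<beta>)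
        (\<Sum>i<n. u i *\<^sub>R (sqrt (real n) *\<^sub>R (matrix_inv (gram Xn n) *v Xn i)))"
proof -
  let ?G = "gram Xn n" and ?Y = "\<lambda>i. Xn i \<bullet> \<beta> + u i" and ?r = "sqrt (real n)"
  have G: "posdef ?G" by (rule posdef_gram[OF rank])
  have RS: "regr Qn = regr ?G" "schur Qn = (1 / real n) *\<^sub>R schur ?G"
    unfolding Qn_def using n by (simp_all add: regr_schur_scaleR[OF G])
  define bU where "bU = beta_U Xn n ?Y"
  define b where "b = (\<Sum>i<n. u i *\<^sub>R (?r *\<^sub>R (matrix_inv ?G *v Xn i)))"
  have b: "?r *\<^sub>R (bU - \<beta>) = b"
    unfolding bU_def beta_U_def xty_linear_model b_def
    by (simp add: matrix_vector_right_distrib matrix_inv_vector[OF posdef_invertible[OF G]] xty_def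
        linear_sum[OF matrix_vector_mul_linear] matrix_vector_mult_scaleR scaleR_sum_right mult.commute)
  let ?E = "shift_dir (regr ?G)"
  define c where "c = vsnd b + ?r *\<^sub>R vsnd \<beta>"
  have c: "c = ?r *\<^sub>R vsnd bU"
    unfolding c_def b[symmetric] by (simp add: algebra_simps)
  have bR: "beta_R Xn n ?Y = bU + ?E (vsnd bU)"
    unfolding bU_def by (rule beta_R_eq[OF G])
  define l where "l = avg_weight (exp (- 2 * \<alpha> * real CARD('k2))) (\<alpha> / \<sigma>\<^sup>2) (c \<bullet> (schur Qn *v c))"
  \<comment> \<open>The squared distance of the two fits is the Gram form of their coefficient
    difference. On the shift direction it reduces to the Schur form, and the factor \<open>n\<close>
    in the Gram matrix is absorbed by the scaling of \<open>c\<close>.\<close>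
  have "(\<Sum>i<n. (Xn i \<bullet> (beta_R Xn n ?Y - bU))\<^sup>2) = ?E (vsnd bU) \<bullet> (?G *v ?E (vsnd bU))"
    by (simp add: bR gram_eq_row_gram inner_row_gram)
  also have "\<dots> = c \<bullet> (schur Qn *v c)"
    using n by (simp add: quadratic_form_shift_dir[OF G] c RS sqrt_mult_sqrt matrix_vector_mult_scaleR scaleR_matrix_vector_assoc[symmetric])
  finally have "beta_tilde \<alpha> \<sigma> Xn n ?Y = l *\<^sub>R (bU + ?E (vsnd bU)) + (1 - l) *\<^sub>R bU"
    unfolding beta_tilde_def Let_def bU_def[symmetric] bR
    by (simp add: l_def avg_weight_def bR)
  then have "?r *\<^sub>R (beta_tilde \<alpha> \<sigma> Xn n ?Y - \<beta>) = ?r *\<^sub>R (bU - \<beta>) + l *\<^sub>R (?r *\<^sub>R ?E (vsnd bU))"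
    by (simp add: algebra_simps)
  also have "\<dots> = b + l *\<^sub>R ?E c"
    unfolding b c by (simp add: shift_dir_scaleR)
  finally show ?thesis
    unfolding avg_map_def Let_def b_def[symmetric] c_def[symmetric] l_def[symmetric] RS(1) .
qed

lemma law_n_avg_map:
  fixes Xn :: "nat \<Rightarrow> real^('k1::finite + 'k2::finite)"
  assumes rank: "full_col_rank Xn n" and n: "0 < n" and \<sigma>: "0 < \<sigma>"
  defines "Qn \<equiv> (1 / real n) *\<^sub>R gram Xn n"
  shows "law_n \<alpha> \<sigma> Xn n \<beta> = distr (density lborel (\<lambda>t. ennreal (gauss_density (\<sigma>\<^sup>2 *\<^sub>R matrix_inv Qn) t))) borel
    (avg_map (exp (- 2 * \<alpha> * real CARD('k2))) (\<alpha> / \<sigma>\<^sup>2) (regr Qn) (schur Qn) (sqrt (real n) *\<^sub>R vsnd \<beta>))"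
proof -
  let ?G = "gram Xn n" and ?H = "avg_map (exp (- 2 * \<alpha> * real CARD('k2))) (\<alpha> / \<sigma>\<^sup>2) (regr Qn) (schur Qn) (sqrt (real n) *\<^sub>R vsnd \<beta>)"
  have G: "posdef ?G" by (rule posdef_gram[OF rank])
  have Gi: "posdef (matrix_inv ?G)" by (rule posdef_matrix_inv[OF G])
  note inv = matrix_inv_vector[OF posdef_invertible[OF G]]
  let ?x = "\<lambda>i. sqrt (real n) *\<^sub>R (matrix_inv ?G *v Xn i)"
  have span: "c = 0" if "\<And>i. i \<in> {..<n} \<Longrightarrow> ?x i \<bullet> c = 0" for c
  proof -
    have "Xn i \<bullet> (matrix_inv ?G *v c) = 0" if "i < n" for i
      using \<open>\<And>i. i \<in> {..<n} \<Longrightarrow> ?x i \<bullet> c = 0\<close>[of i] that n posdef_sym[OF Gi, of "Xn i" c] by simp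
    then have "matrix_inv ?G *v c = 0" using rank by (simp add: full_col_rank_def)
    then show "c = 0" using inv(1)[of c] by simp
  qed
  \<comment> \<open>The covariance is \<open>n\<close> times the product of inverse Gram, Gram and
    inverse Gram matrix, which collapses to the inverse of \<open>Qn\<close>.\<close>
  have "row_gram ?x {..<n} *v v = matrix_inv Qn *v v" for v
  proof -
    have "row_gram ?x {..<n} *v v = real n *\<^sub>R (matrix_inv ?G *v (row_gram Xn {..<n} *v (matrix_inv ?G *v v)))"
      by (simp add: row_gram_vector linear_sum[OF matrix_vector_mul_linear] matrix_vector_mult_scaleR
          scaleR_sum_right posdef_sym[OF Gi] sqrt_mult_sqrt)
    also have "\<dots> = real n *\<^sub>R (matrix_inv ?G *v v)"
      by (simp add: gram_eq_row_gram[symmetric] inv)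
    finally show ?thesis
      unfolding Qn_def using n matrix_inv_scaleR[OF posdef_invertible[OF G], of "1 / real n"]
      by (simp add: scaleR_matrix_vector_assoc[symmetric])
  qed
  then have rg: "row_gram ?x {..<n} = matrix_inv Qn" by (simp add: matrix_eq)
  have H_meas: "?H \<in> borel_measurable borel"
    by (intro borel_measurable_continuous_onI continuous_on_avg_map) simp
  have W_meas: "(\<lambda>u. \<Sum>i<n. u i *\<^sub>R ?x i) \<in> borel_measurable (PiM {..<n} (\<lambda>_. normal_law \<sigma>))"
    by (intro borel_measurable_sum borel_measurable_scaleR) simp_all
  have "law_n \<alpha> \<sigma> Xn n \<beta> = distr (PiM {..<n} (\<lambda>_. normal_law \<sigma>)) borel (\<lambda>u. ?H (\<Sum>i<n. u i *\<^sub>R ?x i))"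
    unfolding law_n_def beta_tilde_avg_map[OF rank n] Qn_def ..
  also have "\<dots> = distr (distr (PiM {..<n} (\<lambda>_. normal_law \<sigma>)) borel (\<lambda>u. \<Sum>i<n. u i *\<^sub>R ?x i)) borel ?H"
    using H_meas W_meas by (subst distr_distr) (simp_all add: o_def)
  also have "distr (PiM {..<n} (\<lambda>_. normal_law \<sigma>)) borel (\<lambda>u. \<Sum>i<n. u i *\<^sub>R ?x i)
      = density lborel (\<lambda>t. ennreal (gauss_density (\<sigma>\<^sup>2 *\<^sub>R row_gram ?x {..<n}) t))"
    by (rule gauss_density_law[OF finite_lessThan span \<sigma>])
  finally show ?thesis unfolding rg .
qed

text \<open>In the limit variable the terms free of \<gamma>, taken without their weight, form one
  linear image of the two normal vectors, with covariance
  \<open>\<sigma>\<^sup>2 *\<^sub>R matrix_inv Q\<close>. The rest is the weighted shift of the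
  averaging map.\<close>

lemma lim_law_avg_map:
  fixes Q :: "real^('k1::finite + 'k2::finite)^('k1 + 'k2)"
  assumes Q: "posdef Q" and \<sigma>: "0 < \<sigma>"
  shows "lim_law Q \<sigma> \<alpha> \<gamma> = distr (density lborel (\<lambda>t. ennreal (gauss_density (\<sigma>\<^sup>2 *\<^sub>R matrix_inv Q) t))) borel
    (avg_map (exp (- 2 * \<alpha> * real CARD('k2))) (\<alpha> / \<sigma>\<^sup>2) (regr Q) (schur Q) \<gamma>)"
proof -
  let ?L = "exp (- 2 * \<alpha> * real CARD('k2))"
  let ?H = "avg_map ?L (\<alpha> / \<sigma>\<^sup>2) (regr Q) (schur Q) \<gamma>"
  define R1 where "R1 = psd_sqrt (matrix_inv (blk11 Q))"
  define R2 where "R2 = psd_sqrt (matrix_inv (schur Q))"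
  note B = posdef_blk11[OF Q] and S = posdef_schur[OF Q]
  have inv1: "R1 = matrix_inv (psd_sqrt (blk11 Q))" and inv2: "R2 = matrix_inv (psd_sqrt (schur Q))"
    unfolding R1_def R2_def by (rule psd_sqrt_matrix_inv[OF B], rule psd_sqrt_matrix_inv[OF S])
  have sqrt_norm: "y \<bullet> (A *v y) = (psd_sqrt A *v y) \<bullet> (psd_sqrt A *v y)" if "posdef A" for A :: "real^'n::finite^'n" and y
  proof -
    have "A *v y = psd_sqrt A *v (psd_sqrt A *v y)"
      by (simp add: matrix_vector_mul_assoc psd_sqrt(2)[OF that])
    then show ?thesis by (simp add: posdef_sym[OF psd_sqrt(1)[OF that]])
  qed
  \<comment> \<open>This is the sum of the C and D terms of the limit variable.\<close>
  define g where "g z = vjoin (R1 *v vfst z - regr Q *v (R2 *v vsnd z)) (R2 *v vsnd z)"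
    for z :: "real^('k1 + 'k2)"
  have lin: "linear g"
    by (simp add: g_def linear_iff vec_eq_iff split_sum_all matrix_vector_right_distrib matrix_vector_mult_scaleR
        algebra_simps)
  define M where "M = matrix g"
  have Mg: "M *v z = g z" for z
    unfolding M_def by (rule fun_cong[OF matrix_vector_mul(2)[OF lin]])
  \<comment> \<open>Completing the square isolates the two roots, each cancelling its inverse. Thus
    \<open>g\<close> is an isometry from the Euclidean form to that of \<open>Q\<close>;
    polarisation then yields \<open>transpose M ** Q ** M = mat 1\<close>.\<close>
  have iso: "g z \<bullet> (Q *v g z) = z \<bullet> z" for z
    unfolding quadratic_form_schur[OF Q] inner_vec_sum[of z z]
    by (simp add: g_def sqrt_norm[OF B] sqrt_norm[OF S] inv1 inv2
        matrix_inv_vector[OF posdef_invertible[OF psd_sqrt(1)[OF B]]]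
        matrix_inv_vector[OF posdef_invertible[OF psd_sqrt(1)[OF S]]])
  have pol: "g y \<bullet> (Q *v g z) = y \<bullet> z" for y z
  proof -
    have "g (y + z) \<bullet> (Q *v g (y + z)) = g y \<bullet> (Q *v g y) + 2 * (g y \<bullet> (Q *v g z)) + g z \<bullet> (Q *v g z)"
      using posdef_sym[OF Q, of "g z" "g y"]
      by (simp add: linear_add[OF lin] matrix_vector_right_distrib inner_add_left inner_add_right inner_commute)
    then show ?thesis
      by (simp add: iso inner_add_left inner_add_right inner_commute)
  qed
  have "(transpose M ** Q ** M) *v z = mat 1 *v z" for z
  proof -
    have "y \<bullet> ((transpose M ** Q ** M) *v z) = y \<bullet> z" for y
      using pol[of y z]
      by (simp add: matrix_vector_mul_assoc[symmetric] Mg inner_matrix_vector[of y "transpose M"] transpose_transpose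
          del: transpose_matrix_vector)
    then show ?thesis using vector_eq_ldot[of "(transpose M ** Q ** M) *v z" z] by simp
  qed
  then have MQM: "(transpose M ** Q) ** M = mat 1" unfolding matrix_eq by blast
  then have M: "invertible M" unfolding invertible_left_inverse by blast
  from MQM have "(M ** transpose M) ** Q = mat 1"
    by (simp add: matrix_left_right_inverse[of "transpose M ** Q"] matrix_mul_assoc)
  then have MM: "matrix_inv Q = M ** transpose M"
    by (intro matrix_inv_eqI) (simp add: matrix_left_right_inverse)
  have var: "lim_var Q \<sigma> \<alpha> \<gamma> (vfst z) (vsnd z) = ?H (g z)" for z
  proof -
    let ?A = "regr Q" and ?Z1 = "vfst z" and ?Z2 = "vsnd z"
    define c where "c = R2 *v ?Z2 + \<gamma>"
    define q where "q = c \<bullet> (schur Q *v c)"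
    \<comment> \<open>The limit is written with the weight of the unrestricted estimator, the
      complement of \<open>avg_weight\<close>.\<close>
    define w where "w = 1 / (1 + exp (2 * \<alpha> * real CARD('k2)) * exp (- \<alpha> * (norm (?Z2 + psd_sqrt (schur Q) *v \<gamma>))\<^sup>2 / \<sigma>\<^sup>2))"
    have "(norm (?Z2 + psd_sqrt (schur Q) *v \<gamma>))\<^sup>2 = q"
      unfolding q_def sqrt_norm[OF S] c_def power2_norm_eq_inner
      by (simp add: matrix_vector_right_distrib inv2 matrix_inv_vector[OF posdef_invertible[OF psd_sqrt(1)[OF S]]])
    then have w: "w = 1 - avg_weight ?L (\<alpha> / \<sigma>\<^sup>2) q"
    proof -
      assume n: "(norm (?Z2 + psd_sqrt (schur Q) *v \<gamma>))\<^sup>2 = q"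
      have "1 / (1 + inverse L * inverse e) = 1 - 1 / (1 + L * e)" if "0 < L" "0 < e" for L e :: real
      proof -
        have "0 < 1 + L * e" using that by (simp add: add_pos_pos)
        then show ?thesis using that by (simp add: field_simps)
      qed
      from this[of ?L "exp (\<alpha> / \<sigma>\<^sup>2 * q)"] show ?thesis
        unfolding w_def n avg_weight_def by (simp add: exp_minus)
    qed
    have gz: "vsnd (g z) + \<gamma> = c" by (simp add: g_def c_def)
    have "lim_var Q \<sigma> \<alpha> \<gamma> ?Z1 ?Z2 = vjoin (?A *v \<gamma>) (- \<gamma>) + vjoin (R1 *v ?Z1) 0
        + w *\<^sub>R (vjoin (- (?A *v (R2 *v ?Z2))) (R2 *v ?Z2) - vjoin (?A *v \<gamma>) (- \<gamma>))"
      by (simp add: lim_var_def Let_def regr_def[symmetric] schur_def[symmetric] R1_def[symmetric] R2_def[symmetric]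
          w_def matrix_vector_mul_assoc)
    also have "\<dots> = ?H (g z)"
      unfolding avg_map_def Let_def gz q_def[symmetric] w
      by (intro vec_sum_eqI)
        (simp_all add: g_def shift_dir_def c_def matrix_vector_right_distrib algebra_simps)
    finally show ?thesis .
  qed
  have H_meas: "?H \<in> borel_measurable borel"
    by (intro borel_measurable_continuous_onI continuous_on_avg_map) simp
  have M_meas: "(\<lambda>z. M *v (\<chi> i. z i)) \<in> borel_measurable (PiM UNIV (\<lambda>_. normal_law \<sigma>))"
    by (subst borel_measurable_euclidean_space)
      (auto simp: Basis_vec_def inner_axis matrix_vector_mult_def)
  have "lim_law Q \<sigma> \<alpha> \<gamma> = distr (PiM UNIV (\<lambda>_. normal_law \<sigma>)) borel (\<lambda>z. ?H (M *v (\<chi> i. z i)))"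
    using var[of "\<chi> i. _ i"] by (simp add: lim_law_def Mg vfst_def vsnd_def)
  also have "\<dots> = distr (distr (PiM UNIV (\<lambda>_. normal_law \<sigma>)) borel (\<lambda>z. M *v (\<chi> i. z i))) borel ?H"
    using H_meas M_meas by (subst distr_distr) (simp_all add: o_def)
  finally show ?thesis
    unfolding gauss_density_linear_image[OF M \<sigma>] MM .
qed

section \<open>Assembling the two limits\<close>

lemma density_convergence_of_uniform_bound:
  fixes f :: "nat \<Rightarrow> 'a \<Rightarrow> real" and g :: "'a \<Rightarrow> real"
  assumes g: "g \<in> borel_measurable M" "\<And>t. 0 \<le> g t" "P = density M (\<lambda>t. ennreal (g t))" "prob_space P"
    and f: "\<And>n. N \<le> n \<Longrightarrow> f n \<in> borel_measurable M" "\<And>n t. N \<le> n \<Longrightarrow> 0 \<le> f n t"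
      "\<And>n. N \<le> n \<Longrightarrow> \<mu> n = density M (\<lambda>t. ennreal (f n t))" "\<And>n. N \<le> n \<Longrightarrow> prob_space (\<mu> n)"
    and \<epsilon>: "\<epsilon> \<longlonglongrightarrow> (0 :: real)"
    and bound: "\<And>n A. A \<in> sets M \<Longrightarrow> \<bar>measure (\<mu> (n + N)) A - measure P A\<bar> \<le> \<epsilon> n"
  shows "(\<lambda>n. \<integral>\<^sup>+ t. ennreal \<bar>f n t - g t\<bar> \<partial>M) \<longlonglongrightarrow> 0"
    and "(\<lambda>n. SUP A \<in> sets M. \<bar>measure (\<mu> n) A - measure P A\<bar>) \<longlonglongrightarrow> 0"
proof -
  have "(\<lambda>n. \<integral>\<^sup>+ t. ennreal \<bar>f (n + N) t - g t\<bar> \<partial>M) \<longlonglongrightarrow> 0"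
  proof (rule tendsto_sandwich[OF _ _ tendsto_const])
    show "\<forall>\<^sub>F n in sequentially. (\<integral>\<^sup>+ t. ennreal \<bar>f (n + N) t - g t\<bar> \<partial>M) \<le> ennreal (2 * \<epsilon> n)"
    proof (intro always_eventually allI L1_distance_le_total_variation)
      fix n
      show "prob_space (density M (\<lambda>t. ennreal (f (n + N) t)))" "prob_space (density M (\<lambda>t. ennreal (g t)))"
        using f(3,4)[of "n + N"] g(3,4) by simp_all
      show "\<bar>measure (density M (\<lambda>t. ennreal (f (n + N) t))) A - measure (density M (\<lambda>t. ennreal (g t))) A\<bar> \<le> \<epsilon> n"
        if "A \<in> sets M" for A
        using bound[OF that, of n] f(3)[of "n + N"] g(3) by simp
    qed (use f(1,2) g(1,2) in simp_all)
    show "(\<lambda>n. ennreal (2 * \<epsilon> n)) \<longlonglongrightarrow> 0"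
      using tendsto_ennrealI[OF tendsto_mult[OF tendsto_const[of 2] \<epsilon>]] by simp
  qed simp
  then show "(\<lambda>n. \<integral>\<^sup>+ t. ennreal \<bar>f n t - g t\<bar> \<partial>M) \<longlonglongrightarrow> 0"
    by (rule LIMSEQ_offset)
  have "(\<lambda>n. SUP A \<in> sets M. \<bar>measure (\<mu> (n + N)) A - measure P A\<bar>) \<longlonglongrightarrow> 0"
  proof (rule tendsto_sandwich[OF _ _ tendsto_const \<epsilon>]; intro always_eventually allI)
    fix n
    show "(SUP A \<in> sets M. \<bar>measure (\<mu> (n + N)) A - measure P A\<bar>) \<le> \<epsilon> n"
      by (intro cSUP_least bound) auto
    \<comment> \<open>A real supremum needs a bound above; the empty set then shows that it is
      nonnegative.\<close>
    have "bdd_above ((\<lambda>A. \<bar>measure (\<mu> (n + N)) A - measure P A\<bar>) ` sets M)"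
      using bound by (intro bdd_aboveI2) auto
    from cSUP_upper[OF sets.empty_sets this] show "0 \<le> (SUP A \<in> sets M. \<bar>measure (\<mu> (n + N)) A - measure P A\<bar>)"
      by simp
  qed
  then show "(\<lambda>n. SUP A \<in> sets M. \<bar>measure (\<mu> n) A - measure P A\<bar>) \<longlonglongrightarrow> 0"
    by (rule LIMSEQ_offset)
qed


text \<open>The inverse function theorem differentiates \<open>inv G\<close> without a formula for
  it. Leaving \<open>F\<close> general serves two purposes: the maps of the samples, and the
  identity, which yields continuity of \<open>inv G\<close>.\<close>

lemma avg_map_conjugate_has_derivative:
  fixes A :: "real^'b::finite^'a::finite" and \<gamma> :: "real^'b"
  assumes L: "0 < L" and \<tau>: "0 < \<tau>" and S: "posdef S"
  defines "G \<equiv> avg_map L \<tau> A S \<gamma>" and "D \<equiv> avg_map_deriv L \<tau> A S \<gamma>"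
  assumes F: "(F has_derivative F') (at x)"
  shows "((inv G \<circ> F) has_derivative (*v) (matrix_inv (matrix (D (inv G (F x))))) \<circ> F') (at x)"
    and "det (matrix ((*v) (matrix_inv (matrix (D (inv G (F x))))) \<circ> F')) = det (matrix F') / det (matrix (D (inv G (F x))))"
proof -
  let ?z = "inv G (F x)"
  have inj: "inj G" unfolding G_def by (rule inj_avg_map[OF L \<tau> S])
  have Gz: "G ?z = F x"
    unfolding G_def by (rule surj_f_inv_f[OF surj_avg_map[OF L S \<tau>]])
  have bl: "bounded_linear (D ?z)"
    unfolding D_def using avg_map_has_derivative[OF L] by (rule has_derivative_bounded_linear)
  have M: "invertible (matrix (D ?z))"
    unfolding invertible_det_nz D_def by (rule avg_map_deriv_det_nz[OF L \<tau> S])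
  have "D ?z (matrix_inv (matrix (D ?z)) *v y) = y" for y
    using matrix_inv_vector(1)[OF M] unfolding matrix_vector_mul(3)[OF bl] .
  then have "D ?z \<circ> (*v) (matrix_inv (matrix (D ?z))) = id" by auto
  then have "(inv G has_derivative (*v) (matrix_inv (matrix (D ?z)))) (at (G ?z))"
    by (intro has_derivative_inverse_strong[of UNIV ?z G])
      (use inj continuous_on_avg_map[OF L] avg_map_has_derivative[OF L] in \<open>auto simp: G_def D_def\<close>)
  then show "((inv G \<circ> F) has_derivative (*v) (matrix_inv (matrix (D ?z))) \<circ> F') (at x)"
    unfolding Gz by (rule diff_chain_at[OF F])
  have "det (matrix (D ?z)) * det (matrix_inv (matrix (D ?z))) = 1"
    using matrix_inv(1)[OF M] by (simp add: det_mul[symmetric])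
  then have "det (matrix_inv (matrix (D ?z))) = 1 / det (matrix (D ?z))"
    using M by (simp add: invertible_det_nz eq_divide_eq mult.commute)
  moreover have "linear F'"
    using has_derivative_bounded_linear[OF F] by (simp add: linear_conv_bounded_linear)
  ultimately show "det (matrix ((*v) (matrix_inv (matrix (D ?z))) \<circ> F')) = det (matrix F') / det (matrix (D ?z))"
    by (simp add: matrix_compose[OF _ matrix_vector_mul_linear] det_mul)
qed

theorem theorem8:
  fixes X :: "nat \<Rightarrow> nat \<Rightarrow> real^('k1::finite + 'k2::finite)"
    and Q :: "real^('k1 + 'k2)^('k1 + 'k2)"
    and \<sigma> \<alpha> :: real
    and \<beta> :: "nat \<Rightarrow> real^('k1 + 'k2)"
    and f :: "nat \<Rightarrow> real^('k1 + 'k2) \<Rightarrow> real"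
  assumes sigma_pos: "\<sigma> > 0"
    and alpha_pos: "\<alpha> > 0"
    and rank: "\<forall>n \<ge> CARD('k1 + 'k2). full_col_rank (X n) n"
    and Q_lim: "(\<lambda>n. (1 / real n) *\<^sub>R gram (X n) n) \<longlonglongrightarrow> Q"
    and Q_pd: "posdef Q"
    and f_dens: "\<forall>n \<ge> CARD('k1 + 'k2). f n \<in> borel_measurable lborel \<and> (\<forall>t. f n t \<ge> 0) \<and>
                   law_n \<alpha> \<sigma> (X n) n (\<beta> n) = density lborel (\<lambda>t. ennreal (f n t))"
  shows "(filterlim (\<lambda>n. norm (sqrt (real n) *\<^sub>R vsnd (\<beta> n))) at_top sequentially \<longrightarrow>
            ((\<lambda>n. \<integral>\<^sup>+ t. ennreal \<bar>f n t - gauss_density ((\<sigma>\<^sup>2) *\<^sub>R matrix_inv Q) t\<bar> \<partial>lborel) \<longlonglongrightarrow> 0) \<and>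
            ((\<lambda>n. SUP A \<in> sets lborel. \<bar>measure (law_n \<alpha> \<sigma> (X n) n (\<beta> n)) A
                  - measure (density lborel (\<lambda>t. ennreal (gauss_density ((\<sigma>\<^sup>2) *\<^sub>R matrix_inv Q) t))) A\<bar>)
               \<longlonglongrightarrow> 0))
       \<and> (\<forall>\<gamma> g. (\<lambda>n. sqrt (real n) *\<^sub>R vsnd (\<beta> n)) \<longlonglongrightarrow> \<gamma> \<longrightarrow>
            g \<in> borel_measurable lborel \<longrightarrow> (\<forall>t. g t \<ge> 0) \<longrightarrow>
            lim_law Q \<sigma> \<alpha> \<gamma> = density lborel (\<lambda>t. ennreal (g t)) \<longrightarrow>
            ((\<lambda>n. \<integral>\<^sup>+ t. ennreal \<bar>f n t - g t\<bar> \<partial>lborel) \<longlonglongrightarrow> 0) \<and>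
            ((\<lambda>n. SUP A \<in> sets lborel. \<bar>measure (law_n \<alpha> \<sigma> (X n) n (\<beta> n)) A
                  - measure (lim_law Q \<sigma> \<alpha> \<gamma>) A\<bar>) \<longlonglongrightarrow> 0))"
proof -
  \<comment> \<open>Full rank and densities are assumed only from this sample size on. Shifting
    indices by \<open>N\<close> also keeps the sample size positive.\<close>
  define N where "N = CARD('k1 + 'k2)"
  have N: "0 < N" by (simp add: N_def)
  define L where "L = exp (- 2 * \<alpha> * real CARD('k2))"
  define \<tau> where "\<tau> = \<alpha> / \<sigma>\<^sup>2"
  have L: "0 < L" and \<tau>: "0 < \<tau>" using alpha_pos sigma_pos by (simp_all add: L_def \<tau>_def)
  define Qn where "Qn n = (1 / real (n + N)) *\<^sub>R gram (X (n + N)) (n + N)" for n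
  define \<gamma>n where "\<gamma>n n = sqrt (real (n + N)) *\<^sub>R vsnd (\<beta> (n + N))" for n
  define \<Gamma> where "\<Gamma> = \<sigma>\<^sup>2 *\<^sub>R matrix_inv Q"
  define \<Gamma>n where "\<Gamma>n n = \<sigma>\<^sup>2 *\<^sub>R matrix_inv (Qn n)" for n
  define F where "F n = avg_map L \<tau> (regr (Qn n)) (schur (Qn n)) (\<gamma>n n)" for n
  define F' where "F' n = avg_map_deriv L \<tau> (regr (Qn n)) (schur (Qn n)) (\<gamma>n n)" for n
  have rank': "full_col_rank (X (n + N)) (n + N)" for n
    using rank by (simp add: N_def)
  have Qn: "posdef (Qn n)" for n
    unfolding Qn_def using N by (intro posdef_scaleR posdef_gram rank') simp
  have Qn_lim: "Qn \<longlonglongrightarrow> Q"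
    unfolding Qn_def using LIMSEQ_ignore_initial_segment[OF Q_lim, of N] .
  have sch: "posdef (schur (Qn n))" "posdef (schur Q)" for n
    by (rule posdef_schur[OF Qn], rule posdef_schur[OF Q_pd])
  note AS_lim = tendsto_regr_schur[OF Qn_lim Qn Q_pd]
  have \<Gamma>: "posdef \<Gamma>" "posdef (\<Gamma>n n)" for n
    unfolding \<Gamma>_def \<Gamma>n_def using sigma_pos by (auto intro!: posdef_scaleR posdef_matrix_inv Q_pd Qn)
  have \<Gamma>_lim: "\<Gamma>n \<longlonglongrightarrow> \<Gamma>"
    unfolding \<Gamma>_def \<Gamma>n_def
    by (intro tendsto_scaleR tendsto_const tendsto_matrix_inv Qn_lim always_eventually allI posdef_invertible Qn Q_pd)
  note gauss_lim = tendsto_gauss_density[OF \<Gamma>_lim \<Gamma>(2,1)]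
  have law: "law_n \<alpha> \<sigma> (X (n + N)) (n + N) (\<beta> (n + N))
      = distr (density lborel (\<lambda>t. ennreal (gauss_density (\<Gamma>n n) t))) borel (F n)" for n
    using law_n_avg_map[OF rank' _ sigma_pos, of n \<alpha> "\<beta> (n + N)"] N
    by (simp add: F_def \<Gamma>n_def Qn_def \<gamma>n_def L_def \<tau>_def)
  have F_der: "(F n has_derivative F' n x) (at x)" for n x
    unfolding F_def F'_def by (rule avg_map_has_derivative[OF L])
  have F_inj: "inj (F n)" for n
    unfolding F_def by (rule inj_avg_map[OF L \<tau> sch(1)])
  have F_meas: "F n \<in> borel_measurable borel" for n
    unfolding F_def by (intro borel_measurable_continuous_onI continuous_on_avg_map L)
  have F'_meas: "(\<lambda>x. det (matrix (F' n x))) \<in> borel_measurable borel" for n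
    unfolding F'_def by (intro borel_measurable_continuous_onI continuous_on_det_avg_map_deriv L)
  have gauss_prob: "prob_space (density lborel (\<lambda>t. ennreal (gauss_density \<Delta> t)))"
    if "posdef \<Delta>" for \<Delta> :: "real^('k1 + 'k2)^('k1 + 'k2)"
    using nn_integral_gauss_density[OF that] by (intro prob_spaceI) (simp add: emeasure_density)
  have law_prob: "prob_space (law_n \<alpha> \<sigma> (X n) n (\<beta> n))" if "N \<le> n" for n
  proof -
    have "prob_space (law_n \<alpha> \<sigma> (X (n - N + N)) (n - N + N) (\<beta> (n - N + N)))"
      unfolding law using F_meas by (intro prob_space.prob_space_distr gauss_prob \<Gamma>) simp
    then show ?thesis using that by simp
  qed
  have f: "f n \<in> borel_measurable lborel" "0 \<le> f n t" "law_n \<alpha> \<sigma> (X n) n (\<beta> n) = density lborel (\<lambda>t. ennreal (f n t))"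
    if "N \<le> n" for n t
    using f_dens that by (auto simp: N_def)
  let ?\<beta>2 = "\<lambda>n. sqrt (real n) *\<^sub>R vsnd (\<beta> n)"
  let ?law = "\<lambda>n. law_n \<alpha> \<sigma> (X n) n (\<beta> n)"
  have diverging: "(\<lambda>n. \<integral>\<^sup>+ t. ennreal \<bar>f n t - gauss_density \<Gamma> t\<bar> \<partial>lborel) \<longlonglongrightarrow> 0 \<and>
      (\<lambda>n. SUP A \<in> sets lborel. \<bar>measure (?law n) A - measure (density lborel (\<lambda>t. ennreal (gauss_density \<Gamma> t))) A\<bar>) \<longlonglongrightarrow> 0"
    if "filterlim (\<lambda>n. norm (?\<beta>2 n)) at_top sequentially"
  proof -
    have \<gamma>n: "filterlim (\<lambda>n. norm (\<gamma>n n)) at_top sequentially"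
      unfolding \<gamma>n_def by (rule filterlim_compose[OF that filterlim_add_const_nat_at_top])
    have "\<exists>\<epsilon>. \<epsilon> \<longlonglongrightarrow> 0 \<and> (\<forall>n. \<forall>A\<in>sets borel.
        \<bar>measure (distr (density lborel (\<lambda>x. ennreal (gauss_density (\<Gamma>n n) x))) borel (F n)) A
          - measure (density lborel (\<lambda>x. ennreal (gauss_density \<Gamma> x))) A\<bar> \<le> \<epsilon> n)"
    proof (rule total_variation_pushforward[OF F_der F_inj F'_meas _ _ continuous_on_gauss_density])
      show "(\<lambda>n. F n x) \<longlonglongrightarrow> x" "(\<lambda>n. det (matrix (F' n x))) \<longlonglongrightarrow> 1" for x
        unfolding F_def F'_def by (rule avg_map_diverging_shift[OF L \<tau> AS_lim sch(2) \<gamma>n])+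
    qed (use gauss_lim gauss_density_nonneg[OF \<Gamma>(1)] gauss_density_nonneg[OF \<Gamma>(2)]
        nn_integral_gauss_density[OF \<Gamma>(1)] nn_integral_gauss_density[OF \<Gamma>(2)] in auto)
    then obtain \<epsilon> where \<epsilon>: "\<epsilon> \<longlonglongrightarrow> 0" "\<And>n A. A \<in> sets borel \<Longrightarrow>
        \<bar>measure (?law (n + N)) A - measure (density lborel (\<lambda>x. ennreal (gauss_density \<Gamma> x))) A\<bar> \<le> \<epsilon> n"
      unfolding law by blast
    show ?thesis
      by (intro conjI density_convergence_of_uniform_bound[where N=N and \<epsilon>=\<epsilon> and \<mu>="?law"])
        (use \<epsilon> f law_prob gauss_prob[OF \<Gamma>(1)] gauss_density_nonneg[OF \<Gamma>(1)] in simp_all)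
  qed
  have converging: "(\<lambda>n. \<integral>\<^sup>+ t. ennreal \<bar>f n t - g t\<bar> \<partial>lborel) \<longlonglongrightarrow> 0 \<and>
      (\<lambda>n. SUP A \<in> sets lborel. \<bar>measure (?law n) A - measure (lim_law Q \<sigma> \<alpha> \<gamma>) A\<bar>) \<longlonglongrightarrow> 0"
    if \<gamma>: "?\<beta>2 \<longlonglongrightarrow> \<gamma>" and g: "g \<in> borel_measurable lborel" "\<forall>t. 0 \<le> g t"
      "lim_law Q \<sigma> \<alpha> \<gamma> = density lborel (\<lambda>t. ennreal (g t))" for \<gamma> g
  proof -
    have \<gamma>n: "\<gamma>n \<longlonglongrightarrow> \<gamma>"
      unfolding \<gamma>n_def using LIMSEQ_ignore_initial_segment[OF \<gamma>, of N] .
    define G where "G = avg_map L \<tau> (regr Q) (schur Q) \<gamma>"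
    define D where "D = avg_map_deriv L \<tau> (regr Q) (schur Q) \<gamma>"
    note conj_der = avg_map_conjugate_has_derivative[OF L \<tau> sch(2), where A="regr Q" and \<gamma>=\<gamma>, folded G_def D_def]
    have G_cont: "continuous_on UNIV G" unfolding G_def by (rule continuous_on_avg_map[OF L])
    have [measurable]: "G \<in> borel_measurable borel"
      by (rule borel_measurable_continuous_onI[OF G_cont])
    have G_inv: "inv G (G x) = x" "G (inv G y) = y" for x y
      unfolding G_def
      by (rule inv_f_f[OF inj_avg_map[OF L \<tau> sch(2)]], rule surj_f_inv_f[OF surj_avg_map[OF L sch(2) \<tau>]])
    \<comment> \<open>Undoing the limiting map replaces the limit law by its Gaussian source, so
      that the comparison is again with a map close to the identity.\<close>
    define H where "H n = inv G \<circ> F n" for n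
    define H' where "H' n x = (*v) (matrix_inv (matrix (D (inv G (F n x))))) \<circ> F' n x" for n x
    have H_der: "(H n has_derivative H' n x) (at x)" for n x
      unfolding H_def H'_def by (rule conj_der(1)[OF F_der])
    have H_det: "det (matrix (H' n x)) = det (matrix (F' n x)) / det (matrix (D (H n x)))" for n x
      unfolding H_def H'_def using conj_der(2)[OF F_der] by simp
    have H_cont: "continuous_on UNIV (H n)" for n
      by (meson H_der has_derivative_continuous continuous_at_imp_continuous_on)
    have [measurable]: "H n \<in> borel_measurable borel" "F n \<in> borel_measurable borel"
      "(\<lambda>x. det (matrix (F' n x))) \<in> borel_measurable borel"
      "(\<lambda>x. det (matrix (D x))) \<in> borel_measurable borel" for n
      using F_meas F'_meas borel_measurable_continuous_onI[OF H_cont]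
        borel_measurable_continuous_onI[OF continuous_on_det_avg_map_deriv[OF L]]
      by (auto simp: D_def)
    have H_inj: "inj (H n)" for n
      unfolding H_def
      by (rule inj_compose[OF _ F_inj]) (metis G_inv(2) injI)
    have H_lim: "(\<lambda>n. H n x) \<longlonglongrightarrow> x" for x
    proof -
      \<comment> \<open>With the identity in place of \<open>F\<close> this is differentiability of
        \<open>inv G\<close> itself at \<open>G x\<close>.\<close>
      have "((inv G \<circ> id) has_derivative (*v) (matrix_inv (matrix (D (inv G (id (G x)))))) \<circ> id) (at (G x))"
        by (rule conj_der(1)[OF has_derivative_id])
      then have "isCont (inv G) (G x)" using has_derivative_continuous by fastforce
      moreover have "(\<lambda>n. F n x) \<longlonglongrightarrow> G x"
        unfolding F_def G_def by (rule tendsto_avg_map[OF L AS_lim \<gamma>n tendsto_const])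
      ultimately have "(\<lambda>n. inv G (F n x)) \<longlonglongrightarrow> inv G (G x)" by (rule isCont_tendsto_compose)
      then show ?thesis by (simp add: H_def G_inv)
    qed
    \<comment> \<open>Numerator and denominator of the Jacobian converge to the same nonzero
      determinant, that of \<open>D x\<close>.\<close>
    have H_det_lim: "(\<lambda>n. det (matrix (H' n x))) \<longlonglongrightarrow> 1" for x
    proof -
      have nz: "det (matrix (D x)) \<noteq> 0" unfolding D_def by (rule avg_map_deriv_det_nz[OF L \<tau> sch(2)])
      have "(\<lambda>n. det (matrix (F' n x))) \<longlonglongrightarrow> det (matrix (D x))"
        unfolding F'_def D_def by (rule tendsto_avg_map_deriv[OF L AS_lim \<gamma>n tendsto_const])
      moreover have "(\<lambda>n. det (matrix (D (H n x)))) \<longlonglongrightarrow> det (matrix (D x))"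
        unfolding D_def by (intro tendsto_avg_map_deriv L tendsto_const H_lim)
      ultimately show ?thesis
        unfolding H_det using tendsto_divide[OF _ _ nz] nz by fastforce
    qed
    have "\<exists>\<epsilon>. \<epsilon> \<longlonglongrightarrow> 0 \<and> (\<forall>n. \<forall>A\<in>sets borel.
        \<bar>measure (distr (density lborel (\<lambda>x. ennreal (gauss_density (\<Gamma>n n) x))) borel (H n)) A
          - measure (density lborel (\<lambda>x. ennreal (gauss_density \<Gamma> x))) A\<bar> \<le> \<epsilon> n)"
    proof (rule total_variation_pushforward[OF H_der H_inj _ H_lim H_det_lim continuous_on_gauss_density])
      show "(\<lambda>x. det (matrix (H' n x))) \<in> borel_measurable borel" for n
        unfolding H_det by measurable
    qed (use gauss_lim gauss_density_nonneg[OF \<Gamma>(1)] gauss_density_nonneg[OF \<Gamma>(2)]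
        nn_integral_gauss_density[OF \<Gamma>(1)] nn_integral_gauss_density[OF \<Gamma>(2)] in auto)
    then obtain \<epsilon> where \<epsilon>: "\<epsilon> \<longlonglongrightarrow> 0" "\<And>n A. A \<in> sets borel \<Longrightarrow>
        \<bar>measure (distr (density lborel (\<lambda>x. ennreal (gauss_density (\<Gamma>n n) x))) borel (H n)) A
          - measure (density lborel (\<lambda>x. ennreal (gauss_density \<Gamma> x))) A\<bar> \<le> \<epsilon> n"
      by blast
    have limlaw: "lim_law Q \<sigma> \<alpha> \<gamma> = distr (density lborel (\<lambda>t. ennreal (gauss_density \<Gamma> t))) borel G"
      using lim_law_avg_map[OF Q_pd sigma_pos] by (simp add: G_def \<Gamma>_def L_def \<tau>_def)
    have bound: "\<bar>measure (?law (n + N)) A - measure (lim_law Q \<sigma> \<alpha> \<gamma>) A\<bar> \<le> \<epsilon> n"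
      if A: "A \<in> sets borel" for n A
    proof -
      \<comment> \<open>The bijection \<open>G\<close> turns the event \<open>A\<close> for the
        sample law into its preimage for the law pushed by \<open>H n\<close>, and likewise for the
        limit law, so the bound carries over unchanged.\<close>
      have GA: "G -` A \<in> sets borel"
        using measurable_sets[of G borel borel A] A by simp
      have "H n -` (G -` A) = F n -` A" by (auto simp: H_def G_inv)
      then have "measure (?law (n + N)) A
          = measure (distr (density lborel (\<lambda>x. ennreal (gauss_density (\<Gamma>n n) x))) borel (H n)) (G -` A)"
        unfolding law using A GA by (simp add: measure_distr)
      moreover have "measure (lim_law Q \<sigma> \<alpha> \<gamma>) A = measure (density lborel (\<lambda>x. ennreal (gauss_density \<Gamma> x))) (G -` A)"
        unfolding limlaw using A by (simp add: measure_distr)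
      ultimately show ?thesis using \<epsilon>(2)[OF GA, of n] by simp
    qed
    have lim_prob: "prob_space (lim_law Q \<sigma> \<alpha> \<gamma>)"
      unfolding limlaw by (intro prob_space.prob_space_distr gauss_prob \<Gamma>) simp
    show ?thesis
      by (intro conjI density_convergence_of_uniform_bound[where N=N and \<epsilon>=\<epsilon> and \<mu>="?law"])
        (use \<epsilon>(1) bound f law_prob lim_prob g in simp_all)
  qed
  show ?thesis
    using diverging converging unfolding \<Gamma>_def by blast
qed

end
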